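(* Let $m\geq 1$ and $n\geq 1$ be integers and let $R\cong S\times T$ with $S=\prod_{i=1}^{m}R_{i}$ and $T=\prod_{j=1}^{n}\mathbb{F}_{j}$, where for every $1\leq i\leq m$, $R_{i}$ is a local Artinian principal ideal ring that is not a field, and $\mathbb{F}_{j}$ is a field for every $1\leq j\leq n$. Put $n_{i}=|I(R_{i})|$ for $1\leq i\leq m$. Then: 1) If $m=n=1$, then $\dim_M(In(R))=n+m+n_{1}-2=n_{1}$. 2) If $m=1$ and $n=2$, then $\dim_M(In(R))=n+m+n_{1}-1=n_{1}+2$. 3) If $n\geq 3$, then $\dim_M(In(R))=\left(\sum_{i=1}^{m}n_{i}\right)+m+n$.
   Context: All rings are commutative with identity. $I(R)$ denotes the set of non-trivial ideals of $R$ (ideals different from $0$ and $R$). The inclusion ideal graph $In(R)$ is the simple graph with vertex set $I(R)$, two distinct vertices being adjacent if and only if one of them is properly contained in the other. A local Artinian principal ideal ring has only finitely many ideals, and they are totally ordered by inclusion. For a graph $G$, $d(x,y)$ denotes the distance between vertices. For an ordered set $S=\{v_1,\dots,v_k\}\subseteq V(G)$ and $v\in V(G)\setminus S$, the representation vector of $v$ is $D(v|S)=(d(v,v_1),\dots,d(v,v_k))$. $S$ is resolving if distinct vertices outside $S$ have different representation vectors with respect to $S$. The metric dimension $\dim_M(G)$ is the minimum cardinality of a resolving set. *)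

theory Defs
  imports
    "HOL-Algebra.Chinese_Remainder"
    "HOL-Library.Extended_Nat"
    "Graph_Theory.Graph_Theory"
begin

locale local_ring = cring +
  assumes unique_maximal: "\<exists>!M. maximalideal M R"

locale artinian_ring = cring +
  assumes descending_chain_condition:
    "\<lbrakk>\<And>k :: nat. ideal (J k) R; \<And>k. J (Suc k) \<subseteq> J k\<rbrakk> \<Longrightarrow> \<exists>N. \<forall>k\<ge>N. J k = J N"

(* The library's principal_domain also requires a domain; zero divisors are allowed here. *)
locale principal_ideal_ring = cring +
  assumes all_ideals_principal: "ideal I R \<Longrightarrow> principalideal I R"

definition nontrivial_ideals :: "('a, 'b) ring_scheme \<Rightarrow> 'a set set" where
  "nontrivial_ideals R = {I. ideal I R \<and> I \<noteq> {\<zero>\<^bsub>R\<^esub>} \<and> I \<noteq> carrier R}"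

(* An undirected simple graph is a loop-free digraph without parallel arcs in which
   every arc occurs together with its reversal, see the lemma below. *)
definition inclusion_ideal_graph :: "('a, 'b) ring_scheme \<Rightarrow> 'a set pair_pre_digraph" where
  "inclusion_ideal_graph R =
     \<lparr> pverts = nontrivial_ideals R,
       parcs = {(I, J). I \<in> nontrivial_ideals R \<and> J \<in> nontrivial_ideals R \<and> (I \<subset> J \<or> J \<subset> I)} \<rparr>"

lemma inclusion_ideal_graph_simple: "pair_bidirected_digraph (inclusion_ideal_graph R)"
  by unfold_locales
     (auto simp: inclusion_ideal_graph_def symmetric_def arcs_ends_conv sym_def)

(* Infinite if v is not reachable from u. *)
definition graph_dist :: "'a pair_pre_digraph \<Rightarrow> 'a \<Rightarrow> 'a \<Rightarrow> ereal" where
  "graph_dist G u v = wf_digraph.\<mu> (with_proj G) (\<lambda>_. 1) u v"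

(* An ordered set of vertices is a list without repetitions. *)
definition representation_vector :: "'a pair_pre_digraph \<Rightarrow> 'a list \<Rightarrow> 'a \<Rightarrow> ereal list" where
  "representation_vector G vs v = map (graph_dist G v) vs"

definition resolving :: "'a pair_pre_digraph \<Rightarrow> 'a list \<Rightarrow> bool" where
  "resolving G vs \<longleftrightarrow>
     distinct vs \<and> set vs \<subseteq> pverts G \<and>
     inj_on (representation_vector G vs) (pverts G - set vs)"

(* Infinite if there is no finite resolving set. *)
definition metric_dimension :: "'a pair_pre_digraph \<Rightarrow> enat" where
  "metric_dimension G = (INF vs \<in> {vs. resolving G vs}. enat (length vs))"

end

(* An ideal of a finite product of chain rings is a vector of lengths, so the graph lives on a product of
   chains {0..L_1} x ... x {0..L_k} without bottom and top, where a field contributes L = 1. Two vertices are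
   at distance 1 if they are comparable, at distance at least 3 if they are complementary, and at distance 2
   otherwise. The nonzero multiples of the unit vectors form a resolving set of size L_1 + ... + L_k.

   For n >= 3 this is optimal. Split off three field coordinates and take a maximal chain in the product of
   the others. Over this chain lies a copy of the crown of the six inner elements of the cube of rank 3, and
   these 6 (N + 1) vertices alone have to be separated. A member of the resolving set whose trace on the cube
   is 000 or 111 separates only one step of the chain. If the remaining members were too few, a double count
   would leave at most four other steps, and these finitely many configurations are refuted by a search that
   is run inside the kernel. For n = 1 and n = 2, m = 1, the shorter optimal sets are found by hand. *)

theory Submission
  imports Defs "HOL-Algebra.Ring_Divisibility"
begin

text \<open>Three field coordinates have to be treated together: beside a single chain, one or two
  of them admit smaller sets than the one on the axes, as the cases n = 1 and n = 2 show. The chain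
  must have no complements inside, which is where a factor that is not a field enters. As far as
  comparabilities go, a test vertex over the chain is given by two thresholds and one element of the
  crown. It separates at most four pairs at steps of the chain, the constant being the joint size of
  the up-set and the down-set of a crown element. If \<open>d\<close> steps remain and only
  \<open>d + 2\<close> test vertices, then \<open>6 d <= 4 (d + 2)\<close>, so
  \<open>d <= 4\<close>. The obstacle is these small values: for \<open>d <= 1\<close> the
  pigeonhole principle is enough, while \<open>d = 2, 3, 4\<close> need the search. Only the
  adjacency of the remaining steps matters and not the gaps between them, so the list of cases does
  not depend on the ring. The search has to be sound in one direction only: \<open>True\<close>
  certifies impossibility, hence it may range over more configurations than can occur.\<close>

section \<open>A search on the crown\<close>

text \<open>The inner elements of the cube of rank 3: \<open>A\<^sub>i\<close> is an atom and \<open>B\<^sub>i\<close> its complement.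
  A set of them is coded by its characteristic vector in the order \<open>A1, B1, A2, B2, A3, B3\<close>.\<close>
datatype hex = A1 | B1 | A2 | B2 | A3 | B3
datatype six = Six bool bool bool bool bool bool
text \<open>Position of a test vertex relative to a level of the chain. The suffix \<open>C\<close> marks that the chain parts are
  bottom and top, where complementary vertices exist.\<close>
datatype status = Above | Apart | At | Below | AboveC | BelowC

section \<open>Order of the crown and coded sets of its elements\<close>

fun compl6 :: "hex \<Rightarrow> hex" where
  "compl6 A1 = B1" | "compl6 A2 = B2" | "compl6 A3 = B3"
| "compl6 B1 = A1" | "compl6 B2 = A2" | "compl6 B3 = A3"

fun ups :: "hex \<Rightarrow> hex list" where
  "ups A1 = [A1, B2, B3]" | "ups A2 = [A2, B1, B3]" | "ups A3 = [A3, B1, B2]"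
| "ups B1 = [B1]" | "ups B2 = [B2]" | "ups B3 = [B3]"

fun dns :: "hex \<Rightarrow> hex list" where
  "dns B1 = [B1, A2, A3]" | "dns B2 = [B2, A1, A3]" | "dns B3 = [B3, A1, A2]"
| "dns A1 = [A1]" | "dns A2 = [A2]" | "dns A3 = [A3]"

definition hle :: "hex \<Rightarrow> hex \<Rightarrow> bool" where "hle x y \<longleftrightarrow> y \<in> set (ups x)"

fun upr :: "hex \<Rightarrow> six" where
  "upr A1 = Six True False False True False True"
| "upr A2 = Six False True True False False True"
| "upr A3 = Six False True False True True False"
| "upr B1 = Six False True False False False False"
| "upr B2 = Six False False False True False False"
| "upr B3 = Six False False False False False True"

fun dnr :: "hex \<Rightarrow> six" where
  "dnr B1 = Six False True True False True False"
| "dnr B2 = Six True False False True True False"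
| "dnr B3 = Six True False True False False True"
| "dnr A1 = Six True False False False False False"
| "dnr A2 = Six False False True False False False"
| "dnr A3 = Six False False False False True False"

fun ptr :: "hex \<Rightarrow> six" where
  "ptr A1 = Six True False False False False False"
| "ptr B1 = Six False True False False False False"
| "ptr A2 = Six False False True False False False"
| "ptr B2 = Six False False False True False False"
| "ptr A3 = Six False False False False True False"
| "ptr B3 = Six False False False False False True"

abbreviation six0 :: six where "six0 \<equiv> Six False False False False False False"
abbreviation six1 :: six where "six1 \<equiv> Six True True True True True True"

fun uni :: "six \<Rightarrow> six \<Rightarrow> six" where
  "uni (Six a b c d e f) (Six a' b' c' d' e' f') =
     Six (a \<or> a') (b \<or> b') (c \<or> c') (d \<or> d') (e \<or> e') (f \<or> f')"

fun dif :: "six \<Rightarrow> six \<Rightarrow> six" where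
  "dif (Six a b c d e f) (Six a' b' c' d' e' f') =
     Six (\<not> a' \<and> a) (\<not> b' \<and> b) (\<not> c' \<and> c) (\<not> d' \<and> d) (\<not> e' \<and> e) (\<not> f' \<and> f)"

fun get :: "six \<Rightarrow> hex \<Rightarrow> bool" where
  "get (Six a b c d e f) A1 = a" | "get (Six a b c d e f) B1 = b"
| "get (Six a b c d e f) A2 = c" | "get (Six a b c d e f) B2 = d"
| "get (Six a b c d e f) A3 = e" | "get (Six a b c d e f) B3 = f"

section \<open>What a single test vertex sees and covers\<close>

fun cmpr :: "status \<Rightarrow> hex \<Rightarrow> six" where
  "cmpr Above x = dnr x" | "cmpr AboveC x = dnr x"
| "cmpr Below x = upr x" | "cmpr BelowC x = upr x"
| "cmpr Apart x = six0" | "cmpr At x = uni (upr x) (dnr x)"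

fun sngr :: "status \<Rightarrow> hex \<Rightarrow> six" where
  "sngr AboveC x = ptr (compl6 x)" | "sngr BelowC x = ptr (compl6 x)"
| "sngr At x = ptr x" | "sngr _ x = six0"

text \<open>The last clause serves the status pairs that stay constant along a step, and those that
  never occur in succession.\<close>

fun covr :: "status \<Rightarrow> status \<Rightarrow> hex \<Rightarrow> six" where
  "covr Above Apart x = dnr x" | "covr At Below x = dnr x"
| "covr Apart Below x = upr x" | "covr Above At x = upr x"
| "covr Above Below x = dif (uni (upr x) (dnr x)) (ptr x)"
| "covr AboveC Above x = ptr (compl6 x)" | "covr AboveC At x = uni (upr x) (ptr (compl6 x))"
| "covr Below BelowC x = ptr (compl6 x)" | "covr At BelowC x = uni (dnr x) (ptr (compl6 x))"
| "covr _ _ x = six0"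

text \<open>The relation \<open>covr\<close> read from the side of the covered element
  \<open>y\<close>, so that the search can list the candidates for covering a given pair.\<close>

fun covx :: "status \<Rightarrow> status \<Rightarrow> hex \<Rightarrow> hex list" where
  "covx Above Apart y = ups y" | "covx At Below y = ups y"
| "covx Apart Below y = dns y" | "covx Above At y = dns y"
| "covx Above Below y = tl (ups y) @ tl (dns y)"
| "covx AboveC Above y = [compl6 y]" | "covx AboveC At y = compl6 y # dns y"
| "covx Below BelowC y = [compl6 y]" | "covx At BelowC y = compl6 y # ups y"
| "covx _ _ y = []"

fun cover :: "status list \<Rightarrow> hex \<Rightarrow> six list" where
  "cover (a # b # w) x = covr a b x # cover (b # w) x" | "cover _ x = []"

fun difs :: "six list \<Rightarrow> six list \<Rightarrow> six list" where
  "difs (r # rs) (c # cs) = dif r c # difs rs cs" | "difs rs _ = rs"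

text \<open>The flag list only supplies a length, here and in the enumerations of words
  below.\<close>

fun reps :: "status \<Rightarrow> bool list \<Rightarrow> status list" where
  "reps s [] = []" | "reps s (_ # n) = s # reps s n"

text \<open>Going up the chain, a test vertex is above the levels for a while, possibly
  \<open>At\<close> one level or \<open>Apart\<close> from several, and below all further ones.
  These are the words that begin after the levels marked \<open>Above\<close> and contain no
  \<open>At\<close>.\<close>

fun words2 :: "bool list \<Rightarrow> status list list" where
  "words2 [] = [[]]"
| "words2 (g # n) = (Below # reps Below n) # map (Cons Apart) (words2 n)"

fun words1 :: "bool list \<Rightarrow> status list list" where
  "words1 [] = [[]]"
| "words1 (g # n) = (At # reps Below n) # map (Cons Above) (words1 n) @ words2 (g # n)"

fun snoc :: "status list \<Rightarrow> status \<Rightarrow> status list" where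
  "snoc [] s = [s]" | "snoc (a # l) s = a # snoc l s"

text \<open>If complements occur, the chain part of the test vertex is top or bottom of the chain.
  This fixes the word except for whether the end at which the vertex itself sits is among the
  levels.\<close>

fun words :: "bool list \<Rightarrow> status list list" where
  "words (g # h # n) = words1 (g # h # n) @
     [AboveC # reps Above (h # n), AboveC # snoc (reps Above n) At,
      snoc (Below # reps Below n) BelowC, snoc (At # reps Below n) BelowC]"
| "words _ = []"

fun covxs :: "six list \<Rightarrow> hex \<Rightarrow> status list \<Rightarrow> hex list" where
  "covxs [] y (a # b # w) = covx a b y" | "covxs (_ # r) y (a # w) = covxs r y w" | "covxs _ y _ = []"

fun first :: "six \<Rightarrow> hex option" where
  "first (Six a b c d e f) = (if a then Some A1 else if b then Some B1 else if c then Some A2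
     else if d then Some B2 else if e then Some A3 else if f then Some B3 else None)"

fun pick :: "six list \<Rightarrow> six list \<Rightarrow> (six list \<times> hex) option" where
  "pick acc [] = None"
| "pick acc (r # rs) = (case first r of Some y \<Rightarrow> Some (acc, y) | None \<Rightarrow> pick (six0 # acc) rs)"

fun inc :: "bool \<Rightarrow> nat \<Rightarrow> nat" where "inc True n = Suc n" | "inc False n = n"

fun cnt :: "six list \<Rightarrow> nat" where
  "cnt [] = 0" | "cnt (Six a b c d e f # rs) = inc a (inc b (inc c (inc d (inc e (inc f (cnt rs))))))"

text \<open>Comparison and multiplication by four are done in unary because the search is evaluated
  by rewriting.\<close>

fun over :: "nat \<Rightarrow> nat \<Rightarrow> bool" where
  "over 0 n = False" | "over (Suc m) 0 = True" | "over (Suc m) (Suc n) = over m n"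

fun quad :: "nat \<Rightarrow> nat" where "quad 0 = 0" | "quad (Suc n) = Suc (Suc (Suc (Suc (quad n))))"

fun sngs :: "status list \<Rightarrow> hex list \<Rightarrow> six" where
  "sngs (s # ss) (x # xs) = uni (sngr s x) (sngs ss xs)" | "sngs _ _ = six0"

fun add6 :: "six \<Rightarrow> bool list list \<Rightarrow> bool list list" where
  "add6 (Six a b c d e f) [p, q, r, s, t, u] = [a # p, b # q, c # r, d # s, e # t, f # u]"
| "add6 _ _ = []"

fun pat6 :: "status list \<Rightarrow> hex list \<Rightarrow> bool list list" where
  "pat6 (s # ss) (x # xs) = add6 (cmpr s x) (pat6 ss xs)" | "pat6 _ _ = [[], [], [], [], [], []]"

fun insp :: "six \<Rightarrow> bool list list \<Rightarrow> bool list list \<Rightarrow> bool list list" where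
  "insp (Six a b c d e f) [p, q, r, s, t, u] acc =
    (let l = (if f then acc else u # acc); l = (if e then l else t # l); l = (if d then l else s # l);
         l = (if c then l else r # l); l = (if b then l else q # l) in (if a then l else p # l))"
| "insp _ _ acc = acc"

fun bmem :: "bool list \<Rightarrow> bool list list \<Rightarrow> bool" where
  "bmem x [] = False" | "bmem x (y # l) = (if x = y then True else bmem x l)"
fun dup :: "bool list list \<Rightarrow> bool" where
  "dup [] = False" | "dup (x # l) = (if bmem x l then True else dup l)"
fun hds :: "status list list \<Rightarrow> status list" where "hds [] = []" | "hds (w # ws) = hd w # hds ws"
fun tls :: "status list list \<Rightarrow> status list list" where "tls [] = []" | "tls (w # ws) = tl w # tls ws"

text \<open>The accumulator holds the comparability patterns of those vertices of the current block
  that no test vertex singles out; a repeated pattern is a pair left unseparated. The accumulator is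
  emptied between blocks, since vertices of different blocks may be separated by members outside the
  configuration.\<close>

fun collide :: "bool list \<Rightarrow> bool list list \<Rightarrow> status list list \<Rightarrow> hex list \<Rightarrow> bool" where
  "collide [] acc ws xs = False"
| "collide (g # gs) acc ws xs =
    (let acc' = insp (sngs (hds ws) xs) (pat6 (hds ws) xs) acc in
     if g then collide gs acc' (tls ws) xs else if dup acc' then True else collide gs [] (tls ws) xs)"

text \<open>Some test vertex must cover the first uncovered pair, so branching over the test vertices that do is
  complete. As each covers at most four pairs, a branch with more than \<open>4 k\<close> uncovered pairs and \<open>k\<close> test vertices
  left is cut off. At the leaves two vertices within one block of consecutive levels must agree on all tests.\<close>
primrec dfs :: "bool list \<Rightarrow> nat \<Rightarrow> status list list \<Rightarrow> hex list \<Rightarrow> six list \<Rightarrow> bool" where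
  "dfs g 0 ws xs rem = (case pick [] rem of None \<Rightarrow> collide g [] ws xs | Some _ \<Rightarrow> True)"
| "dfs g (Suc k) ws xs rem = (case pick [] rem of None \<Rightarrow> False
     | Some iy \<Rightarrow> list_all (\<lambda>w. list_all (\<lambda>x.
        (let rem' = difs rem (cover w x) in
         if over (cnt rem') (quad k) then True else dfs g k (w # ws) (x # xs) rem')) (covxs (fst iy) (snd iy) w)) (words g))"

fun rem0 :: "bool list \<Rightarrow> six list" where
  "rem0 (True # g # gs) = six1 # rem0 (g # gs)"
| "rem0 (False # g # gs) = six0 # rem0 (g # gs)"
| "rem0 _ = []"

text \<open>Entry \<open>i\<close> of \<open>g\<close> tells whether the step from level \<open>i\<close> to the next one has to be resolved by the test vertices;
  a \<open>False\<close> closes a block of consecutive levels.\<close>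
definition refuted :: "nat \<Rightarrow> bool list \<Rightarrow> bool" where
  "refuted z g \<longleftrightarrow> dfs g z [] [] (rem0 g)"

section \<open>Correctness of the coding, and test vertices over a chain of crowns\<close>

lemma get_ptr: "get (ptr x) y \<longleftrightarrow> y = x" by (cases x; cases y) auto
lemma get_upr: "get (upr x) y \<longleftrightarrow> hle x y" by (cases x; cases y) (auto simp: hle_def)
lemma get_dnr: "get (dnr x) y \<longleftrightarrow> hle y x" by (cases x; cases y) (auto simp: hle_def)
lemma get_uni: "get (uni r s) y \<longleftrightarrow> get r y \<or> get s y" by (cases r; cases s; cases y) auto
lemma get_dif: "get (dif r s) y \<longleftrightarrow> get r y \<and> \<not> get s y" by (cases r; cases s; cases y) auto
lemma get_six0: "\<not> get six0 y" by (cases y) auto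
lemma get_six1: "get six1 y" by (cases y) auto
lemma hle_refl: "hle x x" by (cases x) (auto simp: hle_def)
lemma hle_antisym: "hle x y \<Longrightarrow> hle y x \<Longrightarrow> x = y" by (cases x; cases y) (auto simp: hle_def)
lemma set_ups: "y \<in> set (ups x) \<longleftrightarrow> hle x y" by (simp add: hle_def)
lemma set_dns: "y \<in> set (dns x) \<longleftrightarrow> hle y x" by (cases x; cases y) (auto simp: hle_def)

lemmas get_simps = get_ptr get_upr get_dnr get_uni get_dif get_six0 get_six1

lemma covx_covr: "x \<in> set (covx a b y) \<longleftrightarrow> get (covr a b x) y"
  by (cases a; cases b; cases x; cases y) auto

text \<open>An atom has three elements above and one below, itself included, and a coatom the
  reverse. This is the source of the factor four in \<open>quad\<close>.\<close>

lemma card_ups_dns: "card (set (ups x)) + card (set (dns x)) = 4"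
  by (cases x) auto
lemma card_ups_dns_le: "card (set (ups x)) \<le> 3" "card (set (dns x)) \<le> 3"
  by (cases x; auto)+

text \<open>The chain part of the test vertex \<open>w\<close> is below level \<open>v\<close> iff \<open>p w \<le> v\<close> and above it iff \<open>v \<le> q w\<close>; its trace on the
  cube is \<open>x w\<close>.\<close>
locale hexconf =
  fixes W :: "'w set" and q p :: "'w \<Rightarrow> nat" and x :: "'w \<Rightarrow> hex" and N :: nat
  assumes finW: "finite W" and qp: "w \<in> W \<Longrightarrow> q w \<le> p w" and pN: "w \<in> W \<Longrightarrow> p w \<le> N"
    and N2: "2 \<le> N"
begin

definition comp :: "'w \<Rightarrow> nat \<Rightarrow> hex \<Rightarrow> bool" where
  "comp w v y \<longleftrightarrow> p w \<le> v \<and> hle (x w) y \<or> v \<le> q w \<and> hle y (x w)"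

text \<open>Vertices separated from all others by \<open>w\<close>: \<open>w\<close> itself and its complement.\<close>
definition sing :: "'w \<Rightarrow> nat \<Rightarrow> hex \<Rightarrow> bool" where
  "sing w v y \<longleftrightarrow> q w = v \<and> p w = v \<and> y = x w
     \<or> y = compl6 (x w) \<and> (v = 0 \<and> q w = N \<or> v = N \<and> p w = 0)"

text \<open>The pair in question consists of \<open>(v, y)\<close> and \<open>(Suc v, y)\<close>:
  one step of the chain over a fixed element of the crown.\<close>

definition covers :: "'w \<Rightarrow> nat \<Rightarrow> hex \<Rightarrow> bool" where
  "covers w v y \<longleftrightarrow> comp w v y \<noteq> comp w (Suc v) y \<or> sing w v y \<or> sing w (Suc v) y"

text \<open>Comparability changes at two steps at most: the one leaving \<open>q w\<close>, where
  the down-set of \<open>x w\<close> is lost, and the one entering \<open>p w\<close>, where its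
  up-set is gained. Together these have four elements. If the chain part is an end of the chain,
  only one of the two steps exists, with at most three elements, and the complement over the other
  end adds one.\<close>

lemma covers_card:
  assumes w: "w \<in> W"
  shows "finite {(v, y). v < N \<and> covers w v y} \<and> card {(v, y). v < N \<and> covers w v y} \<le> 4"
proof -
  let ?A = "{(v, y). v < N \<and> covers w v y}"
  note qp' = qp[OF w] pN[OF w] N2
  have bound: "finite ?A \<and> card ?A \<le> 4" if "?A \<subseteq> B" "finite B" "card B \<le> 4" for B
    using that card_mono[OF that(2,1)] finite_subset[OF that(1,2)] by simp
  consider "p w = 0" | "q w = N" "p w = N" "p w \<noteq> 0" | "p w \<noteq> 0" "q w < N" using qp' by linarith
  then show ?thesis
  proof cases
    case 1
    let ?B = "Pair 0 ` set (dns (x w)) \<union> {(N - 1, compl6 (x w))}"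
    have "?A \<subseteq> ?B"
      using 1 qp' hle_refl by (auto simp: covers_def comp_def sing_def set_dns)
    moreover have "card ?B \<le> 4"
      using card_Un_le[of "Pair 0 ` set (dns (x w))" "{(N - 1, compl6 (x w))}"]
        card_image_le[of "set (dns (x w))" "Pair (0::nat)"] card_ups_dns_le(2)[of "x w"] by simp
    ultimately show ?thesis by (intro bound) auto
  next
    case 2
    let ?B = "Pair (N - 1) ` set (ups (x w)) \<union> {(0, compl6 (x w))}"
    have "?A \<subseteq> ?B"
    proof (clarsimp simp del: One_nat_def)
      fix v y assume v: "v < N" "covers w v y" "(v, y) \<notin> Pair (N - 1) ` set (ups (x w))"
      then show "v = 0 \<and> y = compl6 (x w)"
        using 2 qp' hle_refl by (cases "Suc v = N") (auto simp: covers_def comp_def sing_def set_ups image_iff)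
    qed
    moreover have "card ?B \<le> 4"
      using card_Un_le[of "Pair (N - 1) ` set (ups (x w))" "{(0, compl6 (x w))}"]
        card_image_le[of "set (ups (x w))" "Pair (N - 1)"] card_ups_dns_le(1)[of "x w"] by simp
    ultimately show ?thesis by (intro bound) auto
  next
    case 3
    let ?B = "Pair (p w - 1) ` set (ups (x w)) \<union> Pair (q w) ` set (dns (x w))"
    have "?A \<subseteq> ?B"
    proof clarify
      fix v y assume v: "v < N" "covers w v y" "(v, y) \<notin> Pair (q w) ` set (dns (x w))"
      then have "\<not> (v = q w \<and> hle y (x w))" by (auto simp: set_dns)
      moreover have "v = p w - 1 \<and> hle (x w) y \<or> v = q w \<and> hle y (x w)"
        using v(1,2) 3 qp' hle_refl by (auto simp: covers_def comp_def sing_def le_Suc_eq not_le)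
      ultimately show "(v, y) \<in> Pair (p w - 1) ` set (ups (x w))" by (auto simp: set_ups)
    qed
    moreover have "card ?B \<le> 4"
      using card_Un_le[of "Pair (p w - 1) ` set (ups (x w))" "Pair (q w) ` set (dns (x w))"]
        card_image_le[of "set (ups (x w))" "Pair (p w - 1)"]
        card_image_le[of "set (dns (x w))" "Pair (q w)"] card_ups_dns[of "x w"] by simp
    ultimately show ?thesis by (intro bound) auto
  qed
qed

definition stat :: "'w \<Rightarrow> nat \<Rightarrow> status" where
  "stat w v = (if p w \<le> v \<and> v \<le> q w then At
     else if v \<le> q w then (if v = 0 \<and> q w = N then AboveC else Above)
     else if p w \<le> v then (if v = N \<and> p w = 0 then BelowC else Below) else Apart)"

lemma cmpr_stat: "w \<in> W \<Longrightarrow> get (cmpr (stat w v) (x w)) y \<longleftrightarrow> comp w v y"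
  by (auto simp: stat_def comp_def get_simps)

lemma sngr_stat: "w \<in> W \<Longrightarrow> get (sngr (stat w v) (x w)) y \<longleftrightarrow> sing w v y"
  using qp[of w] pN[of w] N2 by (auto simp: stat_def sing_def get_simps)

lemma stat_Suc:
  assumes "w \<in> W" "Suc v \<le> N"
  shows "(stat w v, stat w (Suc v)) \<in> {(Above, Above), (Above, Apart), (Above, At), (Above, Below), (At, Below),
    (Apart, Apart), (Apart, Below), (Below, Below), (AboveC, Above), (AboveC, At), (Below, BelowC), (At, BelowC)}"
  using qp[of w] pN[of w] N2 assms by (auto simp: stat_def)

text \<open>Once the two statuses are known the levels no longer matter, and a finite case
  distinction over the crown remains.\<close>

lemma covr_aux:
  assumes "(a, b) \<in> {(Above, Above), (Above, Apart), (Above, At), (Above, Below), (At, Below),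
    (Apart, Apart), (Apart, Below), (Below, Below), (AboveC, Above), (AboveC, At), (Below, BelowC), (At, BelowC)}"
    and "get (cmpr a z) y \<noteq> get (cmpr b z) y \<or> get (sngr a z) y \<or> get (sngr b z) y"
  shows "get (covr a b z) y"
  using assms hle_refl hle_antisym by (auto simp: get_simps)

lemma covr_stat:
  assumes "w \<in> W" "Suc v \<le> N" "covers w v y"
  shows "get (covr (stat w v) (stat w (Suc v)) (x w)) y"
  by (rule covr_aux[OF stat_Suc[OF assms(1,2)]])
    (use assms in \<open>simp add: cmpr_stat sngr_stat covers_def\<close>)

lemma stat_words2:
  assumes "w \<in> W" "sorted lv" "distinct lv" "\<And>v. v \<in> set lv \<Longrightarrow> q w < v \<and> \<not> (v = N \<and> p w = 0)" "length g = length lv"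
  shows "map (stat w) lv \<in> set (words2 g)"
  using assms
proof (induction lv arbitrary: g)
  case (Cons v lv)
  then obtain b g' where g: "g = b # g'" by (cases g) auto
  show ?case
  proof (cases "p w \<le> v")
    case True
    have "map (stat w) lv = reps Below g'"
    proof -
      have "\<forall>u \<in> set (v # lv). stat w u = Below"
        using Cons.prems(2,4) True by (fastforce simp: stat_def)
      moreover have "length g' = length lv" using Cons.prems g by simp
      ultimately show ?thesis
      proof (induction lv arbitrary: g')
        case (Cons a l) then show ?case by (cases g') auto
      qed auto
    qed
    moreover have "stat w v = Below" using True Cons.prems(4)[of v] by (auto simp: stat_def)
    ultimately show ?thesis using g by simp
  next
    case False
    then have "stat w v = Apart" using Cons.prems(4)[of v] by (auto simp: stat_def)
    then show ?thesis using Cons g by auto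
  qed
qed auto

lemma map_stat_reps:
  assumes "\<forall>u \<in> set lv. stat w u = s" "length g' = length lv"
  shows "map (stat w) lv = reps s g'"
  using assms
proof (induction lv arbitrary: g')
  case (Cons a l) then show ?case by (cases g') auto
qed auto

lemma stat_words1:
  assumes "w \<in> W" "sorted lv" "distinct lv" "length g = length lv"
    "\<And>v. v \<in> set lv \<Longrightarrow> v \<le> N \<and> \<not> (v = N \<and> p w = 0) \<and> \<not> (v = 0 \<and> q w = N)"
  shows "map (stat w) lv \<in> set (words1 g)"
  using assms
proof (induction lv arbitrary: g)
  case (Cons v lv)
  then obtain b g' where g: "g = b # g'" by (cases g) auto
  have gt: "v < u" if "u \<in> set lv" for u using Cons.prems(2,3) that by (auto simp: order_less_le)
  have qpw: "q w \<le> p w" using qp Cons.prems by auto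
  consider "p w \<le> v" "v \<le> q w" | "v \<le> q w" "v < p w" | "q w < v" by linarith
  then show ?case
  proof cases
    case 1
    have "map (stat w) lv = reps Below g'"
    proof (rule map_stat_reps)
      show "\<forall>u\<in>set lv. stat w u = Below"
        using 1 gt Cons.prems(5) qpw by (fastforce simp: stat_def)
    qed (use Cons.prems g in auto)
    moreover have "stat w v = At" using 1 by (simp add: stat_def)
    ultimately show ?thesis using g by simp
  next
    case 2
    then have "stat w v = Above" using Cons.prems(5)[of v] by (auto simp: stat_def)
    then show ?thesis using Cons g by auto
  next
    case 3
    have "map (stat w) (v # lv) \<in> set (words2 g)"
      by (rule stat_words2) (use Cons.prems 3 gt in force)+
    moreover have "set (words2 g) \<subseteq> set (words1 g)" using g by (auto simp del: words2.simps)
    ultimately show ?thesis by blast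
  qed
qed auto

lemma snoc_append: "snoc l s = l @ [s]" by (induction l) auto

text \<open>Levels may be skipped in \<open>lv\<close>, so the argument uses only that the status is
  monotone along the chain.\<close>

lemma stat_words:
  assumes w: "w \<in> W" and lv: "sorted lv" "distinct lv" "\<And>v. v \<in> set lv \<Longrightarrow> v \<le> N"
    and len: "length g = length lv" "2 \<le> length lv"
  shows "map (stat w) lv \<in> set (words g)"
proof -
  obtain g1 g2 gs where g: "g = g1 # g2 # gs" using len by (cases g; cases "tl g") auto
  obtain v l z where lv': "lv = v # l @ [z]" using len(2)
    by (cases lv; cases "tl lv" rule: rev_cases) auto
  have lenl: "length gs = length l" using len g lv' by simp
  have lt: "v < z" "\<And>u. u \<in> set l \<Longrightarrow> v < u \<and> u < z"
    using lv(1,2) lv' by (auto simp: sorted_append order_less_le)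
  have zN: "z \<le> N" using lv lv' by auto
  note qp' = qp[OF w] pN[OF w] N2
  \<comment> \<open>A chain part at an end of the chain matters only if the opposite end is among
    the levels, as only then the complement is visible.\<close>
  consider "v = 0" "q w = N" | "z = N" "p w = 0" | "\<not> (v = 0 \<and> q w = N)" "\<not> (z = N \<and> p w = 0)" by argo
  then show ?thesis
  proof cases
    case 1
    have pw: "p w = N" using 1 qp' by simp
    have "stat w v = AboveC" using 1 pw N2 by (simp add: stat_def)
    moreover have "map (stat w) l = reps Above gs"
    proof (rule map_stat_reps[OF _ lenl])
      show "\<forall>u\<in>set l. stat w u = Above"
      proof
        fix u assume "u \<in> set l"
        then have "0 < u" "u < N" using lt(2) zN by fastforce+
        then show "stat w u = Above" using 1 pw by (simp add: stat_def)
      qed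
    qed
    moreover have "stat w z = (if z = N then At else Above)" using 1 pw lt(1) zN by (simp add: stat_def)
    moreover have "reps Above gs @ [Above] = reps Above (g2 # gs)" by (induction gs) auto
    ultimately show ?thesis using g lv' by (auto simp: snoc_append)
  next
    case 2
    have qw: "q w = 0" using 2 qp' by simp
    have "stat w z = BelowC" using 2 qw N2 by (simp add: stat_def)
    moreover have "map (stat w) l = reps Below gs"
    proof (rule map_stat_reps[OF _ lenl])
      show "\<forall>u\<in>set l. stat w u = Below"
      proof
        fix u assume "u \<in> set l"
        then have "0 < u" "u < N" using lt(2) zN by fastforce+
        then show "stat w u = Below" using 2 qw by (simp add: stat_def)
      qed
    qed
    moreover have "stat w v = (if v = 0 then At else Below)" using 2 qw lt(1) zN by (simp add: stat_def)
    ultimately show ?thesis using g lv' by (auto simp: snoc_append)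
  next
    case 3
    have "map (stat w) lv \<in> set (words1 g)"
    proof (rule stat_words1[OF w lv(1,2) len(1)])
      fix u assume u: "u \<in> set lv"
      have "u \<le> z" "v \<le> u" using u lv' lt by (auto simp: less_imp_le)
      then show "u \<le> N \<and> \<not> (u = N \<and> p w = 0) \<and> \<not> (u = 0 \<and> q w = N)"
        using 3 zN by auto
    qed
    then show ?thesis using g by (simp del: words1.simps)
  qed
qed

end

section \<open>Soundness of the search\<close>

definition holes :: "six list \<Rightarrow> (nat \<times> hex) set" where
  "holes rem = {(i, y). i < length rem \<and> get (rem ! i) y}"

lemma inc_eq: "inc b n = of_bool b + n" by (cases b) auto

lemma UNIV_hex: "(UNIV :: hex set) = {A1, B1, A2, B2, A3, B3}"
proof (rule UNIV_eq_I)
  fix y show "y \<in> {A1, B1, A2, B2, A3, B3}" by (cases y) auto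
qed


lemma finite_hex [simp]: "finite (X :: hex set)"
proof (rule finite_subset[OF subset_UNIV])
  show "finite (UNIV :: hex set)" unfolding UNIV_hex by simp
qed

lemma card_get: "card {y. get r y} + n = cnt (r # []) + n"
proof (cases r)
  case (Six a b c d e f)
  have "{y. get r y} = {y \<in> UNIV. get r y}" by simp
  also have "card \<dots> = (\<Sum>y\<in>UNIV. of_bool (get r y))" by (simp flip: card_eq_sum add: sum.If_cases Int_def)
  also have "\<dots> = cnt [r]" unfolding UNIV_hex Six by (simp add: inc_eq)
  finally show ?thesis by simp
qed

lemma cnt_Cons: "cnt (r # rs) = card {y. get r y} + cnt rs"
  using card_get[of r 0] by (cases r) (simp add: inc_eq)

lemma finite_holes: "finite (holes rem)"
proof (rule finite_subset)
  show "holes rem \<subseteq> {..<length rem} \<times> UNIV" by (auto simp: holes_def)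
qed simp

lemma cnt_holes: "cnt rem = card (holes rem)"
proof (induction rem)
  case (Cons r rs)
  have "holes (r # rs) = Pair 0 ` {y. get r y} \<union> map_prod Suc id ` holes rs"
    by (auto simp: holes_def image_iff less_Suc_eq_0_disj)
  moreover have "card (Pair (0::nat) ` {y. get r y} \<union> map_prod Suc id ` holes rs)
    = card (Pair (0::nat) ` {y. get r y}) + card (map_prod Suc id ` holes rs)"
    by (rule card_Un_disjoint) (auto simp: finite_holes)
  moreover have "card (map_prod Suc id ` holes rs) = card (holes rs)"
    by (rule card_image) (auto simp: inj_on_def)
  moreover have "card (Pair (0::nat) ` {y. get r y}) = card {y. get r y}"
    by (rule card_image) (auto simp: inj_on_def)
  ultimately show ?case using Cons by (simp add: cnt_Cons)
qed (simp add: holes_def)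

lemma over_iff: "over m n \<longleftrightarrow> n < m" by (induction m n rule: over.induct) auto
lemma quad_eq: "quad k = 4 * k" by (induction k) auto
lemma bmem_iff: "bmem a l \<longleftrightarrow> a \<in> set l" by (induction l) auto
lemma dup_iff: "dup l \<longleftrightarrow> \<not> distinct l" by (induction l) (auto simp: bmem_iff)

lemma first_Some: "first r = Some y \<Longrightarrow> get r y"
  by (cases r) (auto split: if_splits)


lemma pick_Some:
  "pick acc rem = Some (i, y) \<Longrightarrow> \<exists>j. length i = length acc + j \<and> (j, y) \<in> holes rem"
proof (induction acc rem rule: pick.induct)
  case (2 acc r rs)
  show ?case
  proof (cases "first r")
    case None
    then obtain j where "length i = Suc (length acc) + j" "(j, y) \<in> holes rs" using 2 by auto
    then show ?thesis by (intro exI[of _ "Suc j"]) (auto simp: holes_def)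
  next
    case (Some z)
    then show ?thesis using 2 first_Some by (intro exI[of _ 0]) (auto simp: holes_def)
  qed
qed simp

lemma length_cover: "length (cover w z) = length w - 1"
  by (induction w z rule: cover.induct) auto

lemma nth_cover: "Suc i < length w \<Longrightarrow> cover w z ! i = covr (w ! i) (w ! Suc i) z"
  by (induction w z arbitrary: i rule: cover.induct) (auto simp: nth_Cons split: nat.splits)

lemma length_difs: "length (difs r c) = length r"
  by (induction r c rule: difs.induct) auto

lemma nth_difs: "i < length r \<Longrightarrow> i < length c \<Longrightarrow> difs r c ! i = dif (r ! i) (c ! i)"
  by (induction r c arbitrary: i rule: difs.induct) (auto simp: nth_Cons split: nat.splits)

lemma covxs_eq: "Suc (length i) < length w \<Longrightarrow> covxs i y w = covx (w ! length i) (w ! Suc (length i)) y"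
  by (induction i y w rule: covxs.induct) auto

lemma hds_eq: "hds ws = map hd ws" by (induction ws) auto
lemma tls_eq: "tls ws = map tl ws" by (induction ws) auto

lemma sngs_eq: "get (sngs (map s ch) (map x ch)) y \<longleftrightarrow> (\<exists>w\<in>set ch. get (sngr (s w) (x w)) y)"
  by (induction ch) (auto simp: get_simps)

lemma pat6_eq: "pat6 (map s ch) (map x ch) =
  map (\<lambda>y. map (\<lambda>w. get (cmpr (s w) (x w)) y) ch) [A1, B1, A2, B2, A3, B3]"
proof (induction ch)
  case (Cons w ch) then show ?case by (cases "cmpr (s w) (x w)") auto
qed simp

lemma insp_eq: "insp r (map f [A1, B1, A2, B2, A3, B3]) acc =
  map f (filter (\<lambda>y. \<not> get r y) [A1, B1, A2, B2, A3, B3]) @ acc"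
  by (cases r) (simp add: Let_def)

text \<open>The steps in \<open>D\<close> have to be separated by \<open>W\<close> alone, and
  \<open>lv\<close> lists levels that contain both ends of each flagged step. Separation in
  \<open>res\<close> is demanded only within a run of steps from \<open>D\<close>, since across any
  other step a vertex whose trace is not in the crown may do the work.\<close>

locale hexlv = hexconf +
  fixes D :: "nat set" and lv :: "nat list" and g :: "bool list"
  assumes lv: "sorted lv" "distinct lv" "\<And>v. v \<in> set lv \<Longrightarrow> v \<le> N"
    and len: "length g = length lv" "2 \<le> length lv"
    and D: "D \<subseteq> {..<N}"
    and step: "i < length g \<Longrightarrow> g ! i \<Longrightarrow> Suc i < length lv \<and> lv ! Suc i = Suc (lv ! i) \<and> lv ! i \<in> D"
    and cov: "a \<in> D \<Longrightarrow> \<exists>w\<in>W. covers w a y"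
    and res: "v \<le> v' \<Longrightarrow> v' \<le> N \<Longrightarrow> (v, y) \<noteq> (v', y') \<Longrightarrow> {v..<v'} \<subseteq> D \<Longrightarrow>
      \<forall>w\<in>W. \<not> sing w v y \<and> \<not> sing w v' y' \<Longrightarrow> \<exists>w\<in>W. comp w v y \<noteq> comp w v' y'"
begin

definition word :: "'a \<Rightarrow> status list" where "word w = map (stat w) lv"

text \<open>Invariant of the scan: \<open>acc\<close> consists of the patterns of the vertices
  \<open>els\<close>, which lie in the current block and are not singled out. All steps between them
  belong to \<open>D\<close>, so \<open>res\<close> makes their patterns distinct.\<close>

lemma not_collide:
  assumes ch: "set ch = W"
    and gs: "gs = drop i g" and vs: "vs = drop i lv"
    and acc: "acc = map (\<lambda>(u, y). map (\<lambda>w. comp w u y) ch) els" "distinct els"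
      "\<And>u y. (u, y) \<in> set els \<Longrightarrow> vs \<noteq> [] \<Longrightarrow> u < hd vs \<and> {u..<hd vs} \<subseteq> D"
      "\<And>u y w. (u, y) \<in> set els \<Longrightarrow> w \<in> W \<Longrightarrow> \<not> sing w u y"
  shows "\<not> collide gs acc (map (\<lambda>w. map (stat w) vs) ch) (map x ch)"
  using gs vs acc
proof (induction gs arbitrary: i vs acc els)
  case (Cons b gs)
  have il: "i < length g" using Cons.prems(1) by (cases "i < length g") auto
  then have "drop i g = g ! i # drop (Suc i) g" by (simp add: Cons_nth_drop_Suc)
  then have i: "i < length g" "b = g ! i" "gs = drop (Suc i) g" using Cons.prems(1) il by auto
  obtain v vs' where vs: "vs = v # vs'" "v = lv ! i" "vs' = drop (Suc i) lv"
    using Cons.prems(2) i(1) len(1) by (metis Cons_nth_drop_Suc)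
  have vN: "v \<le> N" using i len vs lv(3) by simp
  define new where "new = map (Pair v) (filter (\<lambda>y. \<forall>w\<in>W. \<not> sing w v y) [A1, B1, A2, B2, A3, B3])"
  define els' where "els' = new @ els"
  define acc' where "acc' = insp (sngs (map (\<lambda>w. stat w v) ch) (map x ch))
    (pat6 (map (\<lambda>w. stat w v) ch) (map x ch)) acc"
  have hd: "hds (map (\<lambda>w. map (stat w) vs) ch) = map (\<lambda>w. stat w v) ch"
    and tl: "tls (map (\<lambda>w. map (stat w) vs) ch) = map (\<lambda>w. map (stat w) vs') ch"
    by (auto simp: hds_eq tls_eq vs(1))
  have acc': "acc' = map (\<lambda>(u, y). map (\<lambda>w. comp w u y) ch) els'"
  proof -
    have 1: "get (cmpr (stat w v) (x w)) y = comp w v y" if "w \<in> set ch" for w y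
      using that ch cmpr_stat by auto
    have 2: "get (sngs (map (\<lambda>w. stat w v) ch) (map x ch)) y \<longleftrightarrow> (\<exists>w\<in>W. sing w v y)" for y
      using sngr_stat unfolding sngs_eq ch by auto
    show ?thesis
      unfolding acc'_def els'_def new_def pat6_eq insp_eq Cons.prems(3)
      using 1 by (simp add: 2 cong: map_cong)
  qed
  have els': "distinct els'" "\<And>u y. (u, y) \<in> set els' \<Longrightarrow> u \<le> v \<and> {u..<v} \<subseteq> D"
    "\<And>u y w. (u, y) \<in> set els' \<Longrightarrow> w \<in> W \<Longrightarrow> \<not> sing w u y"
  proof -
    show "distinct els'"
    proof -
      have "distinct new" unfolding new_def distinct_map by (auto simp: inj_on_def intro: distinct_filter)
      moreover have "u = v" if "(u, y) \<in> set new" for u y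
        using that unfolding new_def by (auto simp del: filter.simps)
      moreover have "u < v" if "(u, y) \<in> set els" for u y
        using Cons.prems(5)[OF that] vs(1) by simp
      ultimately show ?thesis unfolding els'_def using Cons.prems(4) by fastforce
    qed
    show "u \<le> v \<and> {u..<v} \<subseteq> D" if "(u, y) \<in> set els'" for u y
      using that Cons.prems(5)[of u y] vs(1) by (auto simp: els'_def new_def simp del: filter.simps)
    show "\<not> sing w u y" if "(u, y) \<in> set els'" "w \<in> W" for u y w
      using that Cons.prems(6) by (auto simp: els'_def new_def simp del: filter.simps)
  qed
  have dist: "distinct acc'"
  proof -
    have aux: "\<exists>w\<in>W. comp w u y \<noteq> comp w u' y'"
      if "(u, y) \<in> set els'" "(u', y') \<in> set els'" "(u, y) \<noteq> (u', y')" "u \<le> u'" for u y u' y'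
    proof (rule res)
      show "{u..<u'} \<subseteq> D" using els'(2)[OF that(1)] els'(2)[OF that(2)] by auto
      show "u' \<le> N" using els'(2)[OF that(2)] vN by auto
    qed (use that els'(3) in auto)
    have "inj_on (\<lambda>(u, y). map (\<lambda>w. comp w u y) ch) (set els')"
    proof (rule inj_onI, clarify)
      fix u y u' y'
      assume a: "(u, y) \<in> set els'" "(u', y') \<in> set els'" "map (\<lambda>w. comp w u y) ch = map (\<lambda>w. comp w u' y') ch"
      then have eq: "comp w u y = comp w u' y'" if "w \<in> W" for w using that ch by auto
      show "u = u' \<and> y = y'"
      proof (rule ccontr)
        assume "\<not> (u = u' \<and> y = y')"
        then show False using aux[of u y u' y'] aux[of u' y' u y] a eq by (cases "u \<le> u'") auto
      qed
    qed
    then show ?thesis unfolding acc' using els'(1) by (simp add: distinct_map)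
  qed
  show ?case
  proof (cases b)
    case True
    have st: "vs' \<noteq> []" "hd vs' = Suc v" "v \<in> D"
      using step[OF i(1)] True i(2) vs by (auto simp: hd_drop_conv_nth)
    have "\<not> collide gs acc' (map (\<lambda>w. map (stat w) vs') ch) (map x ch)"
    proof (rule Cons.IH[OF i(3) vs(3) acc' els'(1)])
      fix u y assume u: "(u, y) \<in> set els'" "vs' \<noteq> []"
      have "{u..<Suc v} = insert v {u..<v}" using els'(2)[OF u(1)] by auto
      then show "u < hd vs' \<and> {u..<hd vs'} \<subseteq> D" using els'(2)[OF u(1)] st by auto
    qed (use els'(3) in blast)
    then show ?thesis using True by (simp add: Let_def hd tl acc'_def)
  next
    case False
    have "\<not> collide gs [] (map (\<lambda>w. map (stat w) vs') ch) (map x ch)"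
      by (rule Cons.IH[OF i(3) vs(3), where els = "[]"]) auto
    then show ?thesis using False dist by (simp add: Let_def hd tl acc'_def dup_iff)
  qed
qed simp

text \<open>This justifies the cut-off: if the vertices still to be chosen can cover all holes,
  there are at most four holes for each of them.\<close>

lemma holes_card:
  assumes "set tr \<subseteq> W"
    and "\<And>i y. (i, y) \<in> holes rem \<Longrightarrow> Suc i < length lv \<and> g ! i \<and> (\<exists>t\<in>set tr. covers t (lv ! i) y)"
  shows "card (holes rem) \<le> 4 * length tr"
proof -
  let ?C = "\<lambda>t. {(v, y). v < N \<and> covers t v y}"
  let ?f = "\<lambda>(i, y::hex). (lv ! i, y)"
  have sub: "?f ` holes rem \<subseteq> (\<Union>t\<in>set tr. ?C t)"
    using assms(2) step len(1) D by (fastforce simp: subset_iff)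
  have inj: "inj_on ?f (holes rem)"
  proof (rule inj_onI)
    fix a b assume ab: "a \<in> holes rem" "b \<in> holes rem" "?f a = ?f b"
    obtain i y j z where "a = (i, y)" "b = (j, z)" by (cases a; cases b) blast
    then show "a = b" using ab assms(2)[of i y] assms(2)[of j z] lv(2) by (simp add: nth_eq_iff_index_eq)
  qed
  have "card (holes rem) = card (?f ` holes rem)" by (simp add: card_image inj)
  also have "\<dots> \<le> card (\<Union>t\<in>set tr. ?C t)"
    by (rule card_mono[OF _ sub]) (use covers_card assms(1) in auto)
  also have "\<dots> \<le> (\<Sum>t\<in>set tr. card (?C t))" by (rule card_UN_le) simp
  also have "\<dots> \<le> (\<Sum>t\<in>set tr. 4)" using covers_card assms(1) by (intro sum_mono) auto
  also have "\<dots> \<le> 4 * length tr" using card_length[of tr] by simp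
  finally show ?thesis .
qed

text \<open>An actual configuration marks out a branch on which the search finds no contradiction.
  The vertices \<open>ch\<close> have been chosen, \<open>tr\<close> are still available, and every
  hole is covered by some member of \<open>tr\<close>; the one covering the hole picked next is
  among the alternatives tried.\<close>

lemma not_dfs:
  assumes "length tr = k" "set ch \<union> set tr = W" "length rem = length lv - 1"
    and "\<And>i y. (i, y) \<in> holes rem \<Longrightarrow> g ! i \<and> (\<exists>t\<in>set tr. covers t (lv ! i) y)"
  shows "\<not> dfs g k (map word ch) (map x ch) rem"
  using assms
proof (induction k arbitrary: tr ch rem)
  case 0
  then have "holes rem = {}" by fastforce
  then have "pick [] rem = None" using pick_Some[of "[]" rem] by (cases "pick [] rem") auto
  moreover have "\<not> collide g [] (map word ch) (map x ch)"
    unfolding word_def using 0 by (intro not_collide[where i = 0 and els = "[]"]) auto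
  ultimately show ?case by simp
next
  case (Suc k)
  show ?case
  proof (cases "pick [] rem")
    case (Some iy)
    obtain i y where iy: "iy = (i, y)" by (cases iy)
    have hole: "(length i, y) \<in> holes rem" using pick_Some Some iy by fastforce
    then have il: "Suc (length i) < length lv" using Suc.prems(3) by (auto simp: holes_def)
    obtain t where t: "t \<in> set tr" "covers t (lv ! length i) y" and gi: "g ! length i"
      using Suc.prems(4)[OF hole] by auto
    have tW: "t \<in> W" using t Suc.prems(2) by auto
    have covr_word: "get (cover (word s) (x s) ! j) z"
      if "s \<in> W" "Suc j < length lv" "g ! j" "covers s (lv ! j) z" for s j z
    proof -
      have "lv ! Suc j = Suc (lv ! j)" "lv ! j < N" using step[of j] that len D by auto
      then show ?thesis using covr_stat[of s "lv ! j" z] that by (simp add: nth_cover word_def)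
    qed
    have w: "word t \<in> set (words g)" unfolding word_def by (rule stat_words[OF tW lv len])
    have "get (covr (word t ! length i) (word t ! Suc (length i)) (x t)) y"
      using covr_word[OF tW il gi t(2)] il by (simp add: nth_cover word_def)
    then have xt: "x t \<in> set (covxs i y (word t))"
      using il by (simp add: covxs_eq word_def covx_covr)
    define rem' where "rem' = difs rem (cover (word t) (x t))"
    define tr' where "tr' = remove1 t tr"
    have len': "length rem' = length lv - 1" using Suc.prems(3) by (simp add: rem'_def length_difs)
    have tr': "length tr' = k" "set (t # ch) \<union> set tr' = W"
      using t(1) Suc.prems(1,2) unfolding tr'_def
      by (auto simp: length_remove1 dest: notin_set_remove1 intro: in_set_remove1[THEN iffD2])
    have holes': "g ! j \<and> (\<exists>s\<in>set tr'. covers s (lv ! j) z)" "Suc j < length lv" if "(j, z) \<in> holes rem'" for j z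
    proof -
      have j: "j < length rem" "get (rem ! j) z" "\<not> get (cover (word t) (x t) ! j) z"
        using that Suc.prems(3) by (auto simp: holes_def rem'_def length_difs nth_difs length_cover word_def get_dif)
      then obtain s where s: "g ! j" "s \<in> set tr" "covers s (lv ! j) z"
        using Suc.prems(4)[of j z] by (auto simp: holes_def)
      show "Suc j < length lv" using j Suc.prems(3) by simp
      \<comment> \<open>The pair is still a hole after the choice of \<open>t\<close>, so its cover
        comes from another vertex, which is still in \<open>tr'\<close>.\<close>
      then have "s \<noteq> t" using covr_word[OF tW _ s(1)] s(3) j(3) by blast
      then show "g ! j \<and> (\<exists>s\<in>set tr'. covers s (lv ! j) z)" using s by (auto simp: tr'_def)
    qed
    have "card (holes rem') \<le> 4 * length tr'"
      by (rule holes_card) (use tr' holes' in auto)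
    then have "\<not> over (cnt rem') (quad k)" by (simp add: over_iff quad_eq cnt_holes tr'(1))
    moreover have "\<not> dfs g k (word t # map word ch) (x t # map x ch) rem'"
      using Suc.IH[OF tr' len' holes'(1)] by simp
    ultimately show ?thesis using w xt by (auto simp: Some iy list_all_iff Let_def rem'_def)
  qed simp
qed

lemma length_rem0: "length (rem0 h) = length h - 1"
  by (induction h rule: rem0.induct) auto

lemma nth_rem0: "i < length h - 1 \<Longrightarrow> rem0 h ! i = (if h ! i then six1 else six0)"
  by (induction h arbitrary: i rule: rem0.induct) (auto simp: nth_Cons split: nat.splits)

lemma not_refuted:
  assumes "card W \<le> z" "W \<noteq> {}"
  shows "\<not> refuted z g"
proof -
  obtain l where l: "set l = W" "distinct l" using finite_distinct_list[OF finW] by blast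
  obtain a where "a \<in> W" using assms(2) by blast
  \<comment> \<open>The search chooses exactly \<open>z\<close> vertices and allows repetition, so a
    smaller family is padded with copies of one member.\<close>
  define tr where "tr = l @ replicate (z - length l) a"
  have tr: "length tr = z" "set tr = W"
    using l assms(1) \<open>a \<in> W\<close> by (auto simp: tr_def distinct_card[symmetric])
  have "\<not> dfs g z (map word []) (map x []) (rem0 g)"
  proof (rule not_dfs)
    fix i y assume "(i, y) \<in> holes (rem0 g)"
    then have i: "i < length g - 1" "get (rem0 g ! i) y" by (auto simp: holes_def length_rem0)
    then have "g ! i" using nth_rem0[of i g] by (auto simp: get_simps split: if_splits)
    then show "g ! i \<and> (\<exists>t\<in>set tr. covers t (lv ! i) y)"
      using step[of i] i cov tr by auto
  qed (use tr len in \<open>auto simp: length_rem0\<close>)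
  then show ?thesis by (simp add: refuted_def)
qed

end

section \<open>The patterns of two, three and four steps\<close>

lemma refuted_2:
  "refuted (Suc (Suc (Suc (Suc 0)))) [True, True, False]"
  "refuted (Suc (Suc (Suc (Suc 0)))) [True, False, True, False]"
  by code_simp+

lemma refuted_3:
  "refuted (Suc (Suc (Suc (Suc (Suc 0))))) [True, True, True, False]"
  "refuted (Suc (Suc (Suc (Suc (Suc 0))))) [True, True, False, True, False]"
  "refuted (Suc (Suc (Suc (Suc (Suc 0))))) [True, False, True, True, False]"
  "refuted (Suc (Suc (Suc (Suc (Suc 0))))) [True, False, True, False, True, False]"
  by code_simp+

lemma refuted_4:
  "refuted (Suc (Suc (Suc (Suc (Suc (Suc 0)))))) [True, True, True, True, False]"
  "refuted (Suc (Suc (Suc (Suc (Suc (Suc 0)))))) [True, True, True, False, True, False]"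
  "refuted (Suc (Suc (Suc (Suc (Suc (Suc 0)))))) [True, True, False, True, True, False]"
  "refuted (Suc (Suc (Suc (Suc (Suc (Suc 0)))))) [True, False, True, True, True, False]"
  "refuted (Suc (Suc (Suc (Suc (Suc (Suc 0)))))) [True, True, False, True, False, True, False]"
  "refuted (Suc (Suc (Suc (Suc (Suc (Suc 0)))))) [True, False, True, True, False, True, False]"
  "refuted (Suc (Suc (Suc (Suc (Suc (Suc 0)))))) [True, False, True, False, True, True, False]"
  "refuted (Suc (Suc (Suc (Suc (Suc (Suc 0)))))) [True, False, True, False, True, False, True, False]"
  by code_simp+

text \<open>Every step contributes its two end levels, and adjacent steps share one. The flags
  forget the gaps between separate runs, so \<open>d\<close> steps give \<open>2^(d-1)\<close>
  patterns, which are those of the three lemmas above.\<close>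

fun levels :: "nat list \<Rightarrow> nat list" where
  "levels [] = []" | "levels [d] = [d, Suc d]"
| "levels (d # e # ds) = d # (if e = Suc d then levels (e # ds) else Suc d # levels (e # ds))"

fun flags :: "nat list \<Rightarrow> bool list" where
  "flags [] = []" | "flags [d] = [True, False]"
| "flags (d # e # ds) = True # (if e = Suc d then flags (e # ds) else False # flags (e # ds))"

lemma length_flags: "length (flags ds) = length (levels ds)"
  by (induction ds rule: levels.induct) auto

lemma length_levels: "ds \<noteq> [] \<Longrightarrow> 2 \<le> length (levels ds)"
  by (induction ds rule: levels.induct) (auto split: if_splits)

lemma set_levels: "v \<in> set (levels ds) \<Longrightarrow> v \<in> set ds \<union> Suc ` set ds"
  by (induction ds rule: levels.induct) (auto split: if_splits)

lemma levels_Cons: "levels (d # ds) = d # tl (levels (d # ds))"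
  by (cases ds) auto

lemma sorted_levels: "sorted_wrt (<) ds \<Longrightarrow> sorted_wrt (<) (levels ds)"
proof (induction ds rule: levels.induct)
  case (3 d e ds)
  have "e \<le> v" if "v \<in> set (levels (e # ds))" for v
    using set_levels[OF that] 3(3) by auto
  then show ?case using 3 by (fastforce split: if_splits)
qed auto

lemma flags_step:
  assumes "sorted_wrt (<) ds" "i < length (flags ds)" "flags ds ! i"
  shows "Suc i < length (levels ds) \<and> levels ds ! Suc i = Suc (levels ds ! i) \<and> levels ds ! i \<in> set ds"
  using assms
proof (induction ds arbitrary: i rule: levels.induct)
  case (2 d)
  then show ?case by (auto simp: less_Suc_eq)
next
  case (3 d e ds)
  have hd: "levels (e # ds) ! 0 = e" "levels (e # ds) \<noteq> []" using levels_Cons[of e ds] by (metis nth_Cons_0, metis list.distinct(1))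
  show ?case
  proof (cases i)
    case 0
    then show ?thesis using hd by auto
  next
    case (Suc j)
    note ih = 3(1,2)
    show ?thesis
    proof (cases "e = Suc d")
      case True
      then show ?thesis using 3(1)[OF True, of j] 3(3-) Suc by simp
    next
      case False
      then obtain k where k: "j = Suc k" using 3(5) Suc by (cases j) auto
      then show ?thesis using 3(2)[OF False, of k] 3(3-) Suc False by simp
    qed
  qed
qed auto

lemma refuted_flags:
  assumes "length ds \<in> {2, 3, 4}"
  shows "refuted (length ds + 2) (flags ds)"
proof -
  consider d e where "ds = [d, e]" | d e f where "ds = [d, e, f]" | d e f h where "ds = [d, e, f, h]"
    using assms by (auto simp: numeral_eq_Suc length_Suc_conv)
  then show ?thesis
  proof cases
    case 1 then show ?thesis using refuted_2 by simp
  next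
    case 2 then show ?thesis using refuted_3 by simp
  next
    case 3 then show ?thesis using refuted_4 by simp
  qed
qed

section \<open>The lower bound for crowns over a chain\<close>

context hexconf
begin

text \<open>Vertices that are not singled out have different sets of comparable test vertices, and
  each test vertex singles out at most one member of \<open>E\<close>.\<close>

lemma pigeonhole:
  assumes "finite E"
    and sep: "\<And>v y v' y'. (v, y) \<in> E \<Longrightarrow> (v', y') \<in> E \<Longrightarrow> (v, y) \<noteq> (v', y') \<Longrightarrow>
      \<forall>w\<in>W. \<not> sing w v y \<and> \<not> sing w v' y' \<Longrightarrow> \<exists>w\<in>W. comp w v y \<noteq> comp w v' y'"
    and one: "\<And>w v y v' y'. w \<in> W \<Longrightarrow> (v, y) \<in> E \<Longrightarrow> (v', y') \<in> E \<Longrightarrow> sing w v y \<Longrightarrow> sing w v' y' \<Longrightarrow>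
      (v, y) = (v', y')"
  shows "card E \<le> 2 ^ card W + card {w \<in> W. \<exists>(v, y)\<in>E. sing w v y}"
proof -
  let ?K = "{w \<in> W. \<exists>(v, y)\<in>E. sing w v y}"
  define X where "X = {(v, y) \<in> E. \<forall>w\<in>W. \<not> sing w v y}"
  have "inj_on (\<lambda>(v, y). {w \<in> W. comp w v y}) X"
  proof (rule inj_onI, clarify)
    fix v y v' y' assume a: "(v, y) \<in> X" "(v', y') \<in> X" "{w \<in> W. comp w v y} = {w \<in> W. comp w v' y'}"
    then show "v = v' \<and> y = y'" using sep[of v y v' y'] by (fastforce simp: X_def)
  qed
  then have "card X \<le> card (Pow W)"
    by (rule card_inj_on_le) (use finW in auto)
  moreover have "card (E - X) \<le> card ?K"
  proof (rule surj_card_le)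
    show "E - X \<subseteq> (\<lambda>w. THE e. e \<in> E \<and> sing w (fst e) (snd e)) ` ?K"
    proof
      fix e assume "e \<in> E - X"
      then obtain w where w: "w \<in> W" "e \<in> E" "sing w (fst e) (snd e)" by (auto simp: X_def)
      moreover have "(THE e. e \<in> E \<and> sing w (fst e) (snd e)) = e"
      proof (rule the_equality)
        show "e' = e" if "e' \<in> E \<and> sing w (fst e') (snd e')" for e'
          using that w one[of w "fst e'" "snd e'" "fst e" "snd e"] by simp
      qed (use w in simp)
      ultimately show "e \<in> (\<lambda>w. THE e. e \<in> E \<and> sing w (fst e) (snd e)) ` ?K"
        by (intro image_eqI[of _ _ w]) (auto simp: case_prod_beta)
    qed
  qed (use finW in auto)
  moreover have "card E \<le> card X + card (E - X)"
  proof -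
    have "E = X \<union> (E - X)" by (auto simp: X_def)
    then show ?thesis using card_Un_le[of X "E - X"] by simp
  qed
  ultimately show ?thesis using finW by (simp add: card_Pow)
qed

text \<open>The budget \<open>card D + 2\<close>, one less than claimed, is refuted: by counting if
  \<open>D\<close> has more than four members, by the pigeonhole principle if it has at most one,
  and by the search in between.\<close>

lemma hex_bound:
  assumes D: "D \<subseteq> {..<N}"
    and res: "\<And>v v' y y'. v \<le> v' \<Longrightarrow> v' \<le> N \<Longrightarrow> (v, y) \<noteq> (v', y') \<Longrightarrow> {v..<v'} \<subseteq> D \<Longrightarrow>
      \<forall>w\<in>W. \<not> sing w v y \<and> \<not> sing w v' y' \<Longrightarrow> \<exists>w\<in>W. comp w v y \<noteq> comp w v' y'"
  shows "card D + 3 \<le> card W"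
proof (rule ccontr)
  assume "\<not> ?thesis"
  then have le: "card W \<le> card D + 2" by simp
  have finD: "finite D" using D finite_subset by blast
  have cov: "\<exists>w\<in>W. covers w a y" if "a \<in> D" for a y
  proof (rule ccontr)
    assume "\<not> ?thesis"
    then have "\<And>w. w \<in> W \<Longrightarrow> comp w a y = comp w (Suc a) y \<and> \<not> sing w a y \<and> \<not> sing w (Suc a) y"
      by (auto simp: covers_def)
    then show False using res[of a "Suc a" y y] that D by fastforce
  qed
  have UN: "card (UNIV :: hex set) = 6" unfolding UNIV_hex by simp
  \<comment> \<open>Double count of the pairs of a step and a crown element that some test vertex
    must cover.\<close>
  have "6 * card D = card (D \<times> (UNIV :: hex set))" using finD by (simp add: card_cartesian_product UN)
  also have "\<dots> \<le> card (\<Union>w\<in>W. {(v, y). v < N \<and> covers w v y})"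
    by (rule card_mono) (use finW covers_card cov D in auto)
  also have "\<dots> \<le> (\<Sum>w\<in>W. card {(v, y). v < N \<and> covers w v y})" by (rule card_UN_le[OF finW])
  also have "\<dots> \<le> (\<Sum>w\<in>W. 4)" using covers_card by (intro sum_mono) auto
  finally have bound: "6 * card D \<le> 4 * card W" by simp
  have sep: "\<exists>w\<in>W. comp w v y \<noteq> comp w v' y'"
    if "(v, y) \<noteq> (v', y')" "\<forall>w\<in>W. \<not> sing w v y \<and> \<not> sing w v' y'" "v \<le> N" "v' \<le> N"
      "{min v v'..<max v v'} \<subseteq> D" for v y v' y'
    using res[of v v' y y'] res[of v' v y' y] that by (cases "v \<le> v'") (auto simp: min_def max_def)
  consider "card D = 0" | "card D = 1" | "card D \<in> {2, 3, 4}" using bound le by fastforce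
  then show False
  proof cases
    case 1
    let ?K = "\<lambda>u. {w \<in> W. \<exists>(v, y)\<in>{u} \<times> UNIV. sing w v y}"
    have b: "6 \<le> 2 ^ card W + card (?K u)" if "u = 0 \<or> u = 1" for u
    proof -
      have "card ({u} \<times> (UNIV :: hex set)) \<le> 2 ^ card W + card (?K u)"
      proof (rule pigeonhole)
        show "\<exists>w\<in>W. comp w v y \<noteq> comp w v' y'"
          if "(v, y) \<in> {u} \<times> UNIV" "(v', y') \<in> {u} \<times> UNIV" "(v, y) \<noteq> (v', y')"
            "\<forall>w\<in>W. \<not> sing w v y \<and> \<not> sing w v' y'" for v y v' y'
          using that \<open>u = 0 \<or> u = 1\<close> N2 by (intro sep) auto
        show "(v, y) = (v', y')"
          if "w \<in> W" "(v, y) \<in> {u} \<times> UNIV" "(v', y') \<in> {u} \<times> UNIV" "sing w v y" "sing w v' y'" for w v y v' y'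
          using that \<open>u = 0 \<or> u = 1\<close> N2 by (auto simp: sing_def)
      qed auto
      then show ?thesis by (simp add: card_cartesian_product UN)
    qed
    \<comment> \<open>Because of \<open>2 <= N\<close> no test vertex singles out vertices on level
      0 and on level 1. With two test vertices, one of these levels has at most one singled out
      vertex, and its six vertices exceed \<open>4 + 1\<close>.\<close>
    have "card (?K 0) + card (?K 1) = card (?K 0 \<union> ?K 1)"
      by (rule card_Un_disjoint[symmetric]) (use finW qp pN N2 in \<open>auto simp: sing_def\<close>)
    also have "\<dots> \<le> card W" by (rule card_mono[OF finW]) auto
    finally have "card (?K 0) \<le> 1 \<or> card (?K 1) \<le> 1" using le 1 by linarith
    moreover have "(2::nat) ^ card W \<le> 2 ^ 2" using le 1 by (intro power_increasing) auto
    ultimately show False using b[of 0] b[of 1] by auto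
  next
    case 2
    then obtain a where a: "D = {a}" by (auto simp: card_Suc_eq numeral_eq_Suc)
    let ?E = "{a, Suc a} \<times> (UNIV :: hex set)"
    have aN: "Suc a \<le> N" using a D by auto
    have "card ?E \<le> 2 ^ card W + card {w \<in> W. \<exists>(v, y)\<in>?E. sing w v y}"
    proof (rule pigeonhole)
      show "\<exists>w\<in>W. comp w v y \<noteq> comp w v' y'"
        if "(v, y) \<in> ?E" "(v', y') \<in> ?E" "(v, y) \<noteq> (v', y')"
          "\<forall>w\<in>W. \<not> sing w v y \<and> \<not> sing w v' y'" for v y v' y'
        using that aN a by (intro sep) auto
      show "(v, y) = (v', y')"
        if "w \<in> W" "(v, y) \<in> ?E" "(v', y') \<in> ?E" "sing w v y" "sing w v' y'" for w v y v' y'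
        using that aN N2 qp[OF that(1)] by (auto simp: sing_def)
    qed auto
    also have "card {w \<in> W. \<exists>(v, y)\<in>?E. sing w v y} \<le> card W" by (rule card_mono[OF finW]) auto
    \<comment> \<open>With at most three test vertices the right-hand side is at most 11.\<close>
    finally have "12 \<le> 2 ^ card W + card W" by (simp add: card_cartesian_product UN)
    moreover have "(2::nat) ^ card W \<le> 2 ^ 3" using le 2 by (intro power_increasing) auto
    ultimately show False using le 2 by simp
  next
    case 3
    define ds where "ds = sorted_list_of_set D"
    have ds: "sorted_wrt (<) ds" "set ds = D" "length ds = card D" "ds \<noteq> []"
      using finD 3 by (auto simp: ds_def)
    have lv: "sorted_wrt (<) (levels ds)" by (rule sorted_levels[OF ds(1)])
    interpret hexlv W q p x N D "levels ds" "flags ds"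
    proof
      show "sorted (levels ds)" "distinct (levels ds)" using lv by (auto simp: strict_sorted_iff)
      show "v \<le> N" if "v \<in> set (levels ds)" for v using set_levels[OF that] D ds(2) by auto
      show "2 \<le> length (levels ds)" by (rule length_levels[OF ds(4)])
      show "Suc i < length (levels ds) \<and> levels ds ! Suc i = Suc (levels ds ! i) \<and> levels ds ! i \<in> D"
        if "i < length (flags ds)" "flags ds ! i" for i
        using flags_step[OF ds(1) that] ds(2) by simp
    qed (use length_flags D cov res in auto)
    have "W \<noteq> {}" using cov 3 finD by fastforce
    then show False using not_refuted[of "card D + 2"] refuted_flags[of ds] le ds(3) 3 by auto
  qed
qed

end

section \<open>Products of chains\<close>

abbreviation vle :: "nat list \<Rightarrow> nat list \<Rightarrow> bool" where "vle \<equiv> list_all2 (\<le>)"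
definition zeros :: "nat list \<Rightarrow> nat list" where "zeros Ls = map (\<lambda>_. 0) Ls"
definition vertices :: "nat list \<Rightarrow> nat list set" where
  "vertices Ls = {v. vle v Ls \<and> v \<noteq> zeros Ls \<and> v \<noteq> Ls}"

definition comparable :: "('a \<Rightarrow> 'a \<Rightarrow> bool) \<Rightarrow> 'a \<Rightarrow> 'a \<Rightarrow> bool" where
  "comparable leq u v \<longleftrightarrow> leq u v \<or> leq v u"

definition linked :: "('a \<Rightarrow> 'a \<Rightarrow> bool) \<Rightarrow> 'a set \<Rightarrow> 'a \<Rightarrow> 'a \<Rightarrow> bool" where
  "linked leq V u v \<longleftrightarrow> (\<exists>z\<in>V. comparable leq z u \<and> comparable leq z v)"

text \<open>Distance 3 or more is not subdivided here: for lower bounds it is enough that such a pair is separated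
  from everything else, for upper bounds that it is separated from pairs at distance at most 2.\<close>
definition strongly_resolving :: "('a \<Rightarrow> 'a \<Rightarrow> bool) \<Rightarrow> 'a set \<Rightarrow> 'a set \<Rightarrow> bool" where
  "strongly_resolving leq V S \<longleftrightarrow> S \<subseteq> V \<and> (\<forall>u\<in>V - S. \<forall>v\<in>V - S. u \<noteq> v \<longrightarrow>
     (\<exists>w\<in>S. comparable leq u w \<noteq> comparable leq v w \<or> linked leq V u w \<noteq> linked leq V v w))"

definition weakly_resolving :: "('a \<Rightarrow> 'a \<Rightarrow> bool) \<Rightarrow> 'a set \<Rightarrow> 'a set \<Rightarrow> bool" where
  "weakly_resolving leq V S \<longleftrightarrow> S \<subseteq> V \<and> (\<forall>u\<in>V - S. \<forall>v\<in>V - S. u \<noteq> v \<longrightarrow>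
     (\<exists>w\<in>S. comparable leq u w \<noteq> comparable leq v w \<or> \<not> linked leq V u w \<or> \<not> linked leq V v w))"

lemma vle_trans: "vle u v \<Longrightarrow> vle v w \<Longrightarrow> vle u w"
  by (rule list_all2_trans[of "(\<le>)" "(\<le>)" "(\<le>)"]) auto

lemma vle_antisym: "vle u v \<Longrightarrow> vle v u \<Longrightarrow> u = v"
  by (rule list_all2_antisym[of "(\<le>)" "(\<le>)"]) auto

lemma vle_refl: "vle u u" by (simp add: list_all2_refl)

lemma vle_zeros: "vle (zeros Ls) v \<longleftrightarrow> length v = length Ls"
  by (auto simp: zeros_def list_all2_conv_all_nth)

lemma length_zeros [simp]: "length (zeros Ls) = length Ls" by (simp add: zeros_def)
lemma zeros_simps [simp]: "zeros [] = []" "zeros (L # Ls) = 0 # zeros Ls" "zeros (Ks @ Ls) = zeros Ks @ zeros Ls"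
  by (auto simp: zeros_def)

lemma vle_zerosD: "vle v (zeros Ls) \<Longrightarrow> v = zeros Ls"
  by (rule vle_antisym) (auto simp: vle_zeros dest: list_all2_lengthD)

lemma vle_sum: "vle u v \<Longrightarrow> sum_list u \<le> sum_list v"
  by (induction rule: list_all2_induct) auto

lemma vle_sum_eq: "vle u v \<Longrightarrow> sum_list u = sum_list v \<Longrightarrow> u = v"
  by (induction rule: list_all2_induct) (auto dest!: vle_sum)

text \<open>Otherwise the meet or the join of \<open>u\<close> and \<open>v\<close> would be a
  vertex comparable to both.\<close>

lemma complementary:
  assumes uv: "u \<in> vertices Ls" "v \<in> vertices Ls" and nl: "\<not> linked vle (vertices Ls) u v" and i: "i < length Ls"
  shows "min (u ! i) (v ! i) = 0 \<and> max (u ! i) (v ! i) = Ls ! i"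
proof -
  have len: "length u = length Ls" "length v = length Ls" using uv by (auto simp: vertices_def list_all2_lengthD)
  have leq: "\<And>i. i < length Ls \<Longrightarrow> u ! i \<le> Ls ! i" "\<And>i. i < length Ls \<Longrightarrow> v ! i \<le> Ls ! i"
    using uv by (auto simp: vertices_def list_all2_conv_all_nth)
  let ?m = "map2 min u v" and ?j = "map2 max u v"
  have m: "vle ?m u" "vle ?m v" "vle u ?j" "vle v ?j" "vle ?m Ls" "vle ?j Ls"
    using len leq by (auto simp: list_all2_conv_all_nth min.coboundedI1)
  have "?m \<notin> vertices Ls" "?j \<notin> vertices Ls"
    using nl m unfolding linked_def comparable_def by blast+
  moreover have "?m \<noteq> Ls" using m(1) uv(1) vle_antisym[of u Ls] by (auto simp: vertices_def)
  moreover have "?j \<noteq> zeros Ls" using m(3) uv(1) vle_zerosD[of u Ls] by (auto simp: vertices_def)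
  ultimately have "?m = zeros Ls" "?j = Ls" using m by (auto simp: vertices_def)
  then have "?m ! i = 0" "?j ! i = Ls ! i" using i by (auto simp: zeros_def)
  then show ?thesis using i len by simp
qed

lemma weakly_resolvingE:
  assumes "weakly_resolving leq V S" "u \<in> V" "v \<in> V" "u \<notin> S" "v \<notin> S" "u \<noteq> v"
  obtains w where "w \<in> S" "w \<in> V" "comparable leq u w \<noteq> comparable leq v w \<or> \<not> linked leq V u w \<or> \<not> linked leq V v w"
  using assms unfolding weakly_resolving_def by blast

section \<open>A chain of crowns inside a box\<close>

fun greedy :: "nat list \<Rightarrow> nat \<Rightarrow> nat list" where
  "greedy [] v = []" | "greedy (L # Ls) v = min L v # greedy Ls (v - L)"

lemma length_greedy [simp]: "length (greedy Ls v) = length Ls"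
  by (induction Ls arbitrary: v) auto
lemma greedy_mono: "u \<le> v \<Longrightarrow> vle (greedy Ls u) (greedy Ls v)"
  by (induction Ls arbitrary: u v) (auto intro: diff_le_mono)
lemma greedy_le: "vle (greedy Ls u) Ls"
  by (induction Ls arbitrary: u) auto
lemma greedy_sum: "sum_list (greedy Ls v) = min (sum_list Ls) v"
  by (induction Ls arbitrary: v) auto

text \<open>A maximal chain from bottom to top. All its inner elements have an entry that is neither 0 nor maximal,
  so that no inner element has a complement.\<close>
definition path :: "nat \<Rightarrow> nat list \<Rightarrow> nat \<Rightarrow> nat list" where
  "path L Ls v = (if v = 0 then 0 # zeros Ls else (1 + (v - 1 - sum_list Ls)) # greedy Ls (v - 1))"

lemma path_mono: "u \<le> v \<Longrightarrow> vle (path L Ls u) (path L Ls v)"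
  by (auto simp: path_def vle_zeros greedy_mono)

lemma path_sum: "sum_list (path L Ls v) = v"
  by (auto simp: path_def greedy_sum zeros_def)

lemma path_le: "1 \<le> L \<Longrightarrow> v \<le> L + sum_list Ls \<Longrightarrow> vle (path L Ls v) (L # Ls)"
  by (auto simp: path_def greedy_le) (simp add: zeros_def list_all2_conv_all_nth)

lemma path_top: "1 \<le> L \<Longrightarrow> path L Ls (L + sum_list Ls) = L # Ls"
  by (rule vle_sum_eq[OF path_le]) (auto simp: path_sum)

lemma length_path: "length (path L Ls v) = Suc (length Ls)" by (simp add: path_def)

fun enc :: "hex \<Rightarrow> nat list" where
  "enc A1 = [1, 0, 0]" | "enc A2 = [0, 1, 0]" | "enc A3 = [0, 0, 1]"
| "enc B1 = [0, 1, 1]" | "enc B2 = [1, 0, 1]" | "enc B3 = [1, 1, 0]"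

lemma vle_enc: "vle (enc y) (enc z) \<longleftrightarrow> hle y z" by (cases y; cases z) (auto simp: hle_def)
lemma enc_inj: "enc y = enc z \<longleftrightarrow> y = z" by (cases y; cases z) auto
lemma length_enc [simp]: "length (enc y) = 3" by (cases y) auto
lemma enc_bounds [simp]: "vle (enc y) [1, 1, 1]" "vle [0, 0, 0] (enc y)"
  "enc y \<noteq> [1, 1, 1]" "enc y \<noteq> [0, 0, 0]" "\<not> vle [1, 1, 1] (enc y)" "\<not> vle (enc y) [0, 0, 0]" by (cases y; auto)+
lemma enc_cases:
  assumes "vle b [1, 1, 1]"
  shows "b = [0, 0, 0] \<or> b = [1, 1, 1] \<or> b \<in> range enc"
proof -
  obtain b1 b2 b3 where b: "b = [b1, b2, b3]" "b1 \<le> 1" "b2 \<le> 1" "b3 \<le> 1"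
    using assms by (auto simp: list_all2_Cons2)
  then have "b \<in> {[0, 0, 0], [1, 1, 1], enc A1, enc A2, enc A3, enc B1, enc B2, enc B3}" by (auto simp: le_Suc_eq)
  then show ?thesis by blast
qed
lemma enc_compl: "(\<And>i. i < 3 \<Longrightarrow> min (enc y ! i) (enc z ! i) = 0 \<and> max (enc y ! i) (enc z ! i) = [1, 1, 1] ! i) \<Longrightarrow> y = compl6 z"
proof -
  assume "\<And>i. i < 3 \<Longrightarrow> min (enc y ! i) (enc z ! i) = 0 \<and> max (enc y ! i) (enc z ! i) = [1, 1, 1] ! i"
  from this[of 0] this[of 1] this[of 2] show ?thesis by (cases y; cases z) (auto simp: numeral_2_eq_2)
qed

lemma vle_append: "length c = length d \<Longrightarrow> vle (c @ b) (d @ e) \<longleftrightarrow> vle c d \<and> vle b e"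
  by (rule list_all2_append) (auto dest: list_all2_lengthD)

text \<open>The last three coordinates are the fields that are split off; \<open>L\<close> belongs
  to a factor that is not a field, and \<open>2 <= L\<close> leaves room for an entry strictly
  between its bounds.\<close>

locale hexchain =
  fixes L :: nat and Ls :: "nat list" and S :: "nat list set"
  assumes L2: "2 \<le> L" and finS: "finite S"
    and weak: "weakly_resolving vle (vertices (L # Ls @ [1, 1, 1])) S"
begin

definition N where "N = L + sum_list Ls"
abbreviation V where "V \<equiv> vertices (L # Ls @ [1, 1, 1])"
abbreviation \<gamma> where "\<gamma> \<equiv> path L Ls"
definition cpart where "cpart w = take (Suc (length Ls)) w"
definition bpart where "bpart w = drop (Suc (length Ls)) w"
text \<open>With \<open>Q\<close> below, the nearest levels above and below the chain part of
  \<open>w\<close>. They turn its comparabilities with the levels into the two thresholds of a test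
  vertex.\<close>

definition P where "P w = (LEAST v. vle (cpart w) (\<gamma> v))"
definition Q where "Q w = (GREATEST v. v \<le> N \<and> vle (\<gamma> v) (cpart w))"
definition el where "el v y = \<gamma> v @ enc y"
definition W where "W = {w \<in> S. bpart w \<in> range enc}"
definition X where "X w = inv_into UNIV enc (bpart w)"

lemma w_eq: "cpart w @ bpart w = w" by (simp add: cpart_def bpart_def)
lemma length_w: "w \<in> V \<Longrightarrow> length (cpart w) = Suc (length Ls)" "w \<in> V \<Longrightarrow> length (bpart w) = 3"
  by (auto simp: vertices_def cpart_def bpart_def dest!: list_all2_lengthD)

lemma vle_parts: "w \<in> V \<Longrightarrow> vle (cpart w) (L # Ls)" "w \<in> V \<Longrightarrow> vle (bpart w) [1, 1, 1]"
proof -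
  assume w: "w \<in> V"
  then have "vle (cpart w @ bpart w) ((L # Ls) @ [1, 1, 1])" by (simp add: vertices_def w_eq)
  then show "vle (cpart w) (L # Ls)" "vle (bpart w) [1, 1, 1]"
    using vle_append[of "cpart w" "L # Ls" "bpart w" "[1, 1, 1]"] length_w(1)[OF w] by simp_all
qed

lemma \<gamma>N: "\<gamma> N = L # Ls" using path_top L2 by (simp add: N_def)

lemma P_le: "w \<in> V \<Longrightarrow> vle (cpart w) (\<gamma> v) \<longleftrightarrow> P w \<le> v" and P_N: "w \<in> V \<Longrightarrow> P w \<le> N"
proof -
  assume w: "w \<in> V"
  have top: "vle (cpart w) (\<gamma> N)" using vle_parts(1)[OF w] \<gamma>N by simp
  then show "P w \<le> N" unfolding P_def by (rule Least_le)
  have P: "vle (cpart w) (\<gamma> (P w))" unfolding P_def by (rule LeastI[of _ N]) (rule top)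
  show "vle (cpart w) (\<gamma> v) \<longleftrightarrow> P w \<le> v"
  proof
    show "P w \<le> v" if "vle (cpart w) (\<gamma> v)" unfolding P_def using that by (rule Least_le)
    show "vle (cpart w) (\<gamma> v)" if "P w \<le> v" by (rule vle_trans[OF P path_mono[OF that]])
  qed
qed

lemma Q_ge: "w \<in> V \<Longrightarrow> v \<le> N \<Longrightarrow> vle (\<gamma> v) (cpart w) \<longleftrightarrow> v \<le> Q w" and Q_P: "w \<in> V \<Longrightarrow> Q w \<le> P w"
proof -
  assume w: "w \<in> V"
  let ?R = "\<lambda>v. v \<le> N \<and> vle (\<gamma> v) (cpart w)"
  have "?R 0" using length_w(1)[OF w] vle_zeros[of "L # Ls"] by (simp add: path_def)
  then have Q: "?R (Q w)" unfolding Q_def by (rule GreatestI_nat[of _ _ N]) simp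
  have "vle (\<gamma> (Q w)) (\<gamma> (P w))" by (rule vle_trans[of _ "cpart w"]) (use Q P_le[OF w] in auto)
  then show "Q w \<le> P w" using vle_sum path_sum by metis
  assume v: "v \<le> N"
  show "vle (\<gamma> v) (cpart w) \<longleftrightarrow> v \<le> Q w"
  proof
    show "v \<le> Q w" if "vle (\<gamma> v) (cpart w)" unfolding Q_def
      by (rule Greatest_le_nat[of _ _ N]) (use that v in auto)
    show "vle (\<gamma> v) (cpart w)" if "v \<le> Q w" by (rule vle_trans[OF path_mono[OF that]]) (use Q in simp)
  qed
qed


lemma parts_append: "length c = Suc (length Ls) \<Longrightarrow> cpart (c @ b) = c" "length c = Suc (length Ls) \<Longrightarrow> bpart (c @ b) = b"
  by (auto simp: cpart_def bpart_def)

lemma el_V: "v \<le> N \<Longrightarrow> el v y \<in> V"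
proof -
  assume v: "v \<le> N"
  have "vle (\<gamma> v @ enc y) ((L # Ls) @ [1, 1, 1])"
    using path_le[of L v Ls] v L2 by (subst vle_append) (auto simp: length_path N_def simp del: One_nat_def)
  moreover have "\<gamma> v @ enc y \<noteq> zeros (L # Ls) @ [0, 0, 0]" "\<gamma> v @ enc y \<noteq> (L # Ls) @ [1, 1, 1]"
    using append_eq_append_conv[of "\<gamma> v" "0 # zeros Ls" "enc y" "[0, 0, 0]"]
      append_eq_append_conv[of "\<gamma> v" "L # Ls" "enc y" "[1, 1, 1]"] by (simp_all add: length_path del: One_nat_def)
  ultimately show ?thesis by (simp add: vertices_def el_def zeros_def)
qed

lemma el_inj: "el v y = el v' y' \<longleftrightarrow> v = v' \<and> y = y'"
proof
  assume "el v y = el v' y'"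
  then have "\<gamma> v = \<gamma> v'" "enc y = enc y'" by (auto simp: el_def length_path)
  then show "v = v' \<and> y = y'" using path_sum enc_inj by metis
qed simp

lemma comparable_el:
  assumes "w \<in> V" "v \<le> N"
  shows "comparable vle (el v y) w \<longleftrightarrow> v \<le> Q w \<and> vle (enc y) (bpart w) \<or> P w \<le> v \<and> vle (bpart w) (enc y)"
proof -
  have "comparable vle (el v y) (cpart w @ bpart w) \<longleftrightarrow>
      vle (\<gamma> v) (cpart w) \<and> vle (enc y) (bpart w) \<or> vle (cpart w) (\<gamma> v) \<and> vle (bpart w) (enc y)"
    unfolding comparable_def el_def using length_w(1)[OF assms(1)] by (simp add: vle_append length_path)
  then show ?thesis using P_le[OF assms(1)] Q_ge[OF assms] by (simp add: w_eq)
qed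

lemma W_V: "w \<in> W \<Longrightarrow> w \<in> V" using weak by (auto simp: W_def weakly_resolving_def)
lemma enc_X: "w \<in> W \<Longrightarrow> bpart w = enc (X w)" by (auto simp: W_def X_def f_inv_into_f)

sublocale hexconf W Q P X N
  by unfold_locales (use finS W_V Q_P P_N L2 in \<open>auto simp: W_def N_def\<close>)

lemma comp_el: "w \<in> W \<Longrightarrow> v \<le> N \<Longrightarrow> comparable vle (el v y) w \<longleftrightarrow> local.comp w v y"
  using comparable_el[OF W_V] enc_X by (auto simp: comp_def vle_enc)

lemma el_sing: "v \<le> N \<Longrightarrow> el v y \<in> S \<Longrightarrow> \<exists>w\<in>W. sing w v y"
proof -
  assume v: "v \<le> N" "el v y \<in> S"
  have parts: "cpart (el v y) = \<gamma> v" "bpart (el v y) = enc y" by (simp_all add: el_def parts_append length_path)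
  have W: "el v y \<in> W" using v parts by (simp add: W_def)
  have "P (el v y) \<le> v" "v \<le> Q (el v y)"
    using P_le[OF W_V[OF W], of v] Q_ge[OF W_V[OF W] v(1)] parts vle_refl by auto
  then have "P (el v y) = v" "Q (el v y) = v" using Q_P[OF W_V[OF W]] by auto
  moreover have "X (el v y) = y" using enc_X[OF W] parts enc_inj by simp
  ultimately show ?thesis using W by (auto simp: sing_def)
qed

text \<open>Distances of 3 or more bring nothing new on the chain of crowns: such a pair is
  complementary, so the level is an end of the chain and the partner is one that \<open>sing\<close>
  already accounts for.\<close>

lemma unlinked_sing:
  assumes "w \<in> S" "v \<le> N" "\<not> linked vle V (el v y) w"
  shows "w \<in> W \<and> sing w v y"
proof -
  have w: "w \<in> V" using assms(1) weak by (auto simp: weakly_resolving_def)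
  note c = complementary[OF el_V[OF assms(2)] w assms(3)]
  have nth: "el v y ! i = \<gamma> v ! i" "w ! i = cpart w ! i" "(L # Ls @ [1, 1, 1]) ! i = (L # Ls) ! i" if "i \<le> length Ls" for i
    using that by (auto simp: el_def nth_append length_path cpart_def nth_Cons split: nat.splits)
  have cc: "min (\<gamma> v ! i) (cpart w ! i) = 0 \<and> max (\<gamma> v ! i) (cpart w ! i) = (L # Ls) ! i" if "i \<le> length Ls" for i
    using c[of i] that nth[OF that] by simp
  have cb: "min (enc y ! i) (bpart w ! i) = 0 \<and> max (enc y ! i) (bpart w ! i) = [1, 1, 1] ! i" if "i < 3" for i
  proof -
    have "el v y ! (Suc (length Ls) + i) = enc y ! i" by (simp add: el_def nth_append length_path)
    moreover have "w ! (Suc (length Ls) + i) = bpart w ! i"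
      using length_w[OF w] w_eq[of w] by (metis nth_append_length_plus)
    moreover have "(L # Ls @ [1, 1, 1]) ! (Suc (length Ls) + i) = [1, 1, 1] ! i"
      by (simp add: nth_append)
    ultimately show ?thesis using c[of "Suc (length Ls) + i"] that by simp
  qed
  have "bpart w \<in> range enc"
  proof -
    have "bpart w \<noteq> [0, 0, 0]"
    proof
      assume b: "bpart w = [0, 0, 0]"
      show False using cb[of 0] cb[of 1] cb[of 2] unfolding b by (cases y) (auto simp: numeral_2_eq_2)
    qed
    moreover have "bpart w \<noteq> [1, 1, 1]"
    proof
      assume b: "bpart w = [1, 1, 1]"
      show False using cb[of 0] cb[of 1] cb[of 2] unfolding b by (cases y) (auto simp: numeral_2_eq_2)
    qed
    ultimately show ?thesis using enc_cases[OF vle_parts(2)[OF w]] by blast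
  qed
  then have W: "w \<in> W" using assms(1) by (simp add: W_def)
  have y: "y = compl6 (X w)" by (rule enc_compl) (use cb enc_X[OF W] in auto)
  have len: "length (cpart w) = Suc (length Ls)" using length_w[OF w] by simp
  consider "v = 0" | "v = N" | "0 < v" "v < N" using assms(2) by linarith
  then have "v = 0 \<and> Q w = N \<or> v = N \<and> P w = 0"
  proof cases
    case 1
    have "cpart w = L # Ls"
    proof (rule nth_equalityI)
      fix i assume "i < length (cpart w)"
      then have i: "i \<le> length Ls" using len by simp
      have "\<gamma> v ! i = 0" using 1 i by (auto simp: path_def zeros_def nth_Cons split: nat.splits)
      then show "cpart w ! i = (L # Ls) ! i" using cc[OF i] by simp
    qed (use len in simp)
    then have "N \<le> Q w" using Q_ge[OF w, of N] \<gamma>N vle_refl by simp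
    then show ?thesis using 1 Q_P[OF w] P_N[OF w] by simp
  next
    case 2
    have "cpart w = zeros (L # Ls)"
    proof (rule nth_equalityI)
      fix i assume "i < length (cpart w)"
      then have i: "i \<le> length Ls" using len by simp
      have pos: "(L # Ls) ! i = \<gamma> v ! i" using 2 \<gamma>N by simp
      have "cpart w ! i \<le> (L # Ls) ! i" using vle_parts(1)[OF w] i len by (auto simp: list_all2_conv_all_nth)
      then have "cpart w ! i = 0" using cc[OF i] pos by (auto simp: min_def split: if_splits)
      then show "cpart w ! i = zeros (L # Ls) ! i" using i by (auto simp: zeros_def nth_Cons split: nat.splits)
    qed (use len in simp)
    then have "P w \<le> 0" using P_le[OF w, of 0] vle_refl by (simp add: path_def)
    then show ?thesis using 2 by simp
  next
    case 3
    \<comment> \<open>Inside the chain the entry for \<open>L\<close> is strictly between 0 and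
      \<open>L\<close>, which no complement can match.\<close>
    have "\<gamma> v ! 0 = 1 + (v - 1 - sum_list Ls)" using 3 by (simp add: path_def)
    then have "0 < \<gamma> v ! 0" "\<gamma> v ! 0 < L" using 3 L2 by (auto simp: N_def)
    then show ?thesis using cc[of 0] by (auto simp: min_def max_def split: if_splits)
  qed
  then show ?thesis using W y by (auto simp: sing_def)
qed

lemma card_S: "L + sum_list Ls + 3 \<le> card S"
proof -
  \<comment> \<open>With trace 000, comparability with \<open>el v y\<close> means
    \<open>P w <= v\<close> and changes only on entering level \<open>P w\<close>; with trace 111 it
    means \<open>v <= Q w\<close> and changes only on leaving level \<open>Q w\<close>. The steps in
    \<open>D\<close> are untouched by all such members.\<close>
  define D where "D = {a. a < N \<and> (\<forall>w\<in>S. \<not> (bpart w = [0, 0, 0] \<and> P w = Suc a) \<and> \<not> (bpart w = [1, 1, 1] \<and> Q w = a))}"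
  have S_V: "S \<subseteq> V" using weak by (simp add: weakly_resolving_def)
  have "card D + 3 \<le> card W"
  proof (rule hex_bound)
    show "D \<subseteq> {..<N}" by (auto simp: D_def)
    fix v v' y y'
    assume v: "v \<le> v'" "v' \<le> N" "(v, y) \<noteq> (v', y')" "{v..<v'} \<subseteq> D" "\<forall>w\<in>W. \<not> sing w v y \<and> \<not> sing w v' y'"
    have vN: "v \<le> N" using v by simp
    obtain w where w: "w \<in> S" "w \<in> V" "comparable vle (el v y) w \<noteq> comparable vle (el v' y') w \<or>
        \<not> linked vle V (el v y) w \<or> \<not> linked vle V (el v' y') w"
      using weakly_resolvingE[OF weak el_V[OF vN] el_V[OF v(2)], of y y'] el_sing vN v el_inj by metis
    then have ne: "comparable vle (el v y) w \<noteq> comparable vle (el v' y') w"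
      using unlinked_sing vN v by blast
    have "w \<in> W"
    proof (rule ccontr)
      assume "w \<notin> W"
      then consider "bpart w = [0, 0, 0]" | "bpart w = [1, 1, 1]"
        using enc_cases[OF vle_parts(2)[OF w(2)]] w(1) by (auto simp: W_def)
      then show False
      proof cases
        case 1
        then have "P w \<le> v \<longleftrightarrow> \<not> P w \<le> v'" using ne comparable_el[OF w(2)] vN v(2) by simp
        then have "v < P w" "P w \<le> v'" using v(1) by auto
        then have "P w - 1 \<in> {v..<v'}" by auto
        then have "P w - 1 \<in> D" using v(4) by blast
        then show False using 1 w(1) \<open>v < P w\<close> by (auto simp: D_def)
      next
        case 2
        then have "v \<le> Q w \<longleftrightarrow> \<not> v' \<le> Q w" using ne comparable_el[OF w(2)] vN v(2) by (simp del: One_nat_def)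
        then have "v \<le> Q w" "Q w < v'" using v(1) by auto
        then have "Q w \<in> D" using v(4) by auto
        then show False using 2 w(1) by (auto simp: D_def)
      qed
    qed
    then show "\<exists>w\<in>W. local.comp w v y \<noteq> local.comp w v' y'" using ne comp_el vN v(2) by blast
  qed
  moreover have "card ({..<N} - D) \<le> card (S - W)"
  proof (rule surj_card_le)
    show "{..<N} - D \<subseteq> (\<lambda>w. if bpart w = [0, 0, 0] then P w - 1 else Q w) ` (S - W)"
    proof
      fix a assume a: "a \<in> {..<N} - D"
      then obtain w where w: "w \<in> S" "bpart w = [0, 0, 0] \<and> P w = Suc a \<or> bpart w = [1, 1, 1] \<and> Q w = a"
        by (auto simp: D_def)
      moreover have "w \<notin> W" using w(2) enc_bounds(3,4) unfolding W_def by fastforce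
      ultimately show "a \<in> (\<lambda>w. if bpart w = [0, 0, 0] then P w - 1 else Q w) ` (S - W)"
        by (intro image_eqI[of _ _ w]) auto
    qed
  qed (use finS in auto)
  moreover have "card ({..<N} - D) + card D = N"
  proof -
    have "D \<subseteq> {..<N}" by (auto simp: D_def)
    then show ?thesis using card_Diff_subset[of D "{..<N}"] card_mono[of "{..<N}" D] finite_subset[of D "{..<N}"] by simp
  qed
  moreover have "card (S - W) + card W = card S"
  proof -
    have "W \<subseteq> S" by (auto simp: W_def)
    then show ?thesis using card_Diff_subset[of W S] card_mono[of S W] finS finite_subset[of W S] by simp
  qed
  \<comment> \<open>There are at least \<open>N - card D\<close> members outside \<open>W\<close>
    and at least \<open>card D + 3\<close> inside.\<close>
  ultimately show ?thesis by (simp add: N_def)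
qed

end


section \<open>Resolving sets on the axes\<close>

lemma comparable_cong:
  "comparable vle [a, b] [c, d] \<longleftrightarrow> a \<le> c \<and> b \<le> d \<or> c \<le> a \<and> d \<le> b"
  "comparable vle [a, b, e] [c, d, f] \<longleftrightarrow> a \<le> c \<and> b \<le> d \<and> e \<le> f \<or> c \<le> a \<and> d \<le> b \<and> f \<le> e"
  by (auto simp: comparable_def)

definition axis :: "nat list \<Rightarrow> nat \<Rightarrow> nat \<Rightarrow> nat list" where
  "axis Ls i a = (zeros Ls)[i := a]"

text \<open>A vertex below an axis vector lies on the same axis and thus in \<open>S\<close>. For
  all others, comparability with \<open>axis Ls i a\<close> means \<open>a <= v ! i\<close>, so
  comparabilities alone reveal every coordinate.\<close>

lemma axis_bound:
  assumes "2 \<le> length Ls" "\<And>L. L \<in> set Ls \<Longrightarrow> 1 \<le> L"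
  shows "\<exists>S. finite S \<and> strongly_resolving vle (vertices Ls) S \<and> card S = sum_list Ls"
proof -
  define I where "I = (SIGMA i:{..<length Ls}. {1..Ls ! i})"
  define S where "S = (\<lambda>(i, a). axis Ls i a) ` I"
  have nth: "axis Ls i a ! j = (if i = j then a else 0)" if "j < length Ls" for i a j
    using that by (simp add: axis_def zeros_def nth_list_update)
  have len: "length (axis Ls i a) = length Ls" for i a by (simp add: axis_def)
  have inj: "inj_on (\<lambda>(i, a). axis Ls i a) I"
  proof (rule inj_onI)
    fix s t assume st: "s \<in> I" "t \<in> I" "(case s of (i, a) \<Rightarrow> axis Ls i a) = (case t of (i, a) \<Rightarrow> axis Ls i a)"
    obtain i a j b where eq: "s = (i, a)" "t = (j, b)" by (metis surj_pair)
    have "axis Ls i a ! i = axis Ls j b ! i" using st(3) eq by simp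
    then show "s = t" using st(1,2) nth[of i i a] nth[of i j b] by (simp add: eq I_def split: if_splits)
  qed
  have "card S = card I" unfolding S_def by (rule card_image[OF inj])
  also have "\<dots> = (\<Sum>i<length Ls. Ls ! i)" unfolding I_def by simp
  also have "\<dots> = sum_list Ls" by (simp add: sum_list_sum_nth atLeast0LessThan)
  finally have card: "card S = sum_list Ls" .
  have finS: "finite S" unfolding S_def I_def by auto
  have sub: "S \<subseteq> vertices Ls"
  proof (clarsimp simp: S_def I_def)
    fix i a assume i: "i < length Ls" "Suc 0 \<le> a" "a \<le> Ls ! i"
    \<comment> \<open>A second coordinate, where the entry is 0, keeps the axis vector from being
      the top.\<close>
    define j where "j = (if i = 0 then 1 else 0 :: nat)"
    have j: "j < length Ls" "j \<noteq> i" using assms(1) by (auto simp: j_def)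
    have "1 \<le> Ls ! j" using assms(2) j by simp
    then have "axis Ls i a ! j \<noteq> Ls ! j" "axis Ls i a ! i \<noteq> zeros Ls ! i"
      using nth j i by (auto simp: zeros_def)
    moreover have "vle (axis Ls i a) Ls" using nth i len by (auto simp: list_all2_conv_all_nth)
    ultimately show "axis Ls i a \<in> vertices Ls" by (auto simp: vertices_def)
  qed
  have thr: "comparable vle v (axis Ls i a) \<longleftrightarrow> a \<le> v ! i" if "v \<in> vertices Ls - S" "i < length Ls" "1 \<le> a" "a \<le> Ls ! i" for v i a
  proof -
    have v: "length v = length Ls" "v \<in> vertices Ls" using that(1) by (auto simp: vertices_def dest: list_all2_lengthD)
    have "\<not> vle v (axis Ls i a)"
    proof
      assume leq: "vle v (axis Ls i a)"
      have 0: "v ! j = 0" if "j < length Ls" "j \<noteq> i" for j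
        using leq nth[OF that(1), of i a] that v(1) by (auto simp: list_all2_conv_all_nth)
      have vi: "v ! i \<le> Ls ! i" using v(2) that(2) by (auto simp: vertices_def list_all2_conv_all_nth)
      have "v = axis Ls i (v ! i)"
        by (rule nth_equalityI) (use v(1) len nth 0 in auto)
      moreover have "v ! i \<noteq> 0"
      proof
        assume "v ! i = 0"
        then have "v = zeros Ls" by (intro nth_equalityI) (use v(1) 0 in \<open>auto simp: zeros_def\<close>)
        then show False using v(2) by (simp add: vertices_def)
      qed
      ultimately have "v \<in> S" unfolding S_def I_def
        using that(2) vi by (intro image_eqI[of _ _ "(i, v ! i)"]) auto
      then show False using that(1) by simp
    qed
    moreover have "vle (axis Ls i a) v \<longleftrightarrow> a \<le> v ! i"
      using that(2) nth v(1) len by (auto simp: list_all2_conv_all_nth)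
    ultimately show ?thesis by (simp add: comparable_def)
  qed
  have "strongly_resolving vle (vertices Ls) S"
    unfolding strongly_resolving_def
  proof (intro conjI sub ballI impI)
    fix u v assume uv: "u \<in> vertices Ls - S" "v \<in> vertices Ls - S" "u \<noteq> v"
    then have len: "length u = length Ls" "length v = length Ls" by (auto simp: vertices_def dest: list_all2_lengthD)
    then obtain i where i: "i < length Ls" "u ! i \<noteq> v ! i" using uv(3) nth_equalityI[of u v] by auto
    define a where "a = max (u ! i) (v ! i)"
    have "u ! i \<le> Ls ! i" "v ! i \<le> Ls ! i" using uv i by (auto simp: vertices_def list_all2_conv_all_nth)
    then have a: "1 \<le> a" "a \<le> Ls ! i" using i(2) by (auto simp: a_def max_def)
    have "comparable vle u (axis Ls i a) \<noteq> comparable vle v (axis Ls i a)"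
      using thr[OF uv(1) i(1) a] thr[OF uv(2) i(1) a] i(2) by (auto simp: a_def max_def)
    moreover have "axis Ls i a \<in> S" unfolding S_def I_def using i a by force
    ultimately show "\<exists>w\<in>S. comparable vle u w \<noteq> comparable vle v w \<or> linked vle (vertices Ls) u w \<noteq> linked vle (vertices Ls) v w"
      by blast
  qed
  then show ?thesis using finS card by blast
qed

section \<open>One chain with one or two fields\<close>

lemma verts2: "v \<in> vertices [L, 1] \<longleftrightarrow> (\<exists>a b. v = [a, b] \<and> a \<le> L \<and> b \<le> 1 \<and> \<not> (a = 0 \<and> b = 0) \<and> \<not> (a = L \<and> b = 1))"
  by (auto simp: vertices_def list_all2_Cons2)

lemma verts3: "v \<in> vertices [L, 1, 1] \<longleftrightarrow> (\<exists>a b c. v = [a, b, c] \<and> a \<le> L \<and> b \<le> 1 \<and> c \<le> 1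
    \<and> \<not> (a = 0 \<and> b = 0 \<and> c = 0) \<and> \<not> (a = L \<and> b = 1 \<and> c = 1))"
  by (auto simp: vertices_def list_all2_Cons2)

text \<open>One vertex fewer than on the axes: \<open>[1, 0, 0]\<close> is dropped, and
  \<open>[1, 1, 0]\<close>, \<open>[1, 0, 1]\<close> replace the two field axes. The vectors
  \<open>[k, 0, 0]\<close> reveal a first entry of at least 2, and the other two reveal the field
  entries and tell first entry 0 from 1. The only vertex outside \<open>S\<close> whose field
  entries both vanish is \<open>[1, 0, 0]\<close>. It is comparable to all of \<open>S\<close>,
  which no other vertex outside \<open>S\<close> with first entry \<open>L\<close> is.\<close>

lemma upper3:
  assumes L: "2 \<le> L"
  shows "\<exists>S. finite S \<and> strongly_resolving vle (vertices [L, 1, 1]) S \<and> card S = L + 1"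
proof -
  define S where "S = {[1, 1, 0], [1, 0, 1]} \<union> (\<lambda>c. [c, 0, 0]) ` {2..L}"
  have "card S = card {[1, 1, 0], [1, 0, 1 :: nat]} + card ((\<lambda>c. [c, 0, 0 :: nat]) ` {2..L})"
    unfolding S_def by (rule card_Un_disjoint) auto
  then have card: "card S = L + 1" using L by (simp add: card_image inj_on_def)
  have sub: "S \<subseteq> vertices [L, 1, 1]" using L by (auto simp: S_def verts3 simp del: One_nat_def)
  have "strongly_resolving vle (vertices [L, 1, 1]) S"
    unfolding strongly_resolving_def
  proof (intro conjI sub ballI impI)
    fix u v assume uv: "u \<in> vertices [L, 1, 1] - S" "v \<in> vertices [L, 1, 1] - S" "u \<noteq> v"
    show "\<exists>w\<in>S. comparable vle u w \<noteq> comparable vle v w \<or> linked vle (vertices [L, 1, 1]) u w \<noteq> linked vle (vertices [L, 1, 1]) v w"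
    proof (rule ccontr)
      assume "\<not> ?thesis"
      then have eq: "comparable vle u w = comparable vle v w" if "w \<in> S" for w using that by blast
      obtain a b c where u: "u = [a, b, c]" "a \<le> L" "b \<le> 1" "c \<le> 1" "\<not> (a = 0 \<and> b = 0 \<and> c = 0)" "\<not> (a = L \<and> b = 1 \<and> c = 1)"
        using uv(1) by (auto simp: verts3 simp del: One_nat_def)
      obtain a' b' c' where v: "v = [a', b', c']" "a' \<le> L" "b' \<le> 1" "c' \<le> 1" "\<not> (a' = 0 \<and> b' = 0 \<and> c' = 0)" "\<not> (a' = L \<and> b' = 1 \<and> c' = 1)"
        using uv(2) by (auto simp: verts3 simp del: One_nat_def)
      have 1: "comparable vle u [1, 1, 0] = comparable vle v [1, 1, 0]" "comparable vle u [1, 0, 1] = comparable vle v [1, 0, 1]"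
        using eq by (auto simp: S_def)
      have k: "comparable vle u [k, 0, 0] = comparable vle v [k, 0, 0]" if "2 \<le> k" "k \<le> L" for k
        using eq that by (auto simp: S_def)
      have nS: "[a, b, c] \<notin> S" "[a', b', c'] \<notin> S" using uv(1,2) u(1) v(1) by simp_all
      have n0: "\<not> (b = 0 \<and> c = 0 \<and> 2 \<le> a)" "\<not> (b' = 0 \<and> c' = 0 \<and> 2 \<le> a')"
        "\<not> (a = 1 \<and> b = 1 \<and> c = 0)" "\<not> (a = 1 \<and> b = 0 \<and> c = 1)" "\<not> (a' = 1 \<and> b' = 1 \<and> c' = 0)" "\<not> (a' = 1 \<and> b' = 0 \<and> c' = 1)"
        using nS u(2) v(2) by (auto simp: S_def)
      have c1: "a \<le> 1 \<and> c = 0 \<or> 1 \<le> a \<and> b = 1 \<longleftrightarrow> a' \<le> 1 \<and> c' = 0 \<or> 1 \<le> a' \<and> b' = 1"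
        using 1(1) u(3,4) v(3,4) unfolding u(1) v(1) comparable_cong by auto
      have c2: "a \<le> 1 \<and> b = 0 \<or> 1 \<le> a \<and> c = 1 \<longleftrightarrow> a' \<le> 1 \<and> b' = 0 \<or> 1 \<le> a' \<and> c' = 1"
        using 1(2) u(3,4) v(3,4) unfolding u(1) v(1) comparable_cong by auto
      have ck: "a \<le> k \<and> b = 0 \<and> c = 0 \<or> k \<le> a \<longleftrightarrow> a' \<le> k \<and> b' = 0 \<and> c' = 0 \<or> k \<le> a'" if "2 \<le> k" "k \<le> L" for k
        using k[OF that] unfolding u(1) v(1) comparable_cong by auto
      have ne: "\<not> (a = a' \<and> b = b' \<and> c = c')" using uv(3) u v by simp
      consider "b = 0" "c = 0" "b' = 0" "c' = 0" | "b = 0" "c = 0" "\<not> (b' = 0 \<and> c' = 0)"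
        | "\<not> (b = 0 \<and> c = 0)" "b' = 0" "c' = 0" | "\<not> (b = 0 \<and> c = 0)" "\<not> (b' = 0 \<and> c' = 0)" by blast
      then show False
      proof cases
        case 1 then show False using n0 ne u v by auto
      next
        case 2
        then have "a = 1" using n0 u by auto
        then have "L \<le> a'" using ck[of L] 2 L by auto
        then show False using c1 c2 \<open>a = 1\<close> 2 L v by auto
      next
        case 3
        then have "a' = 1" using n0 v by auto
        then have "L \<le> a" using ck[of L] 3 L by auto
        then show False using c1 c2 \<open>a' = 1\<close> 3 L u by auto
      next
        case 4
        then have leq: "k \<le> a \<longleftrightarrow> k \<le> a'" if "2 \<le> k" "k \<le> L" for k using ck[OF that] by auto
        show False
        proof (cases "2 \<le> a")
          case True
          then have "a' = a" using leq[of a] leq[of a'] u(2) v(2) by auto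
          then show False using c1 c2 True ne u(3,4) v(3,4) by auto
        next
          case False
          then have "a \<le> 1" "a' \<le> 1" using leq[of 2] L by auto
          then show False using c1 c2 ne n0 4 u(3,4) v(3,4) by (auto simp: le_Suc_eq)
        qed
      qed
    qed
  qed
  moreover have "finite S" by (simp add: S_def)
  ultimately show ?thesis using card by blast
qed

text \<open>Outside \<open>S\<close> there are \<open>[L - 1, 1]\<close> and the vertices
  \<open>[a, 0]\<close>. The thresholds \<open>a <= c\<close> separate the latter except for
  \<open>a = L - 1\<close> and \<open>a = L\<close>; these two are told apart because
  \<open>[L, 0]\<close> is the complement of \<open>[0, 1]\<close> and so not linked to it.\<close>

lemma upper2:
  assumes L: "2 \<le> L"
  shows "\<exists>S. finite S \<and> strongly_resolving vle (vertices [L, 1]) S \<and> card S = L - 1"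
proof -
  define S where "S = (\<lambda>c. [c, 1]) ` {..<L - 1}"
  have card: "card S = L - 1" by (simp add: S_def card_image inj_on_def)
  have sub: "S \<subseteq> vertices [L, 1]" using L by (auto simp: S_def verts2 simp del: One_nat_def)
  have link: "linked vle (vertices [L, 1]) [a, 0] [0, 1] \<longleftrightarrow> a \<noteq> L" if "1 \<le> a" "a \<le> L" for a
  proof
    assume "linked vle (vertices [L, 1]) [a, 0] [0, 1]"
    then show "a \<noteq> L" using L by (auto simp: linked_def verts2 comparable_cong simp del: One_nat_def)
  next
    assume "a \<noteq> L"
    then show "linked vle (vertices [L, 1]) [a, 0] [0, 1]"
      unfolding linked_def using that by (intro bexI[of _ "[a, 1]"]) (auto simp: verts2 comparable_cong simp del: One_nat_def)
  qed
  have "strongly_resolving vle (vertices [L, 1]) S"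
    unfolding strongly_resolving_def
  proof (intro conjI sub ballI impI)
    fix u v assume uv: "u \<in> vertices [L, 1] - S" "v \<in> vertices [L, 1] - S" "u \<noteq> v"
    show "\<exists>w\<in>S. comparable vle u w \<noteq> comparable vle v w \<or> linked vle (vertices [L, 1]) u w \<noteq> linked vle (vertices [L, 1]) v w"
    proof (rule ccontr)
      assume "\<not> ?thesis"
      then have eq: "comparable vle u [c, 1] = comparable vle v [c, 1]"
          "linked vle (vertices [L, 1]) u [c, 1] = linked vle (vertices [L, 1]) v [c, 1]" if "c < L - 1" for c
        using that by (auto simp: S_def)
      obtain a b where u: "u = [a, b]" "a \<le> L" "b \<le> 1" "\<not> (a = 0 \<and> b = 0)" "\<not> (a = L \<and> b = 1)"
        using uv(1) by (auto simp: verts2 simp del: One_nat_def)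
      obtain a' b' where v: "v = [a', b']" "a' \<le> L" "b' \<le> 1" "\<not> (a' = 0 \<and> b' = 0)" "\<not> (a' = L \<and> b' = 1)"
        using uv(2) by (auto simp: verts2 simp del: One_nat_def)
      have one: "b = 1 \<Longrightarrow> a = L - 1" "b' = 1 \<Longrightarrow> a' = L - 1" using uv u v by (auto simp: S_def)
      have 0: "comparable vle u [0, 1] = comparable vle v [0, 1]"
          "linked vle (vertices [L, 1]) u [0, 1] = linked vle (vertices [L, 1]) v [0, 1]" using eq[of 0] L by auto
      have b: "b = b'"
        using 0(1) u v one L unfolding u(1) v(1) comparable_cong by (auto simp: le_Suc_eq)
      show False
      proof (cases "b = 1")
        case True then show False using one b uv(3) u v by auto
      next
        case False
        then have b0: "b = 0" "b' = 0" using u v b by auto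
        have "a \<noteq> a'" using uv(3) u v b by auto
        moreover have "a = L \<longleftrightarrow> a' = L" using 0(2) link[of a] link[of a'] u v b0 by auto
        ultimately have lt: "a < L" "a' < L" using u v by auto
        have "comparable vle [a, 0] [c, 1] \<longleftrightarrow> a \<le> c" "comparable vle [a', 0] [c, 1] \<longleftrightarrow> a' \<le> c" for c
          by (auto simp: comparable_cong)
        then have "a \<le> c \<longleftrightarrow> a' \<le> c" if "c < L - 1" for c using eq(1)[OF that] u v b0 by simp
        from this[of a] this[of a'] show False using lt \<open>a \<noteq> a'\<close> by linarith
      qed
    qed
  qed
  moreover have "finite S" by (simp add: S_def)
  ultimately show ?thesis using card by blast
qed

text \<open>The number of thresholds below \<open>a\<close> increases strictly along
  \<open>X\<close> and takes at most \<open>card B + 1\<close> values.\<close>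

lemma card_separated:
  fixes X B :: "nat set"
  assumes "finite X" "finite B" and sep: "\<And>a a'. a \<in> X \<Longrightarrow> a' \<in> X \<Longrightarrow> a < a' \<Longrightarrow> \<exists>c\<in>B. a \<le> c \<and> c < a'"
  shows "card X \<le> card B + 1"
proof -
  let ?f = "\<lambda>a. card {c \<in> B. c < a}"
  have less: "?f a < ?f a'" if a: "a \<in> X" "a' \<in> X" "a < a'" for a a'
  proof (rule psubset_card_mono)
    obtain c where "c \<in> B" "a \<le> c" "c < a'" using sep[OF a] by blast
    then have "c \<in> {c \<in> B. c < a'} - {c \<in> B. c < a}" by auto
    then show "{c \<in> B. c < a} \<subset> {c \<in> B. c < a'}" using a(3) by auto
  qed (use assms(2) in auto)
  have "inj_on ?f X"
  proof (rule inj_onI)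
    fix a a' assume "a \<in> X" "a' \<in> X" "?f a = ?f a'"
    then show "a = a'" using less[of a a'] less[of a' a] by (metis less_irrefl linorder_neqE_nat)
  qed
  moreover have "?f ` X \<subseteq> {..card B}" using assms(2) by (auto intro: card_mono)
  ultimately have "card X \<le> card {..card B}" by (intro card_inj_on_le) auto
  then show ?thesis by simp
qed

text \<open>The vertices \<open>[a, 0]\<close> are pairwise comparable, so among them only members
  \<open>[c, 1]\<close> help. Those with \<open>1 <= c\<close> act as thresholds, and
  \<open>[0, 1]\<close> acts only as the complement of \<open>[L, 0]\<close>. Hence all but at most
  one of the \<open>L\<close> vertices must be paid for.\<close>

lemma lower2:
  assumes L: "2 \<le> L" and fin: "finite S" and weak: "weakly_resolving vle (vertices [L, 1]) S"
  shows "L - 1 \<le> card S"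
proof -
  define A where "A = {a \<in> {1..L}. [a, 0] \<in> S}"
  define B where "B = {c \<in> {..<L}. [c, 1] \<in> S}"
  \<comment> \<open>The vertices \<open>[a, 0]\<close> outside \<open>S\<close>, without
    \<open>[L, 0]\<close> if its complement has already isolated it.\<close>
  define X where "X = {1..L} - A - (if 0 \<in> B then {L} else {})"
  have finAB: "finite A" "finite B" by (auto simp: A_def B_def)
  have "card X \<le> card (B - {0}) + 1"
  proof (rule card_separated)
    fix a a' assume a: "a \<in> X" "a' \<in> X" "a < a'"
    have V: "[a, 0] \<in> vertices [L, 1]" "[a', 0] \<in> vertices [L, 1]" using a by (auto simp: X_def verts2 simp del: One_nat_def)
    have "[a, 0] \<notin> S" "[a', 0] \<notin> S" using a by (auto simp: X_def A_def)
    from weakly_resolvingE[OF weak V this]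
    obtain w where w: "w \<in> S" "w \<in> vertices [L, 1]"
      "comparable vle [a, 0] w \<noteq> comparable vle [a', 0] w \<or>
       \<not> linked vle (vertices [L, 1]) [a, 0] w \<or> \<not> linked vle (vertices [L, 1]) [a', 0] w"
      using a(3) by auto
    obtain c b where cb: "w = [c, b]" "c \<le> L" "b \<le> 1" "\<not> (c = L \<and> b = 1)"
      using w(2) by (auto simp: verts2 simp del: One_nat_def)
    have unl: "c = 0 \<and> b = 1 \<and> u = L" if u: "\<not> linked vle (vertices [L, 1]) [u, 0] w" "[u, 0] \<in> vertices [L, 1]" "1 \<le> u" for u
    proof -
      have "min u c = 0" "max u c = L" "max 0 b = 1"
        using complementary[OF u(2) w(2) u(1), of 0] complementary[OF u(2) w(2) u(1), of 1] by (simp_all add: cb(1))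
      then show ?thesis using u(3) by (auto simp: min_def max_def split: if_splits)
    qed
    have nu: "linked vle (vertices [L, 1]) [a, 0] w" "linked vle (vertices [L, 1]) [a', 0] w"
    proof -
      have "1 \<le> a" "1 \<le> a'" using a by (auto simp: X_def)
      moreover have "\<not> (c = 0 \<and> b = 1 \<and> u = L)" if "u \<in> X" for u
        using that w(1) cb(1) L by (auto simp: X_def B_def split: if_splits)
      ultimately show "linked vle (vertices [L, 1]) [a, 0] w" "linked vle (vertices [L, 1]) [a', 0] w"
        using unl V a(1,2) by blast+
    qed
    then have ne: "comparable vle [a, 0] w \<noteq> comparable vle [a', 0] w" using w(3) by blast
    have "b = 1"
    proof (rule ccontr)
      assume "b \<noteq> 1"
      then have "b = 0" using cb(3) by simp
      then show False using ne by (auto simp: cb(1) comparable_cong)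
    qed
    then have "a \<le> c \<and> \<not> a' \<le> c" using ne a(3) cb by (auto simp: comparable_cong)
    moreover have "1 \<le> a" using a by (simp add: X_def)
    moreover have "c \<in> B" using w(1) cb \<open>b = 1\<close> by (auto simp: B_def)
    ultimately show "\<exists>c\<in>B - {0}. a \<le> c \<and> c < a'" by (intro bexI[of _ c]) auto
  qed (auto simp: X_def finAB)
  moreover have "L \<le> card X + card A + (if 0 \<in> B then 1 else 0)"
  proof -
    have "{1..L} \<subseteq> X \<union> A \<union> (if 0 \<in> B then {L} else {})" by (auto simp: X_def)
    then have "card {1..L} \<le> card (X \<union> A \<union> (if 0 \<in> B then {L} else {}))"
      by (rule card_mono[rotated]) (auto simp: X_def finAB)
    also have "\<dots> \<le> card (X \<union> A) + card (if 0 \<in> B then {L} else {})" by (rule card_Un_le)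
    also have "\<dots> \<le> card X + card A + card (if 0 \<in> B then {L} else {})" using card_Un_le[of X A] by simp
    finally show ?thesis by (auto split: if_splits)
  qed
  moreover have "card (B - {0}) + (if 0 \<in> B then 1 else 0) = card B"
    using finAB card_Suc_Diff1[of B 0] by auto
  moreover have "card A + card B \<le> card S"
  proof -
    have "card A + card B = card ((\<lambda>a. [a, 0::nat]) ` A) + card ((\<lambda>c. [c, 1::nat]) ` B)"
      by (simp add: card_image inj_on_def)
    also have "\<dots> = card ((\<lambda>a. [a, 0]) ` A \<union> (\<lambda>c. [c, 1]) ` B)"
      by (rule card_Un_disjoint[symmetric]) (auto simp: finAB)
    also have "\<dots> \<le> card S" by (rule card_mono[OF fin]) (auto simp: A_def B_def)
    finally show ?thesis .
  qed
  ultimately show ?thesis by linarith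
qed

text \<open>With at most \<open>L\<close> members a covering argument becomes tight. This forces the
  members with exactly one field entry to the ends of the chain, where they cannot separate the
  vertices \<open>[a, 1, 1]\<close>; separating these takes too many further members.\<close>

lemma lower3:
  assumes L: "2 \<le> L" and fin: "finite S" and weak: "weakly_resolving vle (vertices [L, 1, 1]) S"
  shows "L + 1 \<le> card S"
proof (rule ccontr)
  assume "\<not> ?thesis"
  then have leq: "card S \<le> L" by simp
  \<comment> \<open>Two columns, indexed by which field entry is 1. Vertices of one column are
    always comparable, vertices of different columns never.\<close>
  define e :: "nat \<Rightarrow> bool \<Rightarrow> nat list" where "e c t = [c, if t then 1 else 0, if t then 0 else 1]" for c t
  define M where "M = {(c, t). c \<le> L \<and> e c t \<in> S}"
  define Z where "Z = {c \<in> {1..L}. [c, 0, 0] \<in> S}"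
  define O1 where "O1 = {c \<in> {..<L}. [c, 1, 1] \<in> S}"
  \<comment> \<open>Steps within a column that no member \<open>[c, 0, 0]\<close> or
    \<open>[c, 1, 1]\<close> separates.\<close>
  define D where "D = {a. a < L \<and> Suc a \<notin> Z \<and> a \<notin> O1}"
  \<comment> \<open>The steps of the columns settled by \<open>e c t\<close>: those touching
    \<open>e c t\<close> itself and those touching its complement, which exists only for
    \<open>c = 0\<close> and \<open>c = L\<close>. There are two in each case.\<close>
  define K where "K = (\<lambda>(c, t). if c = 0 then {(0, t), (L - 1, \<not> t)} else if c = L then {(L - 1, t), (0, \<not> t)} else {(c - 1, t), (c, t)})"
  let ?V = "vertices [L, 1, 1]"
  have finM: "finite M"
  proof (rule finite_subset)
    show "M \<subseteq> {..L} \<times> UNIV" by (auto simp: M_def)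
  qed simp
  have finZO: "finite Z" "finite O1" "finite D" by (auto simp: Z_def O1_def D_def)
  have eV: "e c t \<in> ?V" if "c \<le> L" for c t using that by (auto simp: e_def verts3 simp del: One_nat_def)
  have eM: "(c, t) \<in> M" if "c \<le> L" "e c t \<in> S" for c t using that by (simp add: M_def)
  have vcases: "(\<exists>c t. w = e c t \<and> (c, t) \<in> M) \<or> (\<exists>c\<in>Z. w = [c, 0, 0]) \<or> (\<exists>c\<in>O1. w = [c, 1, 1])"
    if wS: "w \<in> S" "w \<in> ?V" for w
  proof -
    obtain c a b where w: "w = [c, a, b]" "c \<le> L" "a \<le> 1" "b \<le> 1" "\<not> (c = 0 \<and> a = 0 \<and> b = 0)" "\<not> (c = L \<and> a = 1 \<and> b = 1)"
      using wS(2) by (auto simp: verts3 simp del: One_nat_def)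
    consider "a = 0" "b = 0" | "a = 1" "b = 1" | "a = 1" "b = 0" | "a = 0" "b = 1" using w(3,4) by linarith
    then show ?thesis
    proof cases
      case 1 then have "c \<in> Z" using w wS(1) by (auto simp: Z_def)
      then show ?thesis using w 1 by blast
    next
      case 2 then have "c \<in> O1" using w wS(1) by (auto simp: O1_def)
      then show ?thesis using w 2 by blast
    next
      case 3 then have "w = e c True" using w by (simp add: e_def)
      then show ?thesis using eM[OF w(2)] wS(1) by blast
    next
      case 4 then have "w = e c False" using w by (simp add: e_def)
      then show ?thesis using eM[OF w(2)] wS(1) by blast
    qed
  qed
  have cmp: "comparable vle (e v t) (e c s) \<longleftrightarrow> s = t" "comparable vle (e v t) [c, 0, 0] \<longleftrightarrow> c \<le> v"
    "comparable vle (e v t) [c, 1, 1] \<longleftrightarrow> v \<le> c" for v t c s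
    by (auto simp: e_def comparable_cong)
  have unl: "\<exists>c. w = e c (\<not> t) \<and> (c, \<not> t) \<in> M \<and> (v = 0 \<and> c = L \<or> v = L \<and> c = 0)"
    if "w \<in> S" "w \<in> ?V" "v \<le> L" "\<not> linked vle ?V (e v t) w" for w v t
  proof -
    note c = complementary[OF eV[OF that(3)] that(2,4)]
    have c0: "min v (w ! 0) = 0" "max v (w ! 0) = L" using c[of 0] by (auto simp: e_def)
    have c1: "min (if t then 1 else 0) (w ! 1) = 0" "max (if t then 1 else 0) (w ! 1) = (1::nat)" using c[of 1] by (auto simp: e_def)
    have c2: "min (if t then 0 else 1) (w ! 2) = 0" "max (if t then 0 else 1) (w ! 2) = (1::nat)"
      using c[of 2] by (auto simp: e_def numeral_2_eq_2)
    from vcases[OF that(1,2)] show ?thesis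
    proof (elim disjE exE bexE conjE)
      fix c s assume w: "w = e c s" "(c, s) \<in> M"
      have "s = (\<not> t)" using c1 c2 w(1) by (cases s; cases t) (auto simp: e_def)
      moreover have "v = 0 \<and> c = L \<or> v = L \<and> c = 0" using c0 w(1) L by (auto simp: e_def min_def max_def split: if_splits)
      ultimately show ?thesis using w by blast
    next
      fix c assume "w = [c, 0, 0]" then show ?thesis using c1 c2 by (cases t) auto
    next
      fix c assume "w = [c, 1, 1]" then show ?thesis using c1 c2 by (cases t) auto
    qed
  qed
  have res: "(\<exists>c\<in>Z. (c \<le> v) \<noteq> (c \<le> v')) \<or> (\<exists>c\<in>O1. (v \<le> c) \<noteq> (v' \<le> c)) \<or>
      (\<exists>u\<in>{v, v'}. u = 0 \<and> (L, \<not> t) \<in> M \<or> u = L \<and> (0, \<not> t) \<in> M)"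
    if v: "v \<le> L" "v' \<le> L" "v \<noteq> v'" "(v, t) \<notin> M" "(v', t) \<notin> M" for v v' t
  proof -
    have ne: "e v t \<noteq> e v' t" using v by (simp add: e_def)
    have nS: "e v t \<notin> S" "e v' t \<notin> S" using v eM by blast+
    obtain w where w: "w \<in> S" "w \<in> ?V" "comparable vle (e v t) w \<noteq> comparable vle (e v' t) w \<or>
       \<not> linked vle ?V (e v t) w \<or> \<not> linked vle ?V (e v' t) w"
      using weakly_resolvingE[OF weak eV[OF v(1)] eV[OF v(2)] nS ne] by blast
    from w(3) show ?thesis
    proof (elim disjE)
      assume ne: "comparable vle (e v t) w \<noteq> comparable vle (e v' t) w"
      from vcases[OF w(1,2)] show ?thesis
      proof (elim disjE exE bexE conjE)
        fix c s assume "w = e c s" then show ?thesis using ne by (simp add: cmp(1))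
      next
        fix c assume c: "c \<in> Z" "w = [c, 0, 0]"
        have "(c \<le> v) \<noteq> (c \<le> v')" using ne unfolding c(2) cmp(2) .
        then show ?thesis using c(1) by blast
      next
        fix c assume c: "c \<in> O1" "w = [c, 1, 1]"
        have "(v \<le> c) \<noteq> (v' \<le> c)" using ne unfolding c(2) cmp(3) .
        then show ?thesis using c(1) by blast
      qed
    next
      assume "\<not> linked vle ?V (e v t) w"
      from unl[OF w(1,2) v(1) this] v show ?thesis by auto
    next
      assume "\<not> linked vle ?V (e v' t) w"
      from unl[OF w(1,2) v(2) this] v show ?thesis by auto
    qed
  qed
  have cov: "\<exists>w\<in>M. (a, t) \<in> K w" if "a \<in> D" for a t
  proof -
    have a: "a < L" "Suc a \<notin> Z" "a \<notin> O1" using that by (auto simp: D_def)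
    consider "(a, t) \<in> M" | "(Suc a, t) \<in> M" | "(a, t) \<notin> M" "(Suc a, t) \<notin> M" by blast
    then show ?thesis
    proof cases
      case 1 then show ?thesis using a by (intro bexI[of _ "(a, t)"]) (auto simp: K_def)
    next
      case 2 then show ?thesis using a by (intro bexI[of _ "(Suc a, t)"]) (auto simp: K_def)
    next
      case 3
      have "\<not> (\<exists>c\<in>Z. (c \<le> a) \<noteq> (c \<le> Suc a))" "\<not> (\<exists>c\<in>O1. (a \<le> c) \<noteq> (Suc a \<le> c))"
        using a by (metis le_Suc_eq) (metis a(3) le_antisym not_less_eq_eq Suc_leD)
      then consider "a = 0" "(L, \<not> t) \<in> M" | "Suc a = L" "(0, \<not> t) \<in> M"
        using res[of a "Suc a" t] a 3 L by auto
      then show ?thesis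
      proof cases
        case 1 then show ?thesis using L by (intro bexI[of _ "(L, \<not> t)"]) (auto simp: K_def)
      next
        case 2 then show ?thesis using L by (intro bexI[of _ "(0, \<not> t)"]) (auto simp: K_def)
      qed
    qed
  qed
  have Kcard: "finite (K w) \<and> card (K w) \<le> 2" for w
    by (cases w) (auto simp: K_def card_insert_if)
  have pure: "L \<le> card D + card Z + card O1"
  proof -
    have "{..<L} \<subseteq> D \<union> ((\<lambda>c. c - 1) ` Z \<union> O1)" by (force simp: D_def)
    then have "card {..<L} \<le> card (D \<union> ((\<lambda>c. c - 1) ` Z \<union> O1))" by (rule card_mono[rotated]) (auto simp: finZO)
    also have "\<dots> \<le> card D + (card ((\<lambda>c. c - 1) ` Z) + card O1)"
      by (rule order_trans[OF card_Un_le]) (simp add: card_Un_le)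
    also have "\<dots> \<le> card D + (card Z + card O1)" using card_image_le[OF finZO(1)] by simp
    finally show ?thesis by simp
  qed
  have total: "card M + card Z + card O1 \<le> card S"
  proof -
    have "card M + card Z + card O1 = card ((\<lambda>(c, t). e c t) ` M) + card ((\<lambda>c. [c, 0, 0::nat]) ` Z) + card ((\<lambda>c. [c, 1, 1::nat]) ` O1)"
      by (subst (1 2 3) card_image) (auto simp: inj_on_def e_def split: if_splits)
    also have "card ((\<lambda>(c, t). e c t) ` M) + card ((\<lambda>c. [c, 0, 0::nat]) ` Z) = card ((\<lambda>(c, t). e c t) ` M \<union> (\<lambda>c. [c, 0, 0]) ` Z)"
      by (rule card_Un_disjoint[symmetric]) (auto simp: finM finZO e_def split: if_splits)
    also have "\<dots> + card ((\<lambda>c. [c, 1, 1::nat]) ` O1) = card ((\<lambda>(c, t). e c t) ` M \<union> (\<lambda>c. [c, 0, 0]) ` Z \<union> (\<lambda>c. [c, 1, 1]) ` O1)"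
      by (rule card_Un_disjoint[symmetric]) (auto simp: finM finZO e_def split: if_splits)
    also have "\<dots> \<le> card S" by (rule card_mono[OF fin]) (auto simp: M_def Z_def O1_def)
    finally show ?thesis .
  qed
  \<comment> \<open>Conversely, covering the \<open>2 * card D\<close> pairs by sets of size two
    takes at least \<open>card D\<close> of them.\<close>
  have MD: "card M \<le> card D" using pure total leq by linarith
  \<comment> \<open>The cover of \<open>D \<times> UNIV\<close> by the sets \<open>K w\<close> has no slack, hence it is a partition.\<close>
  have exact: "K w \<subseteq> D \<times> UNIV \<and> (\<forall>w'\<in>M - {w}. K w \<inter> K w' = {})" if w: "w \<in> M" for w
  proof -
    define R where "R = K w \<inter> (D \<times> UNIV) - (\<Union>w'\<in>M - {w}. K w')"
    have "D \<times> UNIV \<subseteq> R \<union> (\<Union>w'\<in>M - {w}. K w')" using cov w by (auto simp: R_def)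
    then have "card (D \<times> (UNIV :: bool set)) \<le> card (R \<union> (\<Union>w'\<in>M - {w}. K w'))"
      by (rule card_mono[rotated]) (use Kcard finM in \<open>auto simp: R_def\<close>)
    also have "\<dots> \<le> card R + card (\<Union>w'\<in>M - {w}. K w')" by (rule card_Un_le)
    also have "card (\<Union>w'\<in>M - {w}. K w') \<le> (\<Sum>w'\<in>M - {w}. card (K w'))" by (rule card_UN_le) (use finM in simp)
    also have "\<dots> \<le> (\<Sum>w'\<in>M - {w}. 2)" using Kcard by (intro sum_mono) auto
    also have "\<dots> = 2 * (card M - 1)" using w finM by simp
    finally have "2 * card D \<le> card R + 2 * (card M - 1)" by (simp add: card_cartesian_product)
    moreover have "1 \<le> card M" using w finM by (simp add: Suc_le_eq card_gt_0_iff) blast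
    ultimately have "2 \<le> card R" using MD by linarith
    then have "R = K w" using Kcard[of w] by (intro card_seteq) (auto simp: R_def)
    then show ?thesis by (auto simp: R_def)
  qed
  \<comment> \<open>For an inner \<open>c\<close> the steps on both sides lie in \<open>D\<close>,
    and exactness keeps their other settlers out of \<open>M\<close>. Nothing then separates the
    vertices of the column at \<open>c - 1\<close> and \<open>Suc c\<close>.\<close>
  have ends: "c = 0 \<or> c = L" if w: "(c, t) \<in> M" for c t
  proof (rule ccontr)
    assume "\<not> ?thesis"
    then have c: "0 < c" "c < L" using w by (auto simp: M_def)
    then have K: "K (c, t) = {(c - 1, t), (c, t)}" by (auto simp: K_def)
    then have D: "c - 1 \<in> D" "c \<in> D" using exact[OF w] by auto
    have kk: "(w' = (c, t) \<or> (c - 1, t) \<notin> K w' \<and> (c, t) \<notin> K w')" if "w' \<in> M" for w' using exact[OF w] that K by auto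
    have no: "(c - 1, t) \<notin> M" "(Suc c, t) \<notin> M" "c - 1 = 0 \<Longrightarrow> (L, \<not> t) \<notin> M" "Suc c = L \<Longrightarrow> (0, \<not> t) \<notin> M"
    proof -
      obtain k where k: "c = Suc k" using c by (cases c) auto
      show "(c - 1, t) \<notin> M" "(Suc c, t) \<notin> M" "c - 1 = 0 \<Longrightarrow> (L, \<not> t) \<notin> M" "Suc c = L \<Longrightarrow> (0, \<not> t) \<notin> M"
        using kk[of "(c - 1, t)"] kk[of "(Suc c, t)"] kk[of "(L, \<not> t)"] kk[of "(0, \<not> t)"] c(2)
        by (auto simp: K_def k split: if_splits)
    qed
    have "\<not> (\<exists>k\<in>Z. (k \<le> c - 1) \<noteq> (k \<le> Suc c))"
    proof clarify
      fix k assume k: "k \<in> Z" "(k \<le> c - 1) \<noteq> (k \<le> Suc c)"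
      then have "k = c \<or> k = Suc c" by auto
      then show False using D k(1) c by (auto simp: D_def)
    qed
    moreover have "\<not> (\<exists>k\<in>O1. (c - 1 \<le> k) \<noteq> (Suc c \<le> k))"
    proof clarify
      fix k assume k: "k \<in> O1" "(c - 1 \<le> k) \<noteq> (Suc c \<le> k)"
      then have "k = c - 1 \<or> k = c" by auto
      then show False using D k(1) by (auto simp: D_def)
    qed
    moreover have "c - 1 \<le> L" "Suc c \<le> L" "c - 1 \<noteq> Suc c" "c - 1 \<noteq> L" using c by linarith+
    ultimately show False using res[of "c - 1" "Suc c" t] no by auto
  qed
  \<comment> \<open>The other members compare alike with both columns and cannot tell
    \<open>e 1 True\<close> from \<open>e 1 False\<close>.\<close>
  have "M \<noteq> {}"
  proof
    assume "M = {}"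
    then have "e 1 True \<notin> S" "e 1 False \<notin> S" using L by (auto simp: M_def)
    moreover have "e 1 True \<noteq> e 1 False" by (simp add: e_def)
    ultimately obtain w where w: "w \<in> S" "w \<in> ?V" "comparable vle (e 1 True) w \<noteq> comparable vle (e 1 False) w \<or>
       \<not> linked vle ?V (e 1 True) w \<or> \<not> linked vle ?V (e 1 False) w"
      using weakly_resolvingE[OF weak eV[of 1 True] eV[of 1 False]] L by auto
    moreover have "linked vle ?V (e 1 t) w" for t using unl[OF w(1,2), of 1 t] L \<open>M = {}\<close> by auto
    ultimately have ne: "comparable vle (e 1 True) w \<noteq> comparable vle (e 1 False) w" using w(3) by blast
    from vcases[OF w(1,2)] show False
    proof (elim disjE exE bexE conjE)
      fix c t assume "(c, t) \<in> M" then show False using \<open>M = {}\<close> by simp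
    next
      fix c assume "w = [c, 0, 0]" with ne show False by (simp only: cmp(2))
    next
      fix c assume "w = [c, 1, 1]" with ne show False by (simp only: cmp(3))
    qed
  qed
  then obtain c t where ct: "(c, t) \<in> M" by auto
  \<comment> \<open>A member at an end settles the extreme step there in its own column and the
    opposite extreme step in the other column.\<close>
  have "{0, L - 1} \<subseteq> D"
    using exact[OF ct] ends[OF ct] L by (auto simp: K_def split: if_splits)
  then have "card {0, L - 1} \<le> card D" by (rule card_mono[OF finZO(3)])
  then have D2: "2 \<le> card D" using L by simp
  have MK: "card D \<le> card M"
  proof -
    have "card (D \<times> (UNIV :: bool set)) \<le> card (\<Union>w\<in>M. K w)"
      by (rule card_mono) (use Kcard finM cov in auto)
    also have "\<dots> \<le> (\<Sum>w\<in>M. card (K w))" by (rule card_UN_le[OF finM])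
    also have "\<dots> \<le> (\<Sum>w\<in>M. 2)" using Kcard by (intro sum_mono) auto
    finally show ?thesis by (simp add: card_cartesian_product)
  qed
  \<comment> \<open>The vertices \<open>[a, 1, 1]\<close> outside \<open>S\<close>, without
    \<open>[0, 1, 1]\<close> if its complement \<open>[L, 0, 0]\<close> is a member. Members of
    \<open>M\<close> sit at the ends and are below all of these vertices or comparable to none, so
    only \<open>[c, 0, 0]\<close> with \<open>c < L\<close> can separate them.\<close>
  define X where "X = {..<L} - O1 - (if L \<in> Z then {0} else {})"
  have "card X \<le> card ((\<lambda>c. c - 1) ` (Z - {L})) + 1"
  proof (rule card_separated)
    fix a a' assume a: "a \<in> X" "a' \<in> X" "a < a'"
    have V: "[a, 1, 1] \<in> ?V" "[a', 1, 1] \<in> ?V" using a by (auto simp: X_def verts3 simp del: One_nat_def)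
    have nS: "[a, 1, 1] \<notin> S" "[a', 1, 1] \<notin> S" using a by (auto simp: X_def O1_def)
    obtain w where w: "w \<in> S" "w \<in> ?V" "comparable vle [a, 1, 1] w \<noteq> comparable vle [a', 1, 1] w \<or>
       \<not> linked vle ?V [a, 1, 1] w \<or> \<not> linked vle ?V [a', 1, 1] w"
      using weakly_resolvingE[OF weak V nS] a(3) by auto
    have lk: "linked vle ?V [u, 1, 1] w" if u: "[u, 1, 1] \<in> ?V" "u \<in> X" for u
    proof (rule ccontr)
      assume nl: "\<not> linked vle ?V [u, 1, 1] w"
      note c = complementary[OF u(1) w(2) nl, of 0] complementary[OF u(1) w(2) nl, of 1] complementary[OF u(1) w(2) nl, of 2]
      from vcases[OF w(1,2)] show False
      proof (elim disjE exE bexE conjE)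
        fix c t assume "w = e c t" then show False using c(2,3) by (cases t) (auto simp: e_def numeral_2_eq_2)
      next
        fix c assume "c \<in> Z" "w = [c, 0, 0]"
        then show False using c(1) u(2) L by (auto simp: X_def min_def max_def split: if_splits)
      next
        fix c assume "w = [c, 1, 1]" then show False using c(2) by auto
      qed
    qed
    then have ne: "comparable vle [a, 1, 1] w \<noteq> comparable vle [a', 1, 1] w" using w(3) V a by blast
    from vcases[OF w(1,2)] show "\<exists>c\<in>(\<lambda>c. c - 1) ` (Z - {L}). a \<le> c \<and> c < a'"
    proof (elim disjE exE bexE conjE)
      fix c t assume m: "w = e c t" "(c, t) \<in> M"
      then show ?thesis using ends[OF m(2)] ne a by (cases t) (auto simp: e_def comparable_cong X_def)
    next
      fix c assume c: "c \<in> Z" "w = [c, 0, 0]"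
      then have "(c \<le> a) \<noteq> (c \<le> a')" using ne by (auto simp: comparable_cong)
      then have ca: "a < c" "c \<le> a'" using a(3) by auto
      then have "c \<noteq> L" using a(2) by (auto simp: X_def)
      then show ?thesis using c(1) ca by (intro bexI[of _ "c - 1"]) auto
    next
      fix c assume "w = [c, 1, 1]" then show ?thesis using ne by (auto simp: comparable_cong)
    qed
  qed (auto simp: X_def finZO)
  moreover have "card ((\<lambda>c. c - 1) ` (Z - {L})) \<le> card (Z - {L})" by (rule card_image_le) (simp add: finZO)
  moreover have "card (Z - {L}) + (if L \<in> Z then 1 else 0) = card Z"
    using finZO card_Suc_Diff1[of Z L] by auto
  moreover have "L \<le> card X + card O1 + (if L \<in> Z then 1 else 0)"
  proof -
    have "{..<L} \<subseteq> X \<union> O1 \<union> (if L \<in> Z then {0} else {})" by (auto simp: X_def)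
    then have "card {..<L} \<le> card (X \<union> O1 \<union> (if L \<in> Z then {0} else {}))"
      by (rule card_mono[rotated]) (auto simp: X_def finZO)
    also have "\<dots> \<le> card (X \<union> O1) + card (if L \<in> Z then {0::nat} else {})" by (rule card_Un_le)
    also have "\<dots> \<le> card X + card O1 + card (if L \<in> Z then {0::nat} else {})" using card_Un_le[of X O1] by simp
    finally show ?thesis by (auto split: if_splits)
  qed
  \<comment> \<open>Together with the two members of \<open>M\<close> this exceeds
    \<open>L\<close>.\<close>
  ultimately have "L \<le> card Z + card O1 + 1" by linarith
  then show False using D2 MK total leq by linarith
qed

section \<open>Distances in the inclusion ideal graph\<close>

text \<open>The distance is an infimum of walk lengths. As these are integers, both bounds amount to
  the existence of a short walk, and distances 1 and 2 can be recognised exactly.\<close>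

lemma graph_dist_bounds:
  assumes "wf_digraph (with_proj G)"
  shows "graph_dist G u v \<le> ereal (real n) \<longleftrightarrow> (\<exists>p. pre_digraph.awalk (with_proj G) u p v \<and> length p \<le> n)" (is ?leq)
    and "graph_dist G u v < ereal (real n + 1) \<longleftrightarrow> (\<exists>p. pre_digraph.awalk (with_proj G) u p v \<and> length p \<le> n)" (is ?less)
proof -
  interpret wf_digraph "with_proj G" by fact
  have cost: "awalk_cost (\<lambda>_. 1) p = real (length p)" for p by (induction p) auto
  have 1: "graph_dist G u v \<le> ereal (real n)" if "awalk u p v" "length p \<le> n" for p
    using that unfolding graph_dist_def \<mu>_def by (intro INF_lower2[of p]) (auto simp: cost)
  have 2: "ereal (real n + 1) \<le> graph_dist G u v" if "\<not> (\<exists>p. awalk u p v \<and> length p \<le> n)"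
    unfolding graph_dist_def \<mu>_def
  proof (rule INF_greatest)
    fix p assume "p \<in> {p. awalk u p v}"
    then have "n + 1 \<le> length p" using that by auto
    then show "ereal (real n + 1) \<le> ereal (awalk_cost (\<lambda>_. 1) p)" unfolding cost by simp
  qed
  have lt: "ereal (real n) < ereal (real n + 1)" by simp
  show ?leq using 1 2 lt by (meson less_le_not_le order_trans)
  show ?less using 1 2 lt by (meson leD le_less_trans)
qed

lemma short_awalk_iff:
  "length p \<le> 2 \<longleftrightarrow> p = [] \<or> (\<exists>e. p = [e]) \<or> (\<exists>e f. p = [e, f])"
  by (cases p; cases "tl p") auto

context
  fixes R :: "('r, 'x) ring_scheme" and G N
  defines "G \<equiv> inclusion_ideal_graph R" and "N \<equiv> nontrivial_ideals R"
begin

lemma wf_G: "wf_digraph (with_proj G)"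
  by unfold_locales (auto simp: G_def inclusion_ideal_graph_def)

lemma arcs_G: "(u, v) \<in> parcs G \<longleftrightarrow> u \<in> N \<and> v \<in> N \<and> u \<noteq> v \<and> comparable (\<subseteq>) u v"
  by (auto simp: G_def N_def inclusion_ideal_graph_def comparable_def)

lemma verts_G: "pverts G = N"
  by (simp add: G_def N_def inclusion_ideal_graph_def)

lemma dist_comparable:
  assumes "u \<in> N" "v \<in> N" "u \<noteq> v"
  shows "comparable (\<subseteq>) u v \<longleftrightarrow> graph_dist G u v = 1"
proof -
  interpret wf_digraph "with_proj G" by (rule wf_G)
  have "(\<exists>p. awalk u p v \<and> length p \<le> 1) \<longleftrightarrow> comparable (\<subseteq>) u v"
  proof
    assume "\<exists>p. awalk u p v \<and> length p \<le> 1"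
    then obtain p where p: "awalk u p v" "p = [] \<or> (\<exists>e. p = [e])" by (metis le_Suc_eq One_nat_def length_0_conv length_Suc_conv le_zero_eq)
    then show "comparable (\<subseteq>) u v" using assms by (auto simp: awalk_Nil_iff awalk_Cons_iff arcs_G)
  next
    assume "comparable (\<subseteq>) u v"
    then have "awalk u [(u, v)] v" using assms by (auto simp: awalk_Nil_iff awalk_Cons_iff arcs_G verts_G)
    then show "\<exists>p. awalk u p v \<and> length p \<le> 1" by force
  qed
  moreover have "\<not> (\<exists>p. awalk u p v \<and> length p \<le> 0)" using assms by (auto simp: awalk_Nil_iff)
  ultimately show ?thesis
    using graph_dist_bounds(1)[OF wf_G, of u v 1] graph_dist_bounds(2)[OF wf_G, of u v 0]
    by (auto simp: one_ereal_def)
qed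

text \<open>The witness in \<open>linked\<close> may be \<open>u\<close> or \<open>v\<close> itself,
  which is how distance 1 is included.\<close>

lemma dist_linked:
  assumes "u \<in> N" "v \<in> N" "u \<noteq> v"
  shows "linked (\<subseteq>) N u v \<longleftrightarrow> graph_dist G u v = 1 \<or> graph_dist G u v = 2"
proof -
  interpret wf_digraph "with_proj G" by (rule wf_G)
  have "(\<exists>p. awalk u p v \<and> length p \<le> 2) \<longleftrightarrow> linked (\<subseteq>) N u v"
  proof
    assume "\<exists>p. awalk u p v \<and> length p \<le> 2"
    then obtain p where p: "awalk u p v" "p = [] \<or> (\<exists>e. p = [e]) \<or> (\<exists>e f. p = [e, f])" by (auto simp: short_awalk_iff)
    from p(2) show "linked (\<subseteq>) N u v"
    proof (elim disjE exE)
      assume "p = []" then show ?thesis using p(1) assms by (simp add: awalk_Nil_iff)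
    next
      fix e assume "p = [e]"
      then have "(u, v) \<in> parcs G" using p(1) by (cases e) (auto simp: awalk_Nil_iff awalk_Cons_iff)
      then show ?thesis unfolding arcs_G linked_def comparable_def by blast
    next
      fix e f assume "p = [e, f]"
      then have "(u, snd e) \<in> parcs G" "(snd e, v) \<in> parcs G"
        using p(1) by (cases e; cases f; auto simp: awalk_Nil_iff awalk_Cons_iff)+
      then show ?thesis unfolding arcs_G linked_def comparable_def by blast
    qed
  next
    assume "linked (\<subseteq>) N u v"
    then obtain z where z: "z \<in> N" "comparable (\<subseteq>) z u" "comparable (\<subseteq>) z v" by (auto simp: linked_def)
    show "\<exists>p. awalk u p v \<and> length p \<le> 2"
    proof (cases "z = u \<or> z = v")
      case True
      then have "comparable (\<subseteq>) u v" using z by (auto simp: comparable_def)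
      then have "awalk u [(u, v)] v" using assms by (simp add: awalk_Nil_iff awalk_Cons_iff arcs_G verts_G)
      then show ?thesis by force
    next
      case False
      have "comparable (\<subseteq>) u z" using z(2) by (auto simp: comparable_def)
      then have "awalk u [(u, z), (z, v)] v" using assms z False by (auto simp: awalk_Nil_iff awalk_Cons_iff arcs_G verts_G)
      then show ?thesis by force
    qed
  qed
  then have *: "linked (\<subseteq>) N u v \<longleftrightarrow> graph_dist G u v \<le> 2"
    using graph_dist_bounds(1)[OF wf_G, of u v 2] by simp
  have "graph_dist G u v < 2 \<longleftrightarrow> graph_dist G u v \<le> 1"
    using graph_dist_bounds[OF wf_G, of u v 1] by (simp add: one_ereal_def)
  moreover have "\<not> graph_dist G u v < 1"
    using graph_dist_bounds(2)[OF wf_G, of u v 0] assms by (auto simp: awalk_Nil_iff one_ereal_def)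
  ultimately show ?thesis unfolding * by (auto simp: le_less)
qed

text \<open>Comparable means distance 1, linked means distance at most 2. A strongly resolving set
  separates by these two thresholds and is therefore resolving; conversely two linked pairs that
  agree in comparability have equal distances, so every resolving set is weakly resolving.\<close>

lemma metric_dimension_eqI:
  fixes leq :: "'v \<Rightarrow> 'v \<Rightarrow> bool"
  assumes bij: "bij_betw \<phi> N V"
    and leq: "\<And>I J. I \<in> N \<Longrightarrow> J \<in> N \<Longrightarrow> I \<subseteq> J \<longleftrightarrow> leq (\<phi> I) (\<phi> J)"
    and upper: "\<exists>S. finite S \<and> strongly_resolving leq V S \<and> card S = d"
    and lower: "\<And>S. finite S \<Longrightarrow> weakly_resolving leq V S \<Longrightarrow> d \<le> card S"
  shows "metric_dimension G = enat d"
proof (rule antisym)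
  have inj: "inj_on \<phi> N" and img: "\<phi> ` N = V" using bij by (auto simp: bij_betw_def)
  have cmp: "comparable leq (\<phi> u) (\<phi> v) \<longleftrightarrow> graph_dist G u v = 1" if "u \<in> N" "v \<in> N" "u \<noteq> v" for u v
    using dist_comparable[OF that] that leq by (auto simp: comparable_def)
  have lnk: "linked leq V (\<phi> u) (\<phi> v) \<longleftrightarrow> graph_dist G u v = 1 \<or> graph_dist G u v = 2" if "u \<in> N" "v \<in> N" "u \<noteq> v" for u v
    using dist_linked[OF that] that leq by (simp add: linked_def comparable_def img[symmetric])
  show "metric_dimension G \<le> enat d"
  proof -
    obtain S where S: "finite S" "strongly_resolving leq V S" "card S = d" using upper by blast
    have SV: "S \<subseteq> V" using S(2) by (simp add: strongly_resolving_def)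
    define S' where "S' = {I \<in> N. \<phi> I \<in> S}"
    have bS: "bij_betw \<phi> S' S" using inj SV img by (auto simp: S'_def bij_betw_def inj_on_def)
    then have "finite S'" using S(1) bij_betw_finite by blast
    then obtain vs where vs: "set vs = S'" "distinct vs" using finite_distinct_list by blast
    have "length vs = d" using vs bS S(3) distinct_card[of vs] bij_betw_same_card by metis
    moreover have "resolving G vs"
      unfolding resolving_def
    proof (intro conjI inj_onI)
      fix u v assume u: "u \<in> pverts G - set vs" and v: "v \<in> pverts G - set vs"
        and eq: "representation_vector G vs u = representation_vector G vs v"
      have uN: "u \<in> N" "v \<in> N" "\<phi> u \<notin> S" "\<phi> v \<notin> S" using u v vs by (auto simp: S'_def verts_G)
      have d: "graph_dist G u w = graph_dist G v w" if "w \<in> S'" for w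
        using eq that vs(1) by (auto simp: representation_vector_def)
      show "u = v"
      proof (rule ccontr)
        assume "u \<noteq> v"
        then have "\<phi> u \<noteq> \<phi> v" using inj uN by (auto simp: inj_on_def)
        moreover have "\<phi> u \<in> V - S" "\<phi> v \<in> V - S" using uN img by auto
        ultimately obtain w where w: "w \<in> S" "comparable leq (\<phi> u) w \<noteq> comparable leq (\<phi> v) w \<or>
            linked leq V (\<phi> u) w \<noteq> linked leq V (\<phi> v) w"
          using S(2) unfolding strongly_resolving_def by blast
        then obtain w' where w': "w' \<in> S'" "w = \<phi> w'" using bS by (auto simp: bij_betw_def)
        have "w' \<in> N" "u \<noteq> w'" "v \<noteq> w'" using w' uN w(1) by (auto simp: S'_def)
        then show False using w(2) d[OF w'(1)] uN by (simp add: w'(2) cmp lnk)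
      qed
    qed (use vs in \<open>auto simp: S'_def verts_G\<close>)
    ultimately show ?thesis unfolding metric_dimension_def by (intro INF_lower2[of vs]) auto
  qed
  show "enat d \<le> metric_dimension G"
    unfolding metric_dimension_def
  proof (rule INF_greatest)
    fix vs assume "vs \<in> {vs. resolving G vs}"
    then have r: "distinct vs" "set vs \<subseteq> N" "inj_on (representation_vector G vs) (N - set vs)"
      by (auto simp: resolving_def verts_G)
    have "weakly_resolving leq V (\<phi> ` set vs)"
      unfolding weakly_resolving_def
    proof (intro conjI ballI impI)
      fix u' v' assume u: "u' \<in> V - \<phi> ` set vs" and v: "v' \<in> V - \<phi> ` set vs" and ne: "u' \<noteq> v'"
      obtain u v where uv: "u \<in> N - set vs" "v \<in> N - set vs" "u' = \<phi> u" "v' = \<phi> v" using u v img by blast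
      have "u \<noteq> v" using ne uv by auto
      then have "representation_vector G vs u \<noteq> representation_vector G vs v" using r(3) uv by (auto simp: inj_on_def)
      then obtain w where w: "w \<in> set vs" "graph_dist G u w \<noteq> graph_dist G v w" by (auto simp: representation_vector_def)
      have "w \<in> N" "u \<noteq> w" "v \<noteq> w" using w r uv by auto
      then have "comparable leq u' (\<phi> w) \<noteq> comparable leq v' (\<phi> w) \<or> \<not> linked leq V u' (\<phi> w) \<or> \<not> linked leq V v' (\<phi> w)"
        using w(2) uv by (auto simp: cmp lnk)
      then show "\<exists>w\<in>\<phi> ` set vs. comparable leq u' w \<noteq> comparable leq v' w \<or> \<not> linked leq V u' w \<or> \<not> linked leq V v' w"
        using w(1) by blast
    qed (use r(2) img in auto)
    then have "d \<le> card (\<phi> ` set vs)" by (intro lower) auto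
    also have "\<dots> \<le> length vs" by (rule order_trans[OF card_image_le card_length]) simp
    finally show "enat d \<le> enat (length vs)" by simp
  qed
qed

end

section \<open>Ideals of products of chain rings\<close>

text \<open>An order isomorphism between the lattice of ideals and the product of chains of lengths
  \<open>Ls\<close>.\<close>

definition ideals_form_box :: "('a, 'b) ring_scheme \<Rightarrow> nat list \<Rightarrow> bool" where
  "ideals_form_box R Ls \<longleftrightarrow> (\<exists>\<phi>. bij_betw \<phi> {I. ideal I R} {v. vle v Ls} \<and>
     (\<forall>I J. ideal I R \<longrightarrow> ideal J R \<longrightarrow> (I \<subseteq> J \<longleftrightarrow> vle (\<phi> I) (\<phi> J))))"

lemma (in ring_hom_ring) ideal_image:
  assumes surj: "h ` carrier R = carrier S" and I: "ideal I R"
  shows "ideal (h ` I) S"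
proof -
  interpret I: ideal I R by fact
  show ?thesis
  proof (rule idealI)
    show "ring S" ..
    show "subgroup (h ` I) (add_monoid S)"
      by (rule group_hom.subgroup_img_is_subgroup[OF a_group_hom I.a_subgroup])
    fix a x assume a: "a \<in> h ` I" and x: "x \<in> carrier S"
    then obtain b y where q: "b \<in> I" "a = h b" "y \<in> carrier R" "x = h y" unfolding surj[symmetric] by blast
    then have "x \<otimes>\<^bsub>S\<^esub> a = h (y \<otimes> b)" "a \<otimes>\<^bsub>S\<^esub> x = h (b \<otimes> y)" using I.Icarr by simp_all
    then show "x \<otimes>\<^bsub>S\<^esub> a \<in> h ` I" "a \<otimes>\<^bsub>S\<^esub> x \<in> h ` I"
      using I.I_l_closed[OF q(1,3)] I.I_r_closed[OF q(1,3)] by blast+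
  qed
qed

lemma ideal_image_iso:
  assumes h: "h \<in> ring_iso R S" and rings: "ring R" "ring S"
  shows "ideal I R \<Longrightarrow> ideal (h ` I) S" and "ideal J S \<Longrightarrow> ideal {r \<in> carrier R. h r \<in> J} R"
proof -
  interpret hom: ring_hom_ring R S h
    using h rings by (intro ring_hom_ringI2) (auto simp: ring_iso_def)
  have bij: "bij_betw h (carrier R) (carrier S)" using h by (rule ring_iso_memE(5))
  show "ideal {r \<in> carrier R. h r \<in> J} R" if "ideal J S" for J using that by (rule hom.ideal_vimage)
  show "ideal (h ` I) S" if I: "ideal I R" for I
    using hom.ideal_image[OF _ I] bij by (simp add: bij_betw_def)
qed

lemma ideals_form_box_iso:
  assumes h: "h \<in> ring_iso R S" and rings: "ring R" "ring S" and box: "ideals_form_box S Ls"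
  shows "ideals_form_box R Ls"
proof -
  obtain \<phi> where \<phi>: "bij_betw \<phi> {I. ideal I S} {v. vle v Ls}"
    "\<And>I J. ideal I S \<Longrightarrow> ideal J S \<Longrightarrow> I \<subseteq> J \<longleftrightarrow> vle (\<phi> I) (\<phi> J)"
    using box unfolding ideals_form_box_def by blast
  have bij: "bij_betw h (carrier R) (carrier S)" using h by (rule ring_iso_memE(5))
  have sub: "I \<subseteq> carrier R" if "ideal I R" for I using that by (simp add: additive_subgroup.a_subset ideal.axioms(1))
  have subS: "I \<subseteq> carrier S" if "ideal I S" for I using that by (simp add: additive_subgroup.a_subset ideal.axioms(1))
  have mono: "h ` I \<subseteq> h ` J \<longleftrightarrow> I \<subseteq> J" if "ideal I R" "ideal J R" for I J
  proof
    assume hIJ: "h ` I \<subseteq> h ` J"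
    show "I \<subseteq> J"
    proof
      fix x assume "x \<in> I"
      then have "x \<in> carrier R" "h x \<in> h ` J" using sub[OF that(1)] hIJ by auto
      then show "x \<in> J" using inj_on_image_mem_iff[OF bij_betw_imp_inj_on[OF bij]] sub[OF that(2)] by blast
    qed
  qed blast
  have "bij_betw (\<lambda>I. h ` I) {I. ideal I R} {I. ideal I S}"
  proof (rule bij_betw_byWitness[where f' = "\<lambda>J. {r \<in> carrier R. h r \<in> J}"])
    show "\<forall>I\<in>{I. ideal I R}. {r \<in> carrier R. h r \<in> h ` I} = I"
    proof clarify
      fix I assume "ideal I R"
      then show "{r \<in> carrier R. h r \<in> h ` I} = I"
        using sub[of I] inj_on_image_mem_iff[of h "carrier R" _ I] bij by (auto simp: bij_betw_def)
    qed
    show "\<forall>J\<in>{I. ideal I S}. h ` {r \<in> carrier R. h r \<in> J} = J"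
    proof clarify
      fix J assume "ideal J S"
      moreover have "h ` {r \<in> carrier R. h r \<in> J} = J \<inter> h ` carrier R" by auto
      ultimately show "h ` {r \<in> carrier R. h r \<in> J} = J"
        using subS[of J] bij_betw_imp_surj_on[OF bij] by auto
    qed
  qed (use ideal_image_iso[OF h rings] in auto)
  then have "bij_betw (\<phi> \<circ> (\<lambda>I. h ` I)) {I. ideal I R} {v. vle v Ls}" using \<phi>(1) by (rule bij_betw_trans)
  moreover have "I \<subseteq> J \<longleftrightarrow> vle ((\<phi> \<circ> (\<lambda>I. h ` I)) I) ((\<phi> \<circ> (\<lambda>I. h ` I)) J)" if "ideal I R" "ideal J R" for I J
    using \<phi>(2)[of "h ` I" "h ` J"] ideal_image_iso(1)[OF h rings] mono[OF that] that by simp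
  ultimately show ?thesis unfolding ideals_form_box_def by blast
qed

lemma RDirProd_simps:
  "carrier (RDirProd R S) = carrier R \<times> carrier S" "\<zero>\<^bsub>RDirProd R S\<^esub> = (\<zero>\<^bsub>R\<^esub>, \<zero>\<^bsub>S\<^esub>)"
  "(a, b) \<oplus>\<^bsub>RDirProd R S\<^esub> (c, d) = (a \<oplus>\<^bsub>R\<^esub> c, b \<oplus>\<^bsub>S\<^esub> d)"
  "(a, b) \<otimes>\<^bsub>RDirProd R S\<^esub> (c, d) = (a \<otimes>\<^bsub>R\<^esub> c, b \<otimes>\<^bsub>S\<^esub> d)"
  by (auto simp: RDirProd_def DirProd_def monoid.defs)

lemma ideal_RDirProd:
  assumes rings: "ring R" "ring S"
  shows "ideal K (RDirProd R S) \<longleftrightarrow> (\<exists>I J. ideal I R \<and> ideal J S \<and> K = I \<times> J)"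
proof
  interpret R: ring R by fact
  interpret S: ring S by fact
  interpret RS: ring "RDirProd R S" using rings by (rule RDirProd_ring)
  have hom: "fst \<in> ring_hom (RDirProd R S) R" "snd \<in> ring_hom (RDirProd R S) S"
    by (auto simp: ring_hom_def RDirProd_def DirProd_def monoid.defs)
  interpret f: ring_hom_ring "RDirProd R S" R fst by (intro ring_hom_ringI2 rings hom RS.ring_axioms)
  interpret s: ring_hom_ring "RDirProd R S" S snd by (intro ring_hom_ringI2 rings hom RS.ring_axioms)
  {
    assume K: "ideal K (RDirProd R S)"
    interpret K: ideal K "RDirProd R S" by fact
    have sub: "K \<subseteq> carrier R \<times> carrier S" using K.a_subset by (simp add: RDirProd_simps)
    have "fst ` carrier (RDirProd R S) = carrier R" "snd ` carrier (RDirProd R S) = carrier S"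
      by (auto simp: RDirProd_simps)
    then have "ideal (fst ` K) R" "ideal (snd ` K) S" using f.ideal_image[OF _ K] s.ideal_image[OF _ K] by simp_all
    moreover have "K = fst ` K \<times> snd ` K"
    proof
      show "fst ` K \<times> snd ` K \<subseteq> K"
      proof clarify
        fix a b a' b' assume 1: "(a, b) \<in> K" "(a', b') \<in> K"
        then have c: "a \<in> carrier R" "b \<in> carrier S" "a' \<in> carrier R" "b' \<in> carrier S" using sub by auto
        \<comment> \<open>Multiplication by the two idempotents of the product isolates the
          components.\<close>
        have "(\<one>\<^bsub>R\<^esub>, \<zero>\<^bsub>S\<^esub>) \<otimes>\<^bsub>RDirProd R S\<^esub> (a, b) \<in> K" "(\<zero>\<^bsub>R\<^esub>, \<one>\<^bsub>S\<^esub>) \<otimes>\<^bsub>RDirProd R S\<^esub> (a', b') \<in> K"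
          by (rule K.I_l_closed, use 1 in \<open>simp_all add: RDirProd_simps(1)\<close>)+
        then have "(\<one>\<^bsub>R\<^esub>, \<zero>\<^bsub>S\<^esub>) \<otimes>\<^bsub>RDirProd R S\<^esub> (a, b) \<oplus>\<^bsub>RDirProd R S\<^esub> (\<zero>\<^bsub>R\<^esub>, \<one>\<^bsub>S\<^esub>) \<otimes>\<^bsub>RDirProd R S\<^esub> (a', b') \<in> K"
          by (rule K.a_closed)
        then show "(fst (a, b), snd (a', b')) \<in> K" using c by (simp add: RDirProd_simps)
      qed
    qed force
    ultimately show "\<exists>I J. ideal I R \<and> ideal J S \<and> K = I \<times> J" by blast
  }
  assume "\<exists>I J. ideal I R \<and> ideal J S \<and> K = I \<times> J"
  then obtain I J where IJ: "ideal I R" "ideal J S" "K = I \<times> J" by blast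
  have sub: "I \<subseteq> carrier R" "J \<subseteq> carrier S" using IJ by (simp_all add: additive_subgroup.a_subset ideal.axioms(1))
  have "K = {x \<in> carrier (RDirProd R S). fst x \<in> I} \<inter> {x \<in> carrier (RDirProd R S). snd x \<in> J}"
    using sub by (auto simp: IJ(3) RDirProd_simps)
  then show "ideal K (RDirProd R S)"
    using RS.i_intersect[OF f.ideal_vimage[OF IJ(1)] s.ideal_vimage[OF IJ(2)]] by simp
qed

lemma ideals_form_box_RDirProd:
  assumes rings: "ring R" "ring S" and box: "ideals_form_box R Ls" "ideals_form_box S Ks"
  shows "ideals_form_box (RDirProd R S) (Ls @ Ks)"
proof -
  obtain \<phi> where \<phi>: "bij_betw \<phi> {I. ideal I R} {v. vle v Ls}"
    "\<And>I J. ideal I R \<Longrightarrow> ideal J R \<Longrightarrow> I \<subseteq> J \<longleftrightarrow> vle (\<phi> I) (\<phi> J)"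
    using box(1) unfolding ideals_form_box_def by blast
  obtain \<psi> where \<psi>: "bij_betw \<psi> {I. ideal I S} {v. vle v Ks}"
    "\<And>I J. ideal I S \<Longrightarrow> ideal J S \<Longrightarrow> I \<subseteq> J \<longleftrightarrow> vle (\<psi> I) (\<psi> J)"
    using box(2) unfolding ideals_form_box_def by blast
  define \<theta> where "\<theta> K = \<phi> (fst ` K) @ \<psi> (snd ` K)" for K
  have ne: "I \<noteq> {}" "J \<noteq> {}" if "ideal I R" "ideal J S" for I J
    using that by (metis additive_subgroup.zero_closed empty_iff ideal.axioms(1))+
  have prod: "\<theta> (I \<times> J) = \<phi> I @ \<psi> J" if "ideal I R" "ideal J S" for I J
    using ne[OF that] by (simp add: \<theta>_def)
  have \<phi>v: "vle (\<phi> I) Ls" "length (\<phi> I) = length Ls" if "ideal I R" for I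
    using \<phi>(1) that by (auto simp: bij_betw_def dest: list_all2_lengthD)
  have \<psi>v: "vle (\<psi> I) Ks" if "ideal I S" for I using \<psi>(1) that by (auto simp: bij_betw_def)
  have mono: "K \<subseteq> K' \<longleftrightarrow> vle (\<theta> K) (\<theta> K')" if KK: "ideal K (RDirProd R S)" "ideal K' (RDirProd R S)" for K K'
  proof -
    obtain I J where IJ: "ideal I R" "ideal J S" "K = I \<times> J" using KK(1) unfolding ideal_RDirProd[OF rings] by blast
    obtain I' J' where IJ': "ideal I' R" "ideal J' S" "K' = I' \<times> J'" using KK(2) unfolding ideal_RDirProd[OF rings] by blast
    have "K \<subseteq> K' \<longleftrightarrow> I \<subseteq> I' \<and> J \<subseteq> J'" unfolding IJ(3) IJ'(3) times_subset_iff using ne[OF IJ(1,2)] by (simp only: simp_thms)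
    moreover have "I \<subseteq> I' \<and> J \<subseteq> J' \<longleftrightarrow> vle (\<phi> I) (\<phi> I') \<and> vle (\<psi> J) (\<psi> J')" by (simp only: \<phi>(2)[OF IJ(1) IJ'(1)] \<psi>(2)[OF IJ(2) IJ'(2)])
    moreover have "vle (\<theta> K) (\<theta> K') \<longleftrightarrow> vle (\<phi> I) (\<phi> I') \<and> vle (\<psi> J) (\<psi> J')"
      by (simp only: IJ(3) IJ'(3) prod[OF IJ(1,2)] prod[OF IJ'(1,2)]
          list_all2_append[OF trans[OF \<phi>v(2)[OF IJ(1)] \<phi>v(2)[OF IJ'(1), symmetric]]])
    ultimately show ?thesis by (simp only:)
  qed
  have "bij_betw \<theta> {K. ideal K (RDirProd R S)} {v. vle v (Ls @ Ks)}"
    unfolding bij_betw_def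
  proof
    show "inj_on \<theta> {K. ideal K (RDirProd R S)}"
    proof (rule inj_onI)
      fix K K' assume K: "K \<in> {K. ideal K (RDirProd R S)}" "K' \<in> {K. ideal K (RDirProd R S)}" and eq: "\<theta> K = \<theta> K'"
      have "vle (\<theta> K) (\<theta> K')" "vle (\<theta> K') (\<theta> K)" unfolding eq by (rule vle_refl)+
      then have "K \<subseteq> K'" "K' \<subseteq> K" using mono K by blast+
      then show "K = K'" by (rule equalityI)
    qed
    show "\<theta> ` {K. ideal K (RDirProd R S)} = {v. vle v (Ls @ Ks)}"
    proof (intro equalityI subsetI)
      fix v assume "v \<in> \<theta> ` {K. ideal K (RDirProd R S)}"
      then obtain I J where IJ: "ideal I R" "ideal J S" "v = \<theta> (I \<times> J)" unfolding ideal_RDirProd[OF rings] by blast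
      then show "v \<in> {v. vle v (Ls @ Ks)}" using \<phi>v(1) \<psi>v by (simp add: prod list_all2_appendI)
    next
      fix v assume "v \<in> {v. vle v (Ls @ Ks)}"
      then obtain a b where ab: "v = a @ b" "vle a Ls" "vle b Ks" by (auto simp: list_all2_append2)
      obtain I where I: "ideal I R" "\<phi> I = a"
        using ab(2) bij_betw_imp_surj_on[OF \<phi>(1)] by (metis (no_types, lifting) imageE mem_Collect_eq)
      obtain J where J: "ideal J S" "\<psi> J = b"
        using ab(3) bij_betw_imp_surj_on[OF \<psi>(1)] by (metis (no_types, lifting) imageE mem_Collect_eq)
      note IJ = I J
      have "v = \<theta> (I \<times> J)" using ab(1) IJ by (simp add: prod)
      then show "v \<in> \<theta> ` {K. ideal K (RDirProd R S)}" unfolding ideal_RDirProd[OF rings] using IJ by blast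
    qed
  qed
  then show ?thesis using mono unfolding ideals_form_box_def by blast
qed

text \<open>The empty product is the zero ring, where zero ideal and whole ring coincide; it starts
  the induction over the factors.\<close>

lemma ideals_form_box_trivial:
  assumes "ring R" and triv: "carrier R = {\<zero>\<^bsub>R\<^esub>}"
  shows "ideals_form_box R []"
proof -
  interpret ring R by fact
  have eq: "I = carrier R" if "ideal I R" for I
    using additive_subgroup.a_subset[OF ideal.axioms(1)[OF that]] additive_subgroup.zero_closed[OF ideal.axioms(1)[OF that]]
    unfolding triv by blast
  then have "{I. ideal I R} = {carrier R}" using oneideal by blast
  moreover have "I \<subseteq> J" if "ideal I R" "ideal J R" for I J using eq that by blast
  ultimately show ?thesis unfolding ideals_form_box_def
    by (intro exI[of _ "\<lambda>_. []"]) (simp add: bij_betw_def)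
qed

lemma ring_RDirProd_list: "(\<And>i. i \<in> set is \<Longrightarrow> ring (Rs i)) \<Longrightarrow> ring (RDirProd_list (map Rs is))"
  by (intro RDirProd_list_is_ring) auto

lemma ideals_form_box_RDirProd_list:
  assumes "\<And>i. i \<in> set is \<Longrightarrow> ring (Rs i)" "\<And>i. i \<in> set is \<Longrightarrow> ideals_form_box (Rs i) [f i]"
  shows "ideals_form_box (RDirProd_list (map Rs is)) (map f is)"
  using assms
proof (induction "is")
  case Nil
  have "ring (RDirProd_list (map Rs []))" by (rule ring_RDirProd_list) simp
  moreover have "carrier (RDirProd_list (map Rs [])) = {[]}"
    by (simp only: list.map RDirProd_list_nil nil_ring_simprules)
  moreover have "\<zero>\<^bsub>RDirProd_list (map Rs [])\<^esub> = []"
    by (simp only: list.map RDirProd_list_zero foldr.simps id_apply)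
  ultimately have "ideals_form_box (RDirProd_list (map Rs [])) []"
    by (intro ideals_form_box_trivial) (simp_all only:)
  then show ?case by (simp only: list.map)
next
  case (Cons i "is")
  let ?P = "RDirProd (Rs i) (RDirProd_list (map Rs is))"
  have rings: "ring (Rs i)" "ring (RDirProd_list (map Rs is))" "ring (RDirProd_list (map Rs (i # is)))"
    by (simp add: Cons.prems(1), rule ring_RDirProd_list, simp add: Cons.prems(1), rule ring_RDirProd_list, rule Cons.prems(1))
  have "(\<lambda>(a, as). a # as) \<in> ring_iso ?P (RDirProd_list (map Rs (i # is)))"
    using RDirProd_list_iso1 by simp
  then have iso: "inv_into (carrier ?P) (\<lambda>(a, as). a # as) \<in> ring_iso (RDirProd_list (map Rs (i # is))) ?P"
    by (rule ring_iso_set_sym[OF RDirProd_ring[OF rings(1,2)]])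
  have "ideals_form_box (RDirProd_list (map Rs is)) (map f is)"
    by (rule Cons.IH) (simp_all add: Cons.prems)
  then have "ideals_form_box ?P ([f i] @ map f is)"
    by (intro ideals_form_box_RDirProd rings Cons.prems(2)) simp_all
  then have "ideals_form_box (RDirProd_list (map Rs (i # is))) ([f i] @ map f is)"
    by (rule ideals_form_box_iso[OF iso rings(3) RDirProd_ring[OF rings(1,2)]])
  then show ?case by simp
qed

section \<open>The factors: fields and local rings\<close>

lemma ideals_form_box_chain:
  assumes "ring R" and fin: "finite {I. ideal I R}"
    and chain: "\<And>I J. ideal I R \<Longrightarrow> ideal J R \<Longrightarrow> I \<subseteq> J \<or> J \<subseteq> I"
  shows "ideals_form_box R [card {I. ideal I R} - 1]"
proof -
  interpret ring R by fact
  \<comment> \<open>The rank of an ideal in a finite chain is the number of ideals strictly inside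
    it.\<close>
  define r where "r I = card {J. ideal J R \<and> J \<subset> I}" for I
  have finr: "finite {J. ideal J R \<and> J \<subset> I}" for I by (rule finite_subset[OF _ fin]) auto
  have mono: "I \<subseteq> J \<longleftrightarrow> r I \<le> r J" if "ideal I R" "ideal J R" for I J
  proof
    assume "I \<subseteq> J" then show "r I \<le> r J" unfolding r_def by (intro card_mono finr) auto
  next
    assume le: "r I \<le> r J"
    have "r J < r I" if "\<not> I \<subseteq> J"
    proof -
      have "J \<subset> I" using that chain[OF \<open>ideal I R\<close> \<open>ideal J R\<close>] by auto
      then have "{K. ideal K R \<and> K \<subset> J} \<subset> {K. ideal K R \<and> K \<subset> I}" using \<open>ideal J R\<close> by auto
      then show ?thesis unfolding r_def by (intro psubset_card_mono finr)
    qed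
    then show "I \<subseteq> J" using le by fastforce
  qed
  let ?n = "card {I. ideal I R}"
  have inj: "inj_on r {I. ideal I R}"
  proof (rule inj_onI)
    fix I J assume "I \<in> {I. ideal I R}" "J \<in> {I. ideal I R}" "r I = r J"
    then show "I = J" using mono[of I J] mono[of J I] by auto
  qed
  have "r ` {I. ideal I R} \<subseteq> {..<?n}"
  proof clarify
    fix I assume "ideal I R"
    then have "{J. ideal J R \<and> J \<subset> I} \<subset> {I. ideal I R}" by auto
    then show "r I < ?n" unfolding r_def by (intro psubset_card_mono fin)
  qed
  then have img: "r ` {I. ideal I R} = {..<?n}" using inj by (intro card_subset_eq) (auto simp: card_image)
  have "?n \<noteq> 0" using fin oneideal by auto
  then have n: "{..<?n} = {..?n - 1}" by auto
  have "bij_betw (\<lambda>I. [r I]) {I. ideal I R} {v. vle v [?n - 1]}"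
    unfolding bij_betw_def
  proof
    show "inj_on (\<lambda>I. [r I]) {I. ideal I R}" using inj by (simp add: inj_on_def)
    have "(\<lambda>I. [r I]) ` {I. ideal I R} = (\<lambda>a. [a]) ` r ` {I. ideal I R}" by (simp only: image_image)
    also have "\<dots> = (\<lambda>a. [a]) ` {..?n - 1}" unfolding img n ..
    also have "\<dots> = {v. vle v [?n - 1]}" by (auto simp: list_all2_Cons2)
    finally show "(\<lambda>I. [r I]) ` {I. ideal I R} = {v. vle v [?n - 1]}" .
  qed
  then show ?thesis using mono unfolding ideals_form_box_def by (intro exI[of _ "\<lambda>I. [r I]"]) auto
qed

lemma ideals_form_box_field:
  assumes "field F"
  shows "ideals_form_box F [1]"
proof -
  interpret field F by fact
  have "carrier F \<noteq> {\<zero>\<^bsub>F\<^esub>}" using one_not_zero by (metis one_closed singletonD)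
  then have card: "card {I. ideal I F} = 2" unfolding all_ideals by (simp add: card_insert_if)
  have "I = {\<zero>\<^bsub>F\<^esub>} \<or> I = carrier F" if "ideal I F" for I using all_ideals that by blast
  then have "I \<subseteq> J \<or> J \<subseteq> I" if "ideal I F" "ideal J F" for I J
    using that by (metis empty_subsetI insert_subset subset_refl zero_closed)
  then show ?thesis
    using ideals_form_box_chain[OF ring_axioms, unfolded card] by (simp add: all_ideals)
qed

lemma (in cring) ex_maximalideal:
  assumes I: "ideal I R" "I \<noteq> carrier R"
  shows "\<exists>M. maximalideal M R \<and> I \<subseteq> M"
proof -
  \<comment> \<open>Properness is stated as \<open>\<one> \<notin> J\<close>, a condition that
    evidently passes to unions of chains.\<close>
  define A where "A = {J. ideal J R \<and> I \<subseteq> J \<and> \<one> \<notin> J}"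
  have "\<exists>M\<in>A. \<forall>J\<in>A. M \<subseteq> J \<longrightarrow> J = M"
  proof (rule subset_Zorn)
    fix C assume C: "subset.chain A C"
    show "\<exists>U\<in>A. \<forall>J\<in>C. J \<subseteq> U"
    proof (cases "C = {}")
      case True
      have "I \<in> A" using I ideal.one_imp_carrier[OF I(1)] by (auto simp: A_def)
      then show ?thesis using True by blast
    next
      case False
      have "C \<subseteq> A" using C by (simp add: subset_chain_def)
      moreover have "subset.chain {J. ideal J R} C" using C by (auto simp: subset_chain_def A_def)
      moreover from this have "ideal (\<Union>C) R" using chain_Union_is_ideal[of C] False by simp
      ultimately have "\<Union>C \<in> A" using False unfolding A_def by blast
      then show ?thesis by blast
    qed
  qed
  then obtain M where M: "M \<in> A" "\<forall>J\<in>A. M \<subseteq> J \<longrightarrow> J = M" by (rule bexE)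
  have "maximalideal M R"
  proof (rule maximalidealI)
    show "ideal M R" using M(1) unfolding A_def by blast
    show "carrier R \<noteq> M" using M(1) one_closed unfolding A_def by blast
    fix J assume J: "ideal J R" "M \<subseteq> J" "J \<subseteq> carrier R"
    show "J = M \<or> J = carrier R"
      using M J ideal.one_imp_carrier[OF J(1)] unfolding A_def by blast
  qed
  then show ?thesis using M(1) by (auto simp: A_def)
qed

text \<open>An order isomorphism matches bottom with bottom and top with top, so it restricts to the
  vertex sets.\<close>

lemma nontrivial_ideals_box:
  assumes "ring R" and box: "ideals_form_box R Ls"
  obtains \<phi> where "bij_betw \<phi> (nontrivial_ideals R) (vertices Ls)"
    "\<And>I J. I \<in> nontrivial_ideals R \<Longrightarrow> J \<in> nontrivial_ideals R \<Longrightarrow> I \<subseteq> J \<longleftrightarrow> vle (\<phi> I) (\<phi> J)"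
proof -
  interpret ring R by fact
  obtain \<phi> where \<phi>: "bij_betw \<phi> {I. ideal I R} {v. vle v Ls}"
    "\<And>I J. ideal I R \<Longrightarrow> ideal J R \<Longrightarrow> I \<subseteq> J \<longleftrightarrow> vle (\<phi> I) (\<phi> J)"
    using box unfolding ideals_form_box_def by blast
  have inj: "inj_on \<phi> {I. ideal I R}" and img: "\<phi> ` {I. ideal I R} = {v. vle v Ls}"
    using \<phi>(1) by (auto simp: bij_betw_def)
  obtain Z where Z: "ideal Z R" "\<phi> Z = zeros Ls"
    using img by (metis (mono_tags, lifting) imageE length_zeros mem_Collect_eq vle_zeros)
  have "vle (zeros Ls) (\<phi> {\<zero>\<^bsub>R\<^esub>})" using img zeroideal by (auto simp: vle_zeros dest!: list_all2_lengthD)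
  then have "Z \<subseteq> {\<zero>\<^bsub>R\<^esub>}" using \<phi>(2)[OF Z(1) zeroideal] Z(2) by simp
  then have "Z = {\<zero>\<^bsub>R\<^esub>}" using additive_subgroup.zero_closed[OF ideal.axioms(1)[OF Z(1)]] by blast
  then have zero: "\<phi> {\<zero>\<^bsub>R\<^esub>} = zeros Ls" using Z(2) by simp
  have "Ls \<in> \<phi> ` {I. ideal I R}" unfolding img by (simp add: vle_refl)
  then obtain T where T: "ideal T R" "\<phi> T = Ls" by auto
  have "vle (\<phi> (carrier R)) Ls" using img oneideal by blast
  then have "carrier R \<subseteq> T" using \<phi>(2)[OF oneideal T(1)] T(2) by simp
  then have "T = carrier R" using additive_subgroup.a_subset[OF ideal.axioms(1)[OF T(1)]] by blast
  then have one: "\<phi> (carrier R) = Ls" using T(2) by simp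
  have N: "nontrivial_ideals R = {I. ideal I R} - {{\<zero>\<^bsub>R\<^esub>}, carrier R}" by (auto simp: nontrivial_ideals_def)
  have "\<phi> ` nontrivial_ideals R = {v. vle v Ls} - {zeros Ls, Ls}"
    unfolding N using inj_on_image_set_diff[OF inj, of "{I. ideal I R}" "{{\<zero>\<^bsub>R\<^esub>}, carrier R}"] zeroideal oneideal
    by (simp add: img zero one)
  also have "\<dots> = vertices Ls" by (auto simp: vertices_def)
  finally have "bij_betw \<phi> (nontrivial_ideals R) (vertices Ls)"
    unfolding bij_betw_def using inj by (auto simp: N inj_on_diff)
  then show thesis using \<phi>(2) by (intro that[of \<phi>]) (auto simp: nontrivial_ideals_def)
qed

text \<open>The maximal ideal is generated by a nilpotent \<open>p\<close>, and every ideal is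
  generated by a power of \<open>p\<close>. With the two trivial ideals there are two more ideals
  than vertices, so the chain has length one more than the number of nontrivial ideals.\<close>

lemma ideals_form_box_local:
  assumes "local_ring R" "artinian_ring R" "principal_ideal_ring R" "\<not> field R"
  shows "ideals_form_box R [card (nontrivial_ideals R) + 1]" and "card (nontrivial_ideals R) \<ge> 1"
proof -
  interpret local_ring R by fact
  interpret artinian_ring R by fact
  interpret principal_ideal_ring R by fact
  obtain M where M: "maximalideal M R" "\<And>M'. maximalideal M' R \<Longrightarrow> M' = M" using unique_maximal by blast
  interpret M: maximalideal M R by fact
  \<comment> \<open>A non-unit generates a proper ideal, and this lies in the only maximal
    ideal.\<close>
  have unit: "x \<in> Units R" if x: "x \<in> carrier R" "x \<notin> M" for x
  proof (rule ccontr)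
    assume "x \<notin> Units R"
    then have "y \<otimes>\<^bsub>R\<^esub> x \<noteq> \<one>\<^bsub>R\<^esub>" if "y \<in> carrier R" for y
      using that x(1) m_comm[OF that x(1)] unfolding Units_def by auto
    then have "\<one>\<^bsub>R\<^esub> \<notin> PIdl\<^bsub>R\<^esub> x" unfolding cgenideal_def by force
    then have "PIdl\<^bsub>R\<^esub> x \<noteq> carrier R" by auto
    then have "PIdl\<^bsub>R\<^esub> x \<subseteq> M" using ex_maximalideal[OF cgenideal_ideal[OF x(1)]] M(2) by blast
    then show False using x cgenideal_self by blast
  qed
  have principal: "\<exists>x\<in>carrier R. I = PIdl\<^bsub>R\<^esub> x" if "ideal I R" for I
    using principalideal.generate[OF all_ideals_principal[OF that]] cgenideal_eq_genideal by force
  obtain p where p: "p \<in> carrier R" "M = PIdl\<^bsub>R\<^esub> p" using principal[OF M.is_ideal] by blast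
  define P where "P k = PIdl\<^bsub>R\<^esub> (p [^]\<^bsub>R\<^esub> (k::nat))" for k
  have PI: "ideal (P k) R" for k using p by (simp add: P_def cgenideal_ideal)
  have step: "P (Suc k) \<subseteq> P k" for k
  proof -
    have "p [^]\<^bsub>R\<^esub> Suc k = p \<otimes>\<^bsub>R\<^esub> p [^]\<^bsub>R\<^esub> k" using p(1) nat_pow_Suc2 by blast
    then have "p [^]\<^bsub>R\<^esub> Suc k \<in> P k" using p(1) unfolding P_def cgenideal_def by blast
    then show ?thesis unfolding P_def[of "Suc k"] by (rule cgenideal_minimal[OF PI])
  qed
  then have anti: "P j \<subseteq> P k" if "k \<le> j" for j k using that by (rule lift_Suc_antimono_le)
  obtain N where N: "\<And>k. k \<ge> N \<Longrightarrow> P k = P N" using descending_chain_condition[of P] PI step by blast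
  have "p [^]\<^bsub>R\<^esub> N \<in> P (Suc N)" using N[of "Suc N"] cgenideal_self[of "p [^]\<^bsub>R\<^esub> N"] p(1) unfolding P_def by simp
  then obtain r where r: "r \<in> carrier R" "p [^]\<^bsub>R\<^esub> N = r \<otimes>\<^bsub>R\<^esub> (p [^]\<^bsub>R\<^esub> N \<otimes>\<^bsub>R\<^esub> p)"
    unfolding P_def cgenideal_def by auto
  \<comment> \<open>Nakayama's argument for one generator: \<open>u\<close> lies outside
    \<open>M\<close>, hence is a unit, and it annihilates the \<open>N\<close>-th power of
    \<open>p\<close>.\<close>
  define u where "u = \<one>\<^bsub>R\<^esub> \<ominus>\<^bsub>R\<^esub> r \<otimes>\<^bsub>R\<^esub> p"
  have rp: "r \<otimes>\<^bsub>R\<^esub> p \<in> M" using r(1) unfolding p(2) cgenideal_def by blast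
  have u: "u \<in> carrier R" using r(1) p(1) by (simp add: u_def)
  have "u \<notin> M"
  proof
    assume "u \<in> M"
    then have "u \<oplus>\<^bsub>R\<^esub> r \<otimes>\<^bsub>R\<^esub> p \<in> M" using rp by (rule M.a_closed)
    moreover have "u \<oplus>\<^bsub>R\<^esub> r \<otimes>\<^bsub>R\<^esub> p = \<one>\<^bsub>R\<^esub>" unfolding u_def using r(1) p(1) by algebra
    ultimately show False using M.one_imp_carrier M.I_notcarr by simp
  qed
  then have "u \<in> Units R" using unit u by blast
  moreover have "u \<otimes>\<^bsub>R\<^esub> p [^]\<^bsub>R\<^esub> N = \<zero>\<^bsub>R\<^esub>"
  proof -
    have q: "p [^]\<^bsub>R\<^esub> N \<in> carrier R" using p by simp
    have "u \<otimes>\<^bsub>R\<^esub> p [^]\<^bsub>R\<^esub> N = p [^]\<^bsub>R\<^esub> N \<ominus>\<^bsub>R\<^esub> r \<otimes>\<^bsub>R\<^esub> (p [^]\<^bsub>R\<^esub> N \<otimes>\<^bsub>R\<^esub> p)"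
      unfolding u_def using r(1) p(1) q by algebra
    also have "\<dots> = p [^]\<^bsub>R\<^esub> N \<ominus>\<^bsub>R\<^esub> p [^]\<^bsub>R\<^esub> N" unfolding r(2)[symmetric] ..
    also have "\<dots> = \<zero>\<^bsub>R\<^esub>" using q by (simp add: minus_eq r_neg)
    finally show ?thesis .
  qed
  ultimately have nil: "p [^]\<^bsub>R\<^esub> N = \<zero>\<^bsub>R\<^esub>" 
    using Units_l_cancel[of u "p [^]\<^bsub>R\<^esub> N" "\<zero>\<^bsub>R\<^esub>"] p(1) u by simp
  have powers: "\<exists>k\<le>N. I = P k" if II: "ideal I R" for I
  proof -
    obtain x where x: "x \<in> carrier R" "I = PIdl\<^bsub>R\<^esub> x" using principal[OF II] by blast
    show ?thesis
    proof (cases "x = \<zero>\<^bsub>R\<^esub>")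
      case True
      then show ?thesis using x nil by (auto simp: P_def)
    next
      case False
      have "x = x \<otimes>\<^bsub>R\<^esub> p [^]\<^bsub>R\<^esub> (0::nat)" using x(1) by simp
      then have "x \<in> P 0" using x(1) unfolding P_def cgenideal_def by blast
      moreover have "x \<notin> P N" using False by (auto simp: P_def nil cgenideal_def)
      \<comment> \<open>The last power whose ideal contains \<open>x\<close>. The cofactor of
        \<open>x\<close> is then a unit, and \<open>x\<close> generates the same ideal as that
        power.\<close>
      ultimately obtain k where k: "k < N" "x \<in> P k" "x \<notin> P (Suc k)"
        using ex_least_nat_less[of "\<lambda>k. x \<notin> P k" N] by blast
      obtain v where v: "v \<in> carrier R" "x = v \<otimes>\<^bsub>R\<^esub> p [^]\<^bsub>R\<^esub> k" 
        using k(2) unfolding P_def cgenideal_def by blast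
      have "v \<notin> M"
      proof
        assume "v \<in> M"
        then obtain s where s: "s \<in> carrier R" "v = s \<otimes>\<^bsub>R\<^esub> p" unfolding p(2) cgenideal_def by blast
        have "x = s \<otimes>\<^bsub>R\<^esub> p [^]\<^bsub>R\<^esub> Suc k"
          unfolding v(2) s(2) nat_pow_Suc2[OF p(1)] using s(1) p(1) by (simp add: m_assoc)
        then show False using k(3) s(1) unfolding P_def cgenideal_def by blast
      qed
      then have vU: "v \<in> Units R" using unit v by blast
      have "p [^]\<^bsub>R\<^esub> k = inv\<^bsub>R\<^esub> v \<otimes>\<^bsub>R\<^esub> x" 
        unfolding v(2) using m_assoc[OF Units_inv_closed[OF vU] v(1), of "p [^]\<^bsub>R\<^esub> k"] Units_l_inv[OF vU] p(1) by simp
      then have "p [^]\<^bsub>R\<^esub> k \<in> I" unfolding x(2) cgenideal_def using Units_inv_closed[OF vU] by blast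
      then have "P k \<subseteq> I" unfolding P_def using II by (intro cgenideal_minimal)
      moreover have "I \<subseteq> P k" unfolding x(2) using k(2) PI by (intro cgenideal_minimal)
      ultimately show ?thesis using k(1) by (intro exI[of _ k]) auto
    qed
  qed
  have "{I. ideal I R} \<subseteq> P ` {..N}" using powers by auto
  then have fin: "finite {I. ideal I R}" by (rule finite_subset) simp
  have chain: "I \<subseteq> J \<or> J \<subseteq> I" if "ideal I R" "ideal J R" for I J
    using powers[OF that(1)] powers[OF that(2)] anti by (metis linear)
  have ne: "carrier R \<noteq> {\<zero>\<^bsub>R\<^esub>}"
  proof
    assume eq: "carrier R = {\<zero>\<^bsub>R\<^esub>}"
    have "M = carrier R"
      using M.a_subset additive_subgroup.zero_closed[OF M.additive_subgroup_axioms] unfolding eq by blast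
    then show False using M.I_notcarr by simp
  qed
  have split: "{I. ideal I R} = insert {\<zero>\<^bsub>R\<^esub>} (insert (carrier R) (nontrivial_ideals R))"
    using zeroideal oneideal unfolding nontrivial_ideals_def by blast
  have finN: "finite (nontrivial_ideals R)" using fin unfolding split by simp
  have "card {I. ideal I R} = card (nontrivial_ideals R) + 2"
    unfolding split using ne finN by (simp add: nontrivial_ideals_def)
  then show "ideals_form_box R [card (nontrivial_ideals R) + 1]"
    using ideals_form_box_chain[OF ring_axioms fin chain] by simp
  have "nontrivial_ideals R \<noteq> {}" using trivialideals_eq_field[OF ne] assms(4) unfolding split by blast
  then show "card (nontrivial_ideals R) \<ge> 1" using finN by (simp add: Suc_le_eq card_gt_0_iff)
qed

section \<open>From ideals to metric dimension: the three cases\<close>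

lemma metric_dimension_box:
  assumes "ring R" "ideals_form_box R Ls"
    and "\<exists>S. finite S \<and> strongly_resolving vle (vertices Ls) S \<and> card S = d"
    and "\<And>S. finite S \<Longrightarrow> weakly_resolving vle (vertices Ls) S \<Longrightarrow> d \<le> card S"
  shows "metric_dimension (inclusion_ideal_graph R) = enat d"
proof -
  obtain \<phi> where "bij_betw \<phi> (nontrivial_ideals R) (vertices Ls)"
    "\<And>I J. I \<in> nontrivial_ideals R \<Longrightarrow> J \<in> nontrivial_ideals R \<Longrightarrow> I \<subseteq> J \<longleftrightarrow> vle (\<phi> I) (\<phi> J)"
    using nontrivial_ideals_box[OF assms(1,2)] by blast
  then show ?thesis by (rule metric_dimension_eqI) (use assms(3,4) in blast)+
qed

theorem theorem3p2:
  fixes R :: "('r, 'x) ring_scheme"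
    and Rs :: "nat \<Rightarrow> ('a, 'y) ring_scheme"
    and Fs :: "nat \<Rightarrow> ('b, 'z) ring_scheme"
    and m n :: nat
    and \<nu> :: "nat \<Rightarrow> nat"
  assumes "m \<ge> 1" and "n \<ge> 1"
    and "cring R"
    and "R \<simeq> RDirProd (RDirProd_list (map Rs [1..<Suc m])) (RDirProd_list (map Fs [1..<Suc n]))"
    and "\<And>i. i \<in> {1..m} \<Longrightarrow> local_ring (Rs i)"
    and "\<And>i. i \<in> {1..m} \<Longrightarrow> artinian_ring (Rs i)"
    and "\<And>i. i \<in> {1..m} \<Longrightarrow> principal_ideal_ring (Rs i)"
    and "\<And>i. i \<in> {1..m} \<Longrightarrow> \<not> field (Rs i)"
    and "\<And>j. j \<in> {1..n} \<Longrightarrow> field (Fs j)"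
    and "\<And>i. i \<in> {1..m} \<Longrightarrow> \<nu> i = card (nontrivial_ideals (Rs i))"
  shows "(m = 1 \<and> n = 1 \<longrightarrow>
            metric_dimension (inclusion_ideal_graph R) = enat (n + m + \<nu> 1 - 2) \<and>
            n + m + \<nu> 1 - 2 = \<nu> 1) \<and>
         (m = 1 \<and> n = 2 \<longrightarrow>
            metric_dimension (inclusion_ideal_graph R) = enat (n + m + \<nu> 1 - 1) \<and>
            n + m + \<nu> 1 - 1 = \<nu> 1 + 2) \<and>
         (n \<ge> 3 \<longrightarrow>
            metric_dimension (inclusion_ideal_graph R) = enat ((\<Sum>i = 1..m. \<nu> i) + m + n))"
proof -
  have ringR: "ring R" using assms(3) by (rule cring.axioms(1))
  have mem: "i \<in> {1..k}" if "i \<in> set [1..<Suc k]" for i k using that by auto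
  have local: "ring (Rs i)" "ideals_form_box (Rs i) [\<nu> i + 1]" "1 \<le> \<nu> i" if "i \<in> {1..m}" for i
    using ideals_form_box_local[OF assms(5-8)[OF that]] cring.axioms(1)[OF local_ring.axioms(1)[OF assms(5)[OF that]]]
    by (simp_all only: assms(10)[OF that])
  have fields: "ring (Fs j)" "ideals_form_box (Fs j) [1]" if "j \<in> {1..n}" for j
    using assms(9)[OF that] ideals_form_box_field by (auto intro: cring.axioms(1) fieldE(1))
  let ?S = "RDirProd_list (map Rs [1..<Suc m])" and ?T = "RDirProd_list (map Fs [1..<Suc n])"
  let ?Ls = "map (\<lambda>i. \<nu> i + 1) [1..<Suc m] @ map (\<lambda>_. 1) [1..<Suc n]"
  have rings: "ring ?S" "ring ?T"
    by (rule ring_RDirProd_list, rule local(1), erule mem, rule ring_RDirProd_list, rule fields(1), erule mem)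
  have "ideals_form_box ?S (map (\<lambda>i. \<nu> i + 1) [1..<Suc m])"
    by (rule ideals_form_box_RDirProd_list, rule local(1), erule mem, rule local(2), erule mem)
  moreover have "ideals_form_box ?T (map (\<lambda>_. 1) [1..<Suc n])"
    by (rule ideals_form_box_RDirProd_list, rule fields(1), erule mem, rule fields(2), erule mem)
  ultimately have "ideals_form_box (RDirProd ?S ?T) ?Ls" by (rule ideals_form_box_RDirProd[OF rings])
  moreover obtain h where "h \<in> ring_iso R (RDirProd ?S ?T)"
    using assms(4) unfolding is_ring_iso_def by blast
  ultimately have box: "ideals_form_box R ?Ls"
    using ideals_form_box_iso[OF _ ringR RDirProd_ring[OF rings]] by blast
  have \<nu>1: "1 \<le> \<nu> 1" using local(3)[of 1] assms(1) by simp
  show ?thesis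
  proof (intro conjI impI)
    assume mn: "m = 1 \<and> n = 1"
    \<comment> \<open>The chain length is \<open>\<nu> 1 + 1\<close>, so the bound
      \<open>L - 1\<close> becomes \<open>\<nu> 1\<close>; in the next case \<open>L + 1\<close>
      becomes \<open>\<nu> 1 + 2\<close>.\<close>
    have "?Ls = [\<nu> 1 + 1, 1]" using mn by (simp add: upt_rec)
    then have "metric_dimension (inclusion_ideal_graph R) = enat (\<nu> 1)"
      using metric_dimension_box[OF ringR box, of "\<nu> 1"] upper2[of "\<nu> 1 + 1"] lower2[of "\<nu> 1 + 1"] \<nu>1 by simp
    then show "metric_dimension (inclusion_ideal_graph R) = enat (n + m + \<nu> 1 - 2)" using mn by simp
  next
    assume mn: "m = 1 \<and> n = 2"
    have "?Ls = [\<nu> 1 + 1, 1, 1]" using mn by (simp add: upt_rec)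
    then have "metric_dimension (inclusion_ideal_graph R) = enat (\<nu> 1 + 2)"
      using metric_dimension_box[OF ringR box, of "\<nu> 1 + 2"] upper3[of "\<nu> 1 + 1"] lower3[of "\<nu> 1 + 1"] \<nu>1 by simp
    then show "metric_dimension (inclusion_ideal_graph R) = enat (n + m + \<nu> 1 - 1)" using mn by simp
  next
    assume n: "3 \<le> n"
    \<comment> \<open>The local factor with index 1 provides the long coordinate and three fields
      provide the cube; all other factors go into \<open>Ks\<close>.\<close>
    define Ks where "Ks = map (\<lambda>i. \<nu> i + 1) [2..<Suc m] @ replicate (n - 3) 1"
    have "replicate n (1::nat) = replicate (n - 3) 1 @ replicate 3 1" using n by (simp flip: replicate_add)
    then have fs: "map (\<lambda>_. 1::nat) [1..<Suc n] = replicate (n - 3) 1 @ [1, 1, 1]"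
      by (simp add: map_replicate_const numeral_3_eq_3 del: upt_Suc)
    have rs: "map (\<lambda>i. \<nu> i + 1) [1..<Suc m] = (\<nu> 1 + 1) # map (\<lambda>i. \<nu> i + 1) [2..<Suc m]"
      using assms(1) by (simp add: upt_conv_Cons numeral_2_eq_2 del: upt_Suc)
    have Ls: "?Ls = (\<nu> 1 + 1) # Ks @ [1, 1, 1]" unfolding fs rs Ks_def by simp
    have sum: "sum_list ?Ls = (\<Sum>i = 1..m. \<nu> i) + m + n"
    proof -
      have "sum_list (map (\<lambda>i. \<nu> i + 1) [1..<Suc m]) = (\<Sum>i = 1..m. \<nu> i + 1)"
        by (simp add: interv_sum_list_conv_sum_set_nat atLeastLessThanSuc_atLeastAtMost del: upt_Suc)
      also have "\<dots> = (\<Sum>i = 1..m. \<nu> i) + m" by (simp only: sum.distrib) simp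
      finally have "sum_list (map (\<lambda>i. \<nu> i + 1) [1..<Suc m]) = (\<Sum>i = 1..m. \<nu> i) + m" .
      moreover have "sum_list (map (\<lambda>_. 1::nat) [1..<Suc n]) = n"
        by (simp add: map_replicate_const sum_list_replicate del: upt_Suc)
      ultimately show ?thesis by (simp only: sum_list.append)
    qed
    show "metric_dimension (inclusion_ideal_graph R) = enat ((\<Sum>i = 1..m. \<nu> i) + m + n)"
    proof (rule metric_dimension_box[OF ringR box])
      have "2 \<le> length ?Ls" using n by simp
      moreover have "1 \<le> L" if "L \<in> set ?Ls" for L using that by auto
      ultimately show "\<exists>S. finite S \<and> strongly_resolving vle (vertices ?Ls) S \<and> card S = (\<Sum>i = 1..m. \<nu> i) + m + n"
        unfolding sum[symmetric] by (rule axis_bound)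
      fix S assume S: "finite S" "weakly_resolving vle (vertices ?Ls) S"
      interpret hexchain "\<nu> 1 + 1" Ks S
      proof
        show "2 \<le> \<nu> 1 + 1" using \<nu>1 by simp
        show "weakly_resolving vle (vertices ((\<nu> 1 + 1) # Ks @ [1, 1, 1])) S" using S(2) unfolding Ls .
      qed (rule S(1))
      have "sum_list ?Ls = \<nu> 1 + 1 + sum_list Ks + 3" unfolding Ls by simp
      then show "(\<Sum>i = 1..m. \<nu> i) + m + n \<le> card S" using card_S unfolding sum by (simp only:)
    qed
  qed (use \<nu>1 in auto)
qed

end
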